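(* Let $\mathcal{M} \models \mathsf{PA}$ be countable and recursively saturated. Let $\theta$ be an atomic sentence and $F$ a local idempotent sentential operator for $\theta$. Let $X \subseteq M$ be separable, closed under successors and predecessors, and such that for each $n \in \omega$, $n \in X$ if and only if $\mathcal{M} \models \theta$. Then $\mathcal{M}$ has an expansion $(\mathcal{M}, S) \models \mathsf{CS}^-$ such that $X = \{ x \in M : (\mathcal{M}, S) \models T(F(x)) \equiv T(\theta) \}$.
   Context: A (full) satisfaction class on $\mathcal{M} \models \mathsf{PA}$ is a set $S \subseteq M^2$ such that $(\mathcal{M}, S) \models \mathsf{CS}^-$, i.e.: every element of $S$ is a pair $(\phi,\alpha)$ with $\phi$ an $\mathcal{L}_{\mathsf{PA}}$-formula in the sense of $\mathcal{M}$ and $\alpha$ an assignment for $\phi$ (assigning values to exactly the free variables of $\phi$); for atomic $s = t$, $S(s=t,\alpha)$ iff $s^\alpha = t^\alpha$; $S(\phi \vee \psi, \alpha)$ iff $S(\phi, \alpha\restriction\phi)$ or $S(\psi,\alpha\restriction\psi)$; $S(\neg\phi,\alpha)$ iff not $S(\phi,\alpha)$; $S(\exists v \phi,\alpha)$ iff there is $\beta$ differing from $\alpha$ at most at $v$ with $S(\phi,\beta\restriction\phi)$. For a sentence $\phi$, $T(\phi)$ abbreviates $S(\phi,\emptyset)$. For $a, n \in M$, $(a)_n$ is the $n$-th element of the sequence coded by $a$ and $n \in c$ means membership in the set coded by $c$. A set $X \subseteq M$ is separable if for each $a \in M$ there is $c \in M$ such that for each $n \in \omega$, $(a)_n \in X$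 iff $\mathcal{M} \models n \in c$. Local idempotent sentential operator: fix a standard sentence $\theta$ and a finite propositional template $\Phi(p,q)$ (built from propositional connectives and quantifiers over dummy variables) of non-zero complexity such that $q$ occurs in $\Phi(p,q)$, if $\mathcal{M}\models\theta$ then $\Phi(\top,q)$ is equivalent to $q$, and if $\mathcal{M}\models\neg\theta$ then $\Phi(\bot,q)$ is equivalent to $q$. Then $F: M \to \mathrm{Sent}^{\mathcal{M}}$ is defined (in $\mathcal{M}$) by $F(0) = \theta$ and $F(x+1) = \Phi(\theta, F(x))$.
   Formalization: If θ is false in M the stated equality is impossible, since F(0)=θ puts 0 in {x : T(F(x)) ≡ T(θ)} while 0 is not in X; in that case the formal theorem states that X is the complement of this set. For θ true the equality is as stated. *)

theory Defs
  imports Main "HOL-Library.Countable_Set"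
begin

section \<open>First-order arithmetic\<close>

text \<open>The language is $0, S, +, \cdot$ with equality; the primitive logical symbols are negation,
  disjunction and the existential quantifier, as in the compositional clauses below.
  The universe of a structure is the whole type.\<close>

datatype tm = Var nat | Zero | Succ tm | Plus tm tm | Times tm tm

datatype fm = Eq tm tm | Neg fm | Or fm fm | Ex nat fm

abbreviation Imp :: "fm \<Rightarrow> fm \<Rightarrow> fm" where
  "Imp f g \<equiv> Or (Neg f) g"

abbreviation All :: "nat \<Rightarrow> fm \<Rightarrow> fm" where
  "All v f \<equiv> Neg (Ex v (Neg f))"

record 'm arith =
  zr :: 'm
  sc :: "'m \<Rightarrow> 'm"
  ad :: "'m \<Rightarrow> 'm \<Rightarrow> 'm"
  ml :: "'m \<Rightarrow> 'm \<Rightarrow> 'm"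

fun tm_val :: "'m arith \<Rightarrow> (nat \<Rightarrow> 'm) \<Rightarrow> tm \<Rightarrow> 'm" where
  "tm_val M e (Var v) = e v"
| "tm_val M e Zero = zr M"
| "tm_val M e (Succ t) = sc M (tm_val M e t)"
| "tm_val M e (Plus s t) = ad M (tm_val M e s) (tm_val M e t)"
| "tm_val M e (Times s t) = ml M (tm_val M e s) (tm_val M e t)"

fun sat :: "'m arith \<Rightarrow> (nat \<Rightarrow> 'm) \<Rightarrow> fm \<Rightarrow> bool" where
  "sat M e (Eq s t) \<longleftrightarrow> tm_val M e s = tm_val M e t"
| "sat M e (Neg f) \<longleftrightarrow> \<not> sat M e f"
| "sat M e (Or f g) \<longleftrightarrow> sat M e f \<or> sat M e g"
| "sat M e (Ex v f) \<longleftrightarrow> (\<exists>x. sat M (e(v := x)) f)"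

fun tm_vars :: "tm \<Rightarrow> nat set" where
  "tm_vars (Var v) = {v}"
| "tm_vars Zero = {}"
| "tm_vars (Succ t) = tm_vars t"
| "tm_vars (Plus s t) = tm_vars s \<union> tm_vars t"
| "tm_vars (Times s t) = tm_vars s \<union> tm_vars t"

fun fvars :: "fm \<Rightarrow> nat set" where
  "fvars (Eq s t) = tm_vars s \<union> tm_vars t"
| "fvars (Neg f) = fvars f"
| "fvars (Or f g) = fvars f \<union> fvars g"
| "fvars (Ex v f) = fvars f - {v}"

definition sentence :: "fm \<Rightarrow> bool" where
  "sentence f \<longleftrightarrow> fvars f = {}"

definition atomic :: "fm \<Rightarrow> bool" where
  "atomic f \<longleftrightarrow> (\<exists>s t. f = Eq s t)"

text \<open>For a formula with free variables this is truth of its universal closure.\<close>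

definition models :: "'m arith \<Rightarrow> fm \<Rightarrow> bool" where
  "models M f \<longleftrightarrow> (\<forall>e. sat M e f)"

fun tm_subst :: "nat \<Rightarrow> tm \<Rightarrow> tm \<Rightarrow> tm" where
  "tm_subst v r (Var w) = (if w = v then r else Var w)"
| "tm_subst v r Zero = Zero"
| "tm_subst v r (Succ t) = Succ (tm_subst v r t)"
| "tm_subst v r (Plus s t) = Plus (tm_subst v r s) (tm_subst v r t)"
| "tm_subst v r (Times s t) = Times (tm_subst v r s) (tm_subst v r t)"

text \<open>Substitution does not rename bound variables; this is harmless for the two instances used in
  the induction scheme, because the terms \<open>Zero\<close> and \<open>Succ (Var v)\<close> contain no variable except
  possibly \<open>v\<close>, and below a quantifier on \<open>v\<close> nothing is substituted.\<close>

fun fm_subst :: "nat \<Rightarrow> tm \<Rightarrow> fm \<Rightarrow> fm" where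
  "fm_subst v r (Eq s t) = Eq (tm_subst v r s) (tm_subst v r t)"
| "fm_subst v r (Neg f) = Neg (fm_subst v r f)"
| "fm_subst v r (Or f g) = Or (fm_subst v r f) (fm_subst v r g)"
| "fm_subst v r (Ex w f) = (if w = v then Ex w f else Ex w (fm_subst v r f))"

text \<open>The axioms are to be read as universally closed, see \<open>models\<close>.\<close>

inductive_set PA :: "fm set" where
  "Neg (Eq (Succ (Var 0)) Zero) \<in> PA"
| "Imp (Eq (Succ (Var 0)) (Succ (Var 1))) (Eq (Var 0) (Var 1)) \<in> PA"
| "Eq (Plus (Var 0) Zero) (Var 0) \<in> PA"
| "Eq (Plus (Var 0) (Succ (Var 1))) (Succ (Plus (Var 0) (Var 1))) \<in> PA"
| "Eq (Times (Var 0) Zero) Zero \<in> PA"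
| "Eq (Times (Var 0) (Succ (Var 1))) (Plus (Times (Var 0) (Var 1)) (Var 0)) \<in> PA"
| "Imp (fm_subst v Zero f) (Imp (All v (Imp f (fm_subst v (Succ (Var v)) f))) (All v f)) \<in> PA"

definition model_of_PA :: "'m arith \<Rightarrow> bool" where
  "model_of_PA M \<longleftrightarrow> (\<forall>f \<in> PA. models M f)"

section \<open>Coding inside a structure\<close>

text \<open>The definitions of this section spell out arithmetical formulas, evaluated in \<open>M\<close>: all
  quantifiers range over \<open>M\<close>, and the only primitives are the operations of \<open>M\<close>. Descriptions
  (\<open>THE\<close>) are provably total in PA.\<close>

definition num :: "'m arith \<Rightarrow> nat \<Rightarrow> 'm" where
  "num M n = (sc M ^^ n) (zr M)"

definition lt :: "'m arith \<Rightarrow> 'm \<Rightarrow> 'm \<Rightarrow> bool" where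
  "lt M x y \<longleftrightarrow> (\<exists>z. y = sc M (ad M x z))"

text \<open>Cantor's pairing bijection $(x + y)(x + y + 1)/2 + x$.\<close>

definition pr :: "'m arith \<Rightarrow> 'm \<Rightarrow> 'm \<Rightarrow> 'm" where
  "pr M x y = (THE z. ad M z z = ad M (ml M (ad M x y) (sc M (ad M x y))) (ad M x x))"

text \<open>$(a)_i$, by the beta function: the remainder of $u$ modulo $(i + 1) v + 1$, where
  $a = \langle u, v\rangle$.\<close>

definition elt :: "'m arith \<Rightarrow> 'm \<Rightarrow> 'm \<Rightarrow> 'm" where
  "elt M a i = (THE r. \<exists>u v q. a = pr M u v \<and> lt M r (sc M (ml M (sc M i) v)) \<and>
                  u = ad M (ml M q (sc M (ml M (sc M i) v))) r)"

text \<open>$2^i$\<close>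

definition pow2 :: "'m arith \<Rightarrow> 'm \<Rightarrow> 'm" where
  "pow2 M i = (THE p. \<exists>s. elt M s (zr M) = sc M (zr M) \<and>
                 (\<forall>j. lt M j i \<longrightarrow> elt M s (sc M j) = ad M (elt M s j) (elt M s j)) \<and>
                 elt M s i = p)"

text \<open>Ackermann membership: the \<open>i\<close>-th binary digit of \<open>c\<close> is 1. Every coded set has exactly one
  code, and the empty set is coded by 0.\<close>

definition mem :: "'m arith \<Rightarrow> 'm \<Rightarrow> 'm \<Rightarrow> bool" where
  "mem M i c \<longleftrightarrow> (\<exists>q r. lt M r (pow2 M i) \<and> c = ad M (ml M (sc M (ad M q q)) (pow2 M i)) r)"

definition separable :: "'m arith \<Rightarrow> 'm set \<Rightarrow> bool" where
  "separable M X \<longleftrightarrow> (\<forall>a. \<exists>c. \<forall>n. elt M a (num M n) \<in> X \<longleftrightarrow> mem M (num M n) c)"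

definition c_var :: "'m arith \<Rightarrow> 'm \<Rightarrow> 'm" where
  "c_var M v = pr M (num M 1) v"

definition c_zero :: "'m arith \<Rightarrow> 'm" where
  "c_zero M = pr M (num M 2) (zr M)"

definition c_succ :: "'m arith \<Rightarrow> 'm \<Rightarrow> 'm" where
  "c_succ M t = pr M (num M 3) t"

definition c_plus :: "'m arith \<Rightarrow> 'm \<Rightarrow> 'm \<Rightarrow> 'm" where
  "c_plus M s t = pr M (num M 4) (pr M s t)"

definition c_times :: "'m arith \<Rightarrow> 'm \<Rightarrow> 'm \<Rightarrow> 'm" where
  "c_times M s t = pr M (num M 5) (pr M s t)"

definition c_eq :: "'m arith \<Rightarrow> 'm \<Rightarrow> 'm \<Rightarrow> 'm" where
  "c_eq M s t = pr M (num M 6) (pr M s t)"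

definition c_neg :: "'m arith \<Rightarrow> 'm \<Rightarrow> 'm" where
  "c_neg M f = pr M (num M 7) f"

definition c_or :: "'m arith \<Rightarrow> 'm \<Rightarrow> 'm \<Rightarrow> 'm" where
  "c_or M f g = pr M (num M 8) (pr M f g)"

definition c_ex :: "'m arith \<Rightarrow> 'm \<Rightarrow> 'm \<Rightarrow> 'm" where
  "c_ex M v f = pr M (num M 9) (pr M v f)"

fun tm_code :: "'m arith \<Rightarrow> tm \<Rightarrow> 'm" where
  "tm_code M (Var v) = c_var M (num M v)"
| "tm_code M Zero = c_zero M"
| "tm_code M (Succ t) = c_succ M (tm_code M t)"
| "tm_code M (Plus s t) = c_plus M (tm_code M s) (tm_code M t)"
| "tm_code M (Times s t) = c_times M (tm_code M s) (tm_code M t)"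

fun fm_code :: "'m arith \<Rightarrow> fm \<Rightarrow> 'm" where
  "fm_code M (Eq s t) = c_eq M (tm_code M s) (tm_code M t)"
| "fm_code M (Neg f) = c_neg M (fm_code M f)"
| "fm_code M (Or f g) = c_or M (fm_code M f) (fm_code M g)"
| "fm_code M (Ex v f) = c_ex M (num M v) (fm_code M f)"

section \<open>Recursive saturation\<close>

datatype recf = RZero | RSucc | RProj nat | RComp recf "recf list" | RPrim recf recf | RMin recf

text \<open>\<open>rec_eval f xs y\<close>: the partial recursive function denoted by \<open>f\<close> is defined at \<open>xs\<close> with
  value \<open>y\<close>.\<close>

inductive rec_eval :: "recf \<Rightarrow> nat list \<Rightarrow> nat \<Rightarrow> bool" where
  "rec_eval RZero xs 0"
| "rec_eval RSucc [x] (Suc x)"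
| "i < length xs \<Longrightarrow> rec_eval (RProj i) xs (xs ! i)"
| "list_all2 (\<lambda>g y. rec_eval g xs y) gs ys \<Longrightarrow> rec_eval f ys z \<Longrightarrow> rec_eval (RComp f gs) xs z"
| "rec_eval f xs y \<Longrightarrow> rec_eval (RPrim f g) (0 # xs) y"
| "rec_eval (RPrim f g) (n # xs) y \<Longrightarrow> rec_eval g (n # y # xs) z
   \<Longrightarrow> rec_eval (RPrim f g) (Suc n # xs) z"
| "rec_eval f (n # xs) 0 \<Longrightarrow> (\<forall>m<n. \<exists>k. rec_eval f (m # xs) (Suc k)) \<Longrightarrow> rec_eval (RMin f) xs n"

definition recursive_set :: "nat set \<Rightarrow> bool" where
  "recursive_set A \<longleftrightarrow> (\<exists>f. \<forall>x. rec_eval f [x] (if x \<in> A then 1 else 0))"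

definition nat_arith :: "nat arith" where
  "nat_arith = \<lparr>zr = 0, sc = Suc, ad = (+), ml = (*)\<rparr>"

text \<open>The variable with index 0 is the variable of the type, those with index between 1 and \<open>k\<close>
  are interpreted by the parameters \<open>e 1, ..., e k\<close>.\<close>

definition recursively_saturated :: "'m arith \<Rightarrow> bool" where
  "recursively_saturated M \<longleftrightarrow>
     (\<forall>k e p. recursive_set (fm_code nat_arith ` p) \<and> (\<forall>f\<in>p. fvars f \<subseteq> {..k}) \<and>
        (\<forall>q. finite q \<and> q \<subseteq> p \<longrightarrow> (\<exists>x. \<forall>f\<in>q. sat M (e(0 := x)) f))
        \<longrightarrow> (\<exists>x. \<forall>f\<in>p. sat M (e(0 := x)) f))"

section \<open>Syntax and satisfaction classes inside a structure\<close>

text \<open>Inductive definitions inside \<open>M\<close>: \<open>R C y\<close> says that \<open>y\<close> may be derived from elements \<open>z\<close> with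
  \<open>C z\<close>, and \<open>x\<close> is accepted if it lies in an \<open>M\<close>-coded set each of whose elements is derivable
  from elements of the same set. In every use the premises of a derivation step are formulas or
  terms with strictly smaller codes, so the existence of such a set is equivalent to that of an
  \<open>M\<close>-coded derivation.\<close>

definition derivable :: "'m arith \<Rightarrow> (('m \<Rightarrow> bool) \<Rightarrow> 'm \<Rightarrow> bool) \<Rightarrow> 'm \<Rightarrow> bool" where
  "derivable M R x \<longleftrightarrow> (\<exists>c. mem M x c \<and> (\<forall>y. mem M y c \<longrightarrow> R (\<lambda>z. mem M z c) y))"

definition is_tm :: "'m arith \<Rightarrow> 'm \<Rightarrow> bool" where
  "is_tm M = derivable M (\<lambda>C y.
     (\<exists>v. y = c_var M v) \<or>
     y = c_zero M \<or>
     (\<exists>t. C t \<and> y = c_succ M t) \<or>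
     (\<exists>s t. C s \<and> C t \<and> y = c_plus M s t) \<or>
     (\<exists>s t. C s \<and> C t \<and> y = c_times M s t))"

definition is_fm :: "'m arith \<Rightarrow> 'm \<Rightarrow> bool" where
  "is_fm M = derivable M (\<lambda>C y.
     (\<exists>s t. is_tm M s \<and> is_tm M t \<and> y = c_eq M s t) \<or>
     (\<exists>f. C f \<and> y = c_neg M f) \<or>
     (\<exists>f g. C f \<and> C g \<and> y = c_or M f g) \<or>
     (\<exists>v f. C f \<and> y = c_ex M v f))"

text \<open>\<open>v\<close> occurs free in the given term or formula.\<close>

definition is_free :: "'m arith \<Rightarrow> 'm \<Rightarrow> 'm \<Rightarrow> bool" where
  "is_free M v = derivable M (\<lambda>C y.
     y = c_var M v \<or>
     (\<exists>t. C t \<and> y = c_succ M t) \<or>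
     (\<exists>s t. (C s \<or> C t) \<and> (y = c_plus M s t \<or> y = c_times M s t \<or> y = c_eq M s t)) \<or>
     (\<exists>f. C f \<and> y = c_neg M f) \<or>
     (\<exists>f g. (C f \<or> C g) \<and> y = c_or M f g) \<or>
     (\<exists>w f. w \<noteq> v \<and> C f \<and> y = c_ex M w f))"

text \<open>Assignments are coded finite functions from (indices of) variables to \<open>M\<close>.\<close>

definition is_asg :: "'m arith \<Rightarrow> 'm \<Rightarrow> bool" where
  "is_asg M a \<longleftrightarrow> (\<forall>p. mem M p a \<longrightarrow> (\<exists>v x. p = pr M v x)) \<and>
     (\<forall>v x y. mem M (pr M v x) a \<and> mem M (pr M v y) a \<longrightarrow> x = y)"

definition asg_for :: "'m arith \<Rightarrow> 'm \<Rightarrow> 'm \<Rightarrow> bool" where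
  "asg_for M f a \<longleftrightarrow> is_asg M a \<and> (\<forall>v. (\<exists>x. mem M (pr M v x) a) \<longleftrightarrow> is_free M v f)"

text \<open>The restriction of \<open>a\<close> to the free variables of \<open>f\<close>.\<close>

definition restr :: "'m arith \<Rightarrow> 'm \<Rightarrow> 'm \<Rightarrow> 'm" where
  "restr M a f =
     (THE b. \<forall>p. mem M p b \<longleftrightarrow> mem M p a \<and> (\<exists>v x. p = pr M v x \<and> is_free M v f))"

text \<open>\<open>y\<close> is the value of the term \<open>t\<close> under the assignment \<open>a\<close>.\<close>

definition is_val :: "'m arith \<Rightarrow> 'm \<Rightarrow> 'm \<Rightarrow> 'm \<Rightarrow> bool" where
  "is_val M a t y \<longleftrightarrow> derivable M (\<lambda>C p.
     (\<exists>v x. mem M (pr M v x) a \<and> p = pr M (c_var M v) x) \<or>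
     p = pr M (c_zero M) (zr M) \<or>
     (\<exists>t x. C (pr M t x) \<and> p = pr M (c_succ M t) (sc M x)) \<or>
     (\<exists>s t x y. C (pr M s x) \<and> C (pr M t y) \<and> p = pr M (c_plus M s t) (ad M x y)) \<or>
     (\<exists>s t x y. C (pr M s x) \<and> C (pr M t y) \<and> p = pr M (c_times M s t) (ml M x y)))
   (pr M t y)"

definition CS_minus :: "'m arith \<Rightarrow> ('m \<times> 'm) set \<Rightarrow> bool" where
  "CS_minus M S \<longleftrightarrow>
     (\<forall>f a. (f, a) \<in> S \<longrightarrow> is_fm M f \<and> asg_for M f a) \<and>
     (\<forall>s t a. is_tm M s \<and> is_tm M t \<and> asg_for M (c_eq M s t) a \<longrightarrow>
        ((c_eq M s t, a) \<in> S \<longleftrightarrow> (\<exists>y. is_val M a s y \<and> is_val M a t y))) \<and>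
     (\<forall>f g a. is_fm M f \<and> is_fm M g \<and> asg_for M (c_or M f g) a \<longrightarrow>
        ((c_or M f g, a) \<in> S \<longleftrightarrow> (f, restr M a f) \<in> S \<or> (g, restr M a g) \<in> S)) \<and>
     (\<forall>f a. is_fm M f \<and> asg_for M (c_neg M f) a \<longrightarrow>
        ((c_neg M f, a) \<in> S \<longleftrightarrow> (f, a) \<notin> S)) \<and>
     (\<forall>v f a. is_fm M f \<and> asg_for M (c_ex M v f) a \<longrightarrow>
        ((c_ex M v f, a) \<in> S \<longleftrightarrow>
           (\<exists>b. is_asg M b \<and>
                (\<forall>w x. w \<noteq> v \<longrightarrow> (mem M (pr M w x) b \<longleftrightarrow> mem M (pr M w x) a)) \<and>
                (f, restr M b f) \<in> S)))"

text \<open>\<open>T f\<close>, that is \<open>S\<close> at \<open>f\<close> and the empty assignment, which is coded by 0.\<close>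

definition truth :: "'m arith \<Rightarrow> ('m \<times> 'm) set \<Rightarrow> 'm \<Rightarrow> bool" where
  "truth M S f \<longleftrightarrow> (f, zr M) \<in> S"

section \<open>Local idempotent sentential operators\<close>

text \<open>Templates over the sentence letters \<open>p\<close> and \<open>q\<close>. Other connectives are definable, as in the
  object language. Since only sentences are substituted for the letters, every quantifier of a
  template is a dummy quantifier.\<close>

datatype template = LetP | LetQ | TNeg template | TOr template template | TEx nat template

fun complexity :: "template \<Rightarrow> nat" where
  "complexity LetP = 0"
| "complexity LetQ = 0"
| "complexity (TNeg A) = Suc (complexity A)"
| "complexity (TOr A B) = Suc (max (complexity A) (complexity B))"
| "complexity (TEx v A) = Suc (complexity A)"

fun q_occurs :: "template \<Rightarrow> bool" where
  "q_occurs LetP \<longleftrightarrow> False"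
| "q_occurs LetQ \<longleftrightarrow> True"
| "q_occurs (TNeg A) \<longleftrightarrow> q_occurs A"
| "q_occurs (TOr A B) \<longleftrightarrow> q_occurs A \<or> q_occurs B"
| "q_occurs (TEx v A) \<longleftrightarrow> q_occurs A"

text \<open>The truth value of a template; a dummy quantifier has no effect in a nonempty universe.\<close>

fun t_val :: "template \<Rightarrow> bool \<Rightarrow> bool \<Rightarrow> bool" where
  "t_val LetP p q \<longleftrightarrow> p"
| "t_val LetQ p q \<longleftrightarrow> q"
| "t_val (TNeg A) p q \<longleftrightarrow> \<not> t_val A p q"
| "t_val (TOr A B) p q \<longleftrightarrow> t_val A p q \<or> t_val B p q"
| "t_val (TEx v A) p q \<longleftrightarrow> t_val A p q"

fun t_inst :: "'m arith \<Rightarrow> template \<Rightarrow> 'm \<Rightarrow> 'm \<Rightarrow> 'm" where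
  "t_inst M LetP x y = x"
| "t_inst M LetQ x y = y"
| "t_inst M (TNeg A) x y = c_neg M (t_inst M A x y)"
| "t_inst M (TOr A B) x y = c_or M (t_inst M A x y) (t_inst M B x y)"
| "t_inst M (TEx v A) x y = c_ex M (num M v) (t_inst M A x y)"

definition idempotent_template :: "'m arith \<Rightarrow> fm \<Rightarrow> template \<Rightarrow> bool" where
  "idempotent_template M \<theta> A \<longleftrightarrow> complexity A \<noteq> 0 \<and> q_occurs A \<and>
     (models M \<theta> \<longrightarrow> (\<forall>q. t_val A True q \<longleftrightarrow> q)) \<and>
     (models M (Neg \<theta>) \<longrightarrow> (\<forall>q. t_val A False q \<longleftrightarrow> q))"

text \<open>The function \<open>F\<close> with \<open>F 0 = \<theta>\<close> and \<open>F (x + 1) = A(\<theta>, F x)\<close>, defined by recursion inside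
  \<open>M\<close>: \<open>F x\<close> is the \<open>x\<close>-th element of a coded sequence that satisfies the recursion up to \<open>x\<close>.\<close>

definition iterate :: "'m arith \<Rightarrow> fm \<Rightarrow> template \<Rightarrow> 'm \<Rightarrow> 'm" where
  "iterate M \<theta> A x =
     (THE y. \<exists>s. elt M s (zr M) = fm_code M \<theta> \<and>
        (\<forall>i. lt M i x \<longrightarrow> elt M s (sc M i) = t_inst M A (fm_code M \<theta>) (elt M s i)) \<and>
        elt M s x = y)"

definition local_idempotent_operator :: "'m arith \<Rightarrow> fm \<Rightarrow> ('m \<Rightarrow> 'm) \<Rightarrow> bool" where
  "local_idempotent_operator M \<theta> F \<longleftrightarrow> sentence \<theta> \<and>
     (\<exists>A. idempotent_template M \<theta> A \<and> F = iterate M \<theta> A)"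

text \<open>On the use of these notions: \<open>F 0 = \<theta>\<close>, so 0 always belongs to the set \<open>E\<close> of all \<open>x\<close> such
  that \<open>T (F x)\<close> and \<open>T \<theta>\<close> are equivalent. If \<open>X\<close> contains all
  standard numbers when \<open>\<theta>\<close> is true and none of them when \<open>\<theta>\<close> is false, then \<open>X = E\<close> is
  possible only if \<open>\<theta>\<close> is true; if \<open>\<theta>\<close> is false, the set to compare with \<open>X\<close> is the complement
  of \<open>E\<close>. In both cases it is the set of all \<open>x\<close> with \<open>T (F x)\<close>.\<close>

end

theory Submission
  imports Defs
begin

text \<open>In both cases the claim is that \<open>F x\<close> is true if and only if \<open>x\<close> lies in \<open>X\<close>. The satisfaction
  class is the limit of a chain of finite sets of signed pairs (formula, assignment). Each finite
  set extends to a compositional valuation of a set of formulas that is closed under immediate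
  subformulas, and this valuation agrees with \<open>X\<close> on the iterates it contains. In order to add one
  more formula, list its subformulas of standard depth in a coded sequence; by separability some
  element codes the set of those indices at which \<open>X\<close> requires an iterate to be true. Now play a
  closed game with coded positions: the opponent names an entry of the sequence and an assignment, and the player
  adds a truth value and a witness. For any standard number of rounds the player wins, as
  compositional values can be prescribed on finitely many new formulas, starting from the old
  valuation and from the canonical values of the formulas that occur in the iterates (here the
  closure of \<open>X\<close> under successors and predecessors is used). The rules are
  definable, so by recursive saturation the player wins the infinite game, and a play in which all
  challenges occur yields the new valuation.\<close>

subsection \<open>Definability and induction\<close>

text \<open>Neither \<open>X\<close> nor the values already chosen are definable in
  \<open>M\<close>, so saturation cannot be applied to a description of the wanted valuation. The
  game avoids this: a position is one element coding a set of facts, the rules see \<open>X\<close>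
  only through the code \<open>c\<close>, and \<open>X\<close> itself enters only in the proof that
  any finite number of rounds can be survived. That proof rests on the fact that subformulas have
  smaller codes: within a finite set of formulas values can be assigned by increasing code, although
  the subformula relation of a nonstandard formula may be ill-founded when seen from outside. The
  code \<open>c\<close> is correct at standard indices, which suffices because round t inspects only
  indices below t. The price is that every step replaces the whole valuation; what survives are the
  finitely many facts coded by the initial position. Definability is treated semantically, by
  \<open>dfn\<close>, so that induction in \<open>M\<close> and saturation apply to HOL predicates
  without formulas being written out.\<close>

lemma tm_val_cong: "(\<And>v. v \<in> tm_vars t \<Longrightarrow> e v = e' v) \<Longrightarrow> tm_val M e t = tm_val M e' t"
  by (induction t) auto

lemma sat_cong: "(\<And>v. v \<in> fvars f \<Longrightarrow> e v = e' v) \<Longrightarrow> sat M e f = sat M e' f"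
proof (induction f arbitrary: e e')
  case (Eq s t)
  then have "tm_val M e s = tm_val M e' s" "tm_val M e t = tm_val M e' t"
    by (auto intro!: tm_val_cong)
  then show ?case by simp
next
  case (Neg f)
  have "sat M e f = sat M e' f" by (rule Neg.IH) (use Neg.prems in simp)
  then show ?case by simp
next
  case (Or f g)
  have "sat M e f = sat M e' f" "sat M e g = sat M e' g"
    by (rule Or.IH, use Or.prems in simp)+
  then show ?case by simp
next
  case (Ex v f)
  have "sat M (e(v := x)) f = sat M (e'(v := x)) f" for x
    by (rule Ex.IH) (use Ex.prems in auto)
  then show ?case by simp
qed

lemma finite_tm_vars [simp]: "finite (tm_vars t)" by (induction t) auto

lemma finite_fvars [simp]: "finite (fvars f)" by (induction f) auto

section \<open>Renaming of variables\<close>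

fun tm_ren :: "(nat \<Rightarrow> nat) \<Rightarrow> tm \<Rightarrow> tm" where
  "tm_ren \<sigma> (Var v) = Var (\<sigma> v)"
| "tm_ren \<sigma> Zero = Zero"
| "tm_ren \<sigma> (Succ t) = Succ (tm_ren \<sigma> t)"
| "tm_ren \<sigma> (Plus s t) = Plus (tm_ren \<sigma> s) (tm_ren \<sigma> t)"
| "tm_ren \<sigma> (Times s t) = Times (tm_ren \<sigma> s) (tm_ren \<sigma> t)"

lemma tm_val_ren: "tm_val M e (tm_ren \<sigma> t) = tm_val M (\<lambda>n. e (\<sigma> n)) t"
  by (induction t) auto

lemma fresh_nat: "finite A \<Longrightarrow> \<exists>w :: nat. w \<notin> A"
  using ex_new_if_finite infinite_UNIV_nat by blast

text \<open>The map \<sigma> need not be injective. At a quantifier the bound variable moves to some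
  \<open>w\<close> outside the image of the free variables, so nothing is captured. The renamings in
  the closure rules of \<open>dfn\<close> are obtained from this lemma.\<close>

lemma sat_ren: "\<exists>g. \<forall>e. sat M e g \<longleftrightarrow> sat M (\<lambda>n. e (\<sigma> n)) f"
proof (induction f arbitrary: \<sigma>)
  case (Eq s t)
  show ?case
    by (rule exI[of _ "Eq (tm_ren \<sigma> s) (tm_ren \<sigma> t)"]) (simp add: tm_val_ren)
next
  case (Neg f)
  then obtain g where "\<forall>e. sat M e g \<longleftrightarrow> sat M (\<lambda>n. e (\<sigma> n)) f" by blast
  then show ?case by (intro exI[of _ "Neg g"]) simp
next
  case (Or f f')
  obtain g where "\<forall>e. sat M e g \<longleftrightarrow> sat M (\<lambda>n. e (\<sigma> n)) f" using Or.IH(1) by blast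
  moreover obtain g' where "\<forall>e. sat M e g' \<longleftrightarrow> sat M (\<lambda>n. e (\<sigma> n)) f'" using Or.IH(2) by blast
  ultimately show ?case by (intro exI[of _ "Or g g'"]) simp
next
  case (Ex v f)
  obtain w where w: "w \<notin> \<sigma> ` fvars f" using fresh_nat[of "\<sigma> ` fvars f"] by auto
  obtain g where g: "\<forall>e. sat M e g \<longleftrightarrow> sat M (\<lambda>n. e ((\<sigma>(v := w)) n)) f" using Ex.IH by blast
  have "sat M (\<lambda>n. (e(w := x)) ((\<sigma>(v := w)) n)) f \<longleftrightarrow> sat M ((\<lambda>n. e (\<sigma> n))(v := x)) f" for e x
    by (rule sat_cong) (use w in auto)
  then show ?case using g by (intro exI[of _ "Ex w g"]) simp
qed

text \<open>The even variables of a defining formula are the arguments, the odd ones are interpreted by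
  parameters.\<close>

definition mix :: "(nat \<Rightarrow> 'm) \<Rightarrow> (nat \<Rightarrow> 'm) \<Rightarrow> nat \<Rightarrow> 'm" where
  "mix e r n = (if even n then e (n div 2) else r (n div 2))"

text \<open>Definability with parameters, for predicates on environments. The arguments act as a de
  Bruijn stack: a quantifier binds \<open>e 0\<close> and shifts the rest, so that the closure rules
  match HOL terms directly.\<close>

definition dfn :: "'m arith \<Rightarrow> ((nat \<Rightarrow> 'm) \<Rightarrow> bool) \<Rightarrow> bool" where
  "dfn M P \<longleftrightarrow> (\<exists>f r. \<forall>e. sat M (mix e r) f \<longleftrightarrow> P e)"

definition dft :: "'m arith \<Rightarrow> ((nat \<Rightarrow> 'm) \<Rightarrow> 'm) \<Rightarrow> bool" where
  "dft M t \<longleftrightarrow> dfn M (\<lambda>e. e 0 = t (\<lambda>n. e (Suc n)))"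

section \<open>Closure of definability under connectives, quantifiers and substitution\<close>

lemma dfn_Not: "dfn M P \<Longrightarrow> dfn M (\<lambda>e. \<not> P e)"
  unfolding dfn_def by (metis sat.simps(2))

lemma dfn_Or:
  assumes "dfn M P" "dfn M Q"
  shows "dfn M (\<lambda>e. P e \<or> Q e)"
proof -
  obtain f r where f: "\<forall>e. sat M (mix e r) f \<longleftrightarrow> P e" using assms(1) unfolding dfn_def by blast
  obtain g s where g: "\<forall>e. sat M (mix e s) g \<longleftrightarrow> Q e" using assms(2) unfolding dfn_def by blast
  \<comment> \<open>The k-th parameter of \<open>f\<close> goes to place 2k and that of
    \<open>g\<close> to place 2k+1 of the joint sequence \<open>mix r s\<close>; the arguments stay
    where they are.\<close>
  define \<sigma> where "\<sigma> n = (if even n then n else 4 * (n div 2) + 1)" for n :: nat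
  define \<tau> where "\<tau> n = (if even n then n else 4 * (n div 2) + 3)" for n :: nat
  obtain f' where f': "\<And>e. sat M e f' \<longleftrightarrow> sat M (\<lambda>n. e (\<sigma> n)) f" using sat_ren by blast
  obtain g' where g': "\<And>e. sat M e g' \<longleftrightarrow> sat M (\<lambda>n. e (\<tau> n)) g" using sat_ren by blast
  have 1: "(\<lambda>n. mix e (mix r s) (\<sigma> n)) = mix e r" for e
    by (auto simp: fun_eq_iff mix_def \<sigma>_def elim!: oddE)
  have 2: "(\<lambda>n. mix e (mix r s) (\<tau> n)) = mix e s" for e
  proof
    fix n
    have "(4 * (n div 2) + 3) div 2 = Suc (2 * (n div 2))" by simp
    then show "mix e (mix r s) (\<tau> n) = mix e s n" by (auto simp: mix_def \<tau>_def)
  qed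
  show ?thesis unfolding dfn_def
    by (rule exI[of _ "Or f' g'"], rule exI[of _ "mix r s"]) (use f g in \<open>simp add: f' g' 1 2\<close>)
qed

lemma dfn_And: "dfn M P \<Longrightarrow> dfn M Q \<Longrightarrow> dfn M (\<lambda>e. P e \<and> Q e)"
  using dfn_Not[OF dfn_Or[OF dfn_Not dfn_Not], of M P Q] by simp

lemma dfn_Imp: "dfn M P \<Longrightarrow> dfn M Q \<Longrightarrow> dfn M (\<lambda>e. P e \<longrightarrow> Q e)"
  unfolding imp_conv_disj by (intro dfn_Or dfn_Not)

lemma dfn_Iff: "dfn M P \<Longrightarrow> dfn M Q \<Longrightarrow> dfn M (\<lambda>e. P e \<longleftrightarrow> Q e)"
  unfolding iff_conv_conj_imp by (intro dfn_And dfn_Imp)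

lemma dfn_Ex:
  assumes "dfn M (\<lambda>e. P (\<lambda>n. e (Suc n)) (e 0))"
  shows "dfn M (\<lambda>e. \<exists>x. P e x)"
proof -
  obtain f r where f: "\<forall>e. sat M (mix e r) f \<longleftrightarrow> P (\<lambda>n. e (Suc n)) (e 0)"
    using assms unfolding dfn_def by blast
  \<comment> \<open>Argument 0 becomes the fresh variable \<open>w\<close>, the later arguments move
    down by one place (two in the variable index), and the parameters, which are odd, are
    kept.\<close>
  define \<sigma> where "\<sigma> w n = (if n = 0 then w else if even n then n - 2 else n)" for w n :: nat
  obtain w where w: "w \<notin> \<sigma> 0 ` fvars f" using fresh_nat[of "\<sigma> 0 ` fvars f"] by auto
  obtain g where g: "\<And>e. sat M e g \<longleftrightarrow> sat M (\<lambda>n. e (\<sigma> w n)) f" using sat_ren by blast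
  have "sat M ((mix e r)(w := x)) g \<longleftrightarrow> P e x" for e x
  proof -
    have "sat M ((mix e r)(w := x)) g \<longleftrightarrow> sat M (mix (\<lambda>n. case n of 0 \<Rightarrow> x | Suc m \<Rightarrow> e m) r) f"
      unfolding g
    proof (rule sat_cong)
      fix v assume v: "v \<in> fvars f"
      show "((mix e r)(w := x)) (\<sigma> w v) = mix (\<lambda>n. case n of 0 \<Rightarrow> x | Suc m \<Rightarrow> e m) r v"
      proof (cases "v = 0")
        case False
        then have "\<sigma> w v = \<sigma> 0 v" by (simp add: \<sigma>_def)
        then have "\<sigma> w v \<noteq> w" using w v by (metis imageI)
        moreover have "even v \<Longrightarrow> v div 2 = Suc ((v - 2) div 2)" using False by presburger
        ultimately show ?thesis using False by (auto simp: mix_def \<sigma>_def)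
      qed (simp add: \<sigma>_def mix_def)
    qed
    then show ?thesis using f by simp
  qed
  then show ?thesis unfolding dfn_def
    by (intro exI[of _ "Ex w g"] exI[of _ r]) simp
qed

lemma dfn_All:
  assumes "dfn M (\<lambda>e. P (\<lambda>n. e (Suc n)) (e 0))"
  shows "dfn M (\<lambda>e. \<forall>x. P e x)"
proof -
  have "dfn M (\<lambda>e. \<not> (\<exists>x. \<not> P e x))" by (intro dfn_Not dfn_Ex assms)
  then show ?thesis by simp
qed

lemma dfn_ren:
  assumes "dfn M P"
  shows "dfn M (\<lambda>e. P (\<lambda>n. e (\<sigma> n)))"
proof -
  obtain f r where f: "\<forall>e. sat M (mix e r) f \<longleftrightarrow> P e" using assms unfolding dfn_def by blast
  define \<tau> where "\<tau> n = (if even n then 2 * \<sigma> (n div 2) else n)" for n :: nat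
  obtain g where g: "\<And>e. sat M e g \<longleftrightarrow> sat M (\<lambda>n. e (\<tau> n)) f" using sat_ren by blast
  have "(\<lambda>n. mix e r (\<tau> n)) = mix (\<lambda>n. e (\<sigma> n)) r" for e
    by (auto simp: fun_eq_iff mix_def \<tau>_def)
  then show ?thesis unfolding dfn_def
    by (intro exI[of _ g] exI[of _ r]) (use f in \<open>simp add: g\<close>)
qed

lemma dfn_mono: "dfn M P \<Longrightarrow> (\<And>e. P e \<longleftrightarrow> Q e) \<Longrightarrow> dfn M Q"
  unfolding dfn_def by simp

lemma dfn_tm:
  assumes "\<And>e. tm_val M (mix e r) s = p e" "\<And>e. tm_val M (mix e r) t = q e"
  shows "dfn M (\<lambda>e. p e = q e)"
  unfolding dfn_def by (intro exI[of _ "Eq s t"] exI[of _ r]) (simp add: assms)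

lemma dft_var: "dft M (\<lambda>e. e k)"
  unfolding dft_def
  by (rule dfn_tm[of M undefined "Var 0" _ "Var (2 * Suc k)"]) (simp_all add: mix_def)

lemma dft_const: "dft M (\<lambda>e. c)"
  unfolding dft_def
  by (rule dfn_tm[of M "\<lambda>_. c" "Var 0" _ "Var 1"]) (simp_all add: mix_def)

lemma dft_shift: "dft M t \<Longrightarrow> dft M (\<lambda>e. t (\<lambda>n. e (Suc n)))"
  unfolding dft_def
  using dfn_ren[of M "\<lambda>e. e 0 = t (\<lambda>n. e (Suc n))" "\<lambda>n. case n of 0 \<Rightarrow> 0 | Suc n \<Rightarrow> Suc (Suc n)"]
  by simp

text \<open>Substitution through the graph: P (s e) is read as \<exists>x. x = s e \<and> P x. Hence
  definability of a function introduced by a description reduces to a definition of its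
  graph.\<close>

lemma dfn_subst1:
  assumes "dfn M (\<lambda>e. P (e 0))" "dft M s"
  shows "dfn M (\<lambda>e. P (s e))"
proof -
  have "dfn M (\<lambda>e. \<exists>x. x = s e \<and> P x)"
    using assms(2) assms(1)[THEN dfn_ren, of "\<lambda>_. 0"]
    by (intro dfn_Ex dfn_And) (simp_all add: dft_def)
  then show ?thesis by simp
qed

lemma dfn_subst2:
  assumes "dfn M (\<lambda>e. P (e 0) (e 1))" "dft M s" "dft M t"
  shows "dfn M (\<lambda>e. P (s e) (t e))"
proof -
  have "dfn M (\<lambda>e. P (s (\<lambda>n. e (Suc n))) (e 0))"
  proof -
    have "dfn M (\<lambda>e. \<exists>x. x = s (\<lambda>n. e (Suc n)) \<and> P x (e 0))"
      using assms(2)[THEN dft_shift] assms(1)[THEN dfn_ren, of "\<lambda>n. n"]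
      by (intro dfn_Ex dfn_And) (simp_all add: dft_def)
    then show ?thesis by simp
  qed
  then have "dfn M (\<lambda>e. \<exists>y. y = t e \<and> P (s e) y)"
    using assms(3) by (intro dfn_Ex dfn_And) (simp_all add: dft_def)
  then show ?thesis by simp
qed

lemma dfn_subst3:
  assumes "dfn M (\<lambda>e. P (e 0) (e 1) (e 2))" "dft M s" "dft M t" "dft M u"
  shows "dfn M (\<lambda>e. P (s e) (t e) (u e))"
proof -
  have "dfn M (\<lambda>e. P (s (\<lambda>n. e (Suc (Suc n)))) (t (\<lambda>n. e (Suc (Suc n)))) (e 0))"
  proof -
    have "dfn M (\<lambda>e. \<exists>x. x = s (\<lambda>n. e (Suc (Suc n))) \<and>
        (\<exists>y. y = t (\<lambda>n. e (Suc (Suc n))) \<and> P x y (e 0)))"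
      using assms(2)[THEN dft_shift, THEN dft_shift] assms(3)[THEN dft_shift, THEN dft_shift, THEN dft_shift]
        assms(1)[THEN dfn_ren, of "\<lambda>n. if n = 0 then 1 else if n = 1 then 0 else 2"]
      by (intro dfn_Ex dfn_And) (simp_all add: dft_def numeral_2_eq_2)
    then show ?thesis by simp
  qed
  then have *: "dfn M (\<lambda>e. P (s (\<lambda>n. e (Suc n))) (t (\<lambda>n. e (Suc n))) (e 0))"
    using dfn_ren[of M _ "\<lambda>n. case n of 0 \<Rightarrow> 0 | Suc 0 \<Rightarrow> 0 | Suc (Suc k) \<Rightarrow> Suc k"] by fastforce
  have "dfn M (\<lambda>e. \<exists>y. y = u e \<and> P (s e) (t e) y)"
    using assms(4) * by (intro dfn_Ex dfn_And) (simp_all add: dft_def)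
  then show ?thesis by simp
qed

lemma dfn_eq: "dft M s \<Longrightarrow> dft M t \<Longrightarrow> dfn M (\<lambda>e. s e = t e)"
  by (rule dfn_subst2[where P = "(=)"])
     (rule dfn_tm[of M undefined "Var 0" _ "Var 2"], simp_all add: mix_def)

lemma dft_subst1:
  assumes "dfn M (\<lambda>e. e 0 = g (e 1))" "dft M s"
  shows "dft M (\<lambda>e. g (s e))"
  unfolding dft_def
  by (rule dfn_subst2[where P = "\<lambda>x y. x = g y"]) (use assms in \<open>auto intro: dft_var dft_shift\<close>)

lemma dft_subst2:
  assumes "dfn M (\<lambda>e. e 0 = g (e 1) (e 2))" "dft M s" "dft M t"
  shows "dft M (\<lambda>e. g (s e) (t e))"
  unfolding dft_def
  by (rule dfn_subst3[where P = "\<lambda>x y z. x = g y z"])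
     (use assms in \<open>auto intro: dft_var dft_shift\<close>)

lemma dft_sc: "dft M s \<Longrightarrow> dft M (\<lambda>e. sc M (s e))"
  by (rule dft_subst1, rule dfn_tm[of M undefined "Var 0" _ "Succ (Var 2)"])
     (simp_all add: mix_def)

lemma dft_ad: "dft M s \<Longrightarrow> dft M t \<Longrightarrow> dft M (\<lambda>e. ad M (s e) (t e))"
  by (rule dft_subst2[where g = "ad M"],
      rule dfn_tm[of M undefined "Var 0" _ "Plus (Var 2) (Var 4)"]) (simp_all add: mix_def)

lemma dft_ml: "dft M s \<Longrightarrow> dft M t \<Longrightarrow> dft M (\<lambda>e. ml M (s e) (t e))"
  by (rule dft_subst2[where g = "ml M"],
      rule dfn_tm[of M undefined "Var 0" _ "Times (Var 2) (Var 4)"]) (simp_all add: mix_def)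

lemma dft_If:
  assumes "dfn M P" "dft M s" "dft M t"
  shows "dft M (\<lambda>e. if P e then s e else t e)"
proof -
  have "dfn M (\<lambda>e. P (\<lambda>n. e (Suc n)))" using dfn_ren[OF assms(1), of Suc] by simp
  then have "dfn M (\<lambda>e. (P (\<lambda>n. e (Suc n)) \<longrightarrow> e 0 = s (\<lambda>n. e (Suc n))) \<and>
      (\<not> P (\<lambda>n. e (Suc n)) \<longrightarrow> e 0 = t (\<lambda>n. e (Suc n))))"
    using assms(2,3) by (intro dfn_And dfn_Imp dfn_Not) (simp_all add: dft_def)
  then show ?thesis unfolding dft_def by (rule dfn_mono) auto
qed

lemma dfn_const: "dfn M (\<lambda>e. b)"
proof (cases b)
  case True
  have "dfn M (\<lambda>e. e 0 = e 0)" by (intro dfn_eq dft_var)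
  then show ?thesis using True by simp
next
  case False
  have "dfn M (\<lambda>e. \<not> e 0 = e 0)" by (intro dfn_Not dfn_eq dft_var)
  then show ?thesis using False by simp
qed

text \<open>With these rules a definability condition is discharged by recursion on the shape of the
  predicate; each new notion of arithmetic adds its own rule.\<close>

named_theorems dfn_rules

lemmas [dfn_rules] = dfn_Not dfn_Or dfn_And dfn_Imp dfn_Iff dfn_Ex dfn_All dfn_eq
  dft_var dft_const dft_sc dft_ad dft_ml dft_If dfn_const

lemma dfn_lt [dfn_rules]: "dft M s \<Longrightarrow> dft M t \<Longrightarrow> dfn M (\<lambda>e. lt M (s e) (t e))"
  by (rule dfn_subst2) (unfold lt_def, intro dfn_rules)

lemma tm_val_subst: "tm_val M e (tm_subst v r t) = tm_val M (e(v := tm_val M e r)) t"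
  by (induction t) auto

lemma sat_subst:
  "tm_vars r \<subseteq> {v} \<Longrightarrow> sat M e (fm_subst v r f) \<longleftrightarrow> sat M (e(v := tm_val M e r)) f"
proof (induction f arbitrary: e)
  case (Ex w f)
  have *: "tm_val M (e(w := x)) r = tm_val M e r" if "w \<noteq> v" for x
    by (rule tm_val_cong) (use that Ex.prems in auto)
  show ?case
  proof (cases "w = v")
    case False
    then have "(e(w := x))(v := tm_val M (e(w := x)) r) = (e(v := tm_val M e r))(w := x)" for x
      using * by (auto simp: fun_eq_iff)
    then have "sat M (e(w := x)) (fm_subst v r f) \<longleftrightarrow> sat M ((e(v := tm_val M e r))(w := x)) f" for x
      using Ex.IH[OF Ex.prems] by metis
    then show ?thesis using False by (simp add: fun_upd_def)
  next
    case True
    have "(\<lambda>a. if a = v then c else e a)(v := x) = e(v := x)" for c x by (auto simp: fun_eq_iff)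
    then show ?thesis using True by simp
  qed
qed (auto simp: tm_val_subst)

section \<open>Induction in a model of PA\<close>

locale pa =
  fixes M :: "'m arith"
  assumes PA: "model_of_PA M"
begin

lemma ax: "f \<in> PA \<Longrightarrow> sat M e f"
  using PA unfolding model_of_PA_def models_def by blast

lemma induct:
  assumes "dfn M (\<lambda>e. P (e 0))" "P (zr M)" "\<And>x. P x \<Longrightarrow> P (sc M x)"
  shows "P x"
proof -
  obtain f r where f: "\<And>e. sat M (mix e r) f \<longleftrightarrow> P (e 0)" using assms(1) unfolding dfn_def by blast
  have "(mix e r)(0 := x) = mix (e(0 := x)) r" for e x
    by (auto simp: fun_eq_iff mix_def)
  then have f': "sat M ((mix e r)(0 := x)) f \<longleftrightarrow> P x" for e x using f[of "e(0 := x)"] by simp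
  have "sat M (mix undefined r) (Imp (fm_subst 0 Zero f)
      (Imp (All 0 (Imp f (fm_subst 0 (Succ (Var 0)) f))) (All 0 f)))"
    by (rule ax, rule PA.intros)
  then show ?thesis using assms(2,3) by (simp add: sat_subst f')
qed

end

context pa
begin

subsection \<open>Ordered semiring structure\<close>

abbreviation zro ("\<zero>") where "\<zero> \<equiv> zr M"
abbreviation one ("\<one>") where "\<one> \<equiv> sc M (zr M)"
abbreviation suc ("\<S>") where "\<S> \<equiv> sc M"
abbreviation plus (infixl "\<oplus>" 65) where "x \<oplus> y \<equiv> ad M x y"
abbreviation times (infixl "\<otimes>" 70) where "x \<otimes> y \<equiv> ml M x y"
abbreviation less (infix "\<prec>" 50) where "x \<prec> y \<equiv> lt M x y"

lemma sc_ne_zr [simp]: "\<S> x \<noteq> \<zero>" "\<zero> \<noteq> \<S> x"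
  using ax[OF PA.intros(1), of "\<lambda>_. x"] by (auto dest: sym)

lemma sc_inject [simp]: "\<S> x = \<S> y \<longleftrightarrow> x = y"
  using ax[OF PA.intros(2), of "\<lambda>n. if n = 0 then x else y"] by auto

lemma ad_zr [simp]: "x \<oplus> \<zero> = x"
  using ax[OF PA.intros(3), of "\<lambda>_. x"] by simp

lemma ad_sc [simp]: "x \<oplus> \<S> y = \<S> (x \<oplus> y)"
  using ax[OF PA.intros(4), of "\<lambda>n. if n = 0 then x else y"] by simp

lemma ml_zr [simp]: "x \<otimes> \<zero> = \<zero>"
  using ax[OF PA.intros(5), of "\<lambda>_. x"] by simp

lemma ml_sc [simp]: "x \<otimes> \<S> y = x \<otimes> y \<oplus> x"
  using ax[OF PA.intros(6), of "\<lambda>n. if n = 0 then x else y"] by simp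

lemma zr_ad [simp]: "\<zero> \<oplus> x = x"
  by (rule induct[where P = "\<lambda>x. \<zero> \<oplus> x = x"]) (intro dfn_rules, simp_all)

lemma sc_ad [simp]: "\<S> x \<oplus> y = \<S> (x \<oplus> y)"
  by (rule induct[where P = "\<lambda>y. \<S> x \<oplus> y = \<S> (x \<oplus> y)"]) (intro dfn_rules, simp_all)

lemma ad_comm: "x \<oplus> y = y \<oplus> x"
  by (rule induct[where P = "\<lambda>y. x \<oplus> y = y \<oplus> x"]) (intro dfn_rules, simp_all)

lemma ad_assoc: "x \<oplus> y \<oplus> z = x \<oplus> (y \<oplus> z)"
  by (rule induct[where P = "\<lambda>z. x \<oplus> y \<oplus> z = x \<oplus> (y \<oplus> z)"]) (intro dfn_rules, simp_all)

lemma ad_left_comm: "x \<oplus> (y \<oplus> z) = y \<oplus> (x \<oplus> z)"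
  by (metis ad_assoc ad_comm)

lemma zr_ml [simp]: "\<zero> \<otimes> x = \<zero>"
  by (rule induct[where P = "\<lambda>x. \<zero> \<otimes> x = \<zero>"]) (intro dfn_rules, simp_all)

lemma sc_ml [simp]: "\<S> x \<otimes> y = x \<otimes> y \<oplus> y"
  by (rule induct[where P = "\<lambda>y. \<S> x \<otimes> y = x \<otimes> y \<oplus> y"])
     (intro dfn_rules, simp_all add: ad_assoc ad_comm ad_left_comm)

lemma ml_comm: "x \<otimes> y = y \<otimes> x"
  by (rule induct[where P = "\<lambda>y. x \<otimes> y = y \<otimes> x"]) (intro dfn_rules, simp_all)

lemma ml_distrib: "(x \<oplus> y) \<otimes> z = x \<otimes> z \<oplus> y \<otimes> z"
  by (rule induct[where P = "\<lambda>z. (x \<oplus> y) \<otimes> z = x \<otimes> z \<oplus> y \<otimes> z"])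
     (intro dfn_rules, simp_all add: ad_assoc ad_left_comm)

lemma ml_assoc: "x \<otimes> y \<otimes> z = x \<otimes> (y \<otimes> z)"
  by (rule induct[where P = "\<lambda>z. x \<otimes> y \<otimes> z = x \<otimes> (y \<otimes> z)"])
     (intro dfn_rules, simp_all add: ml_distrib[of _ _ "x"] ml_comm[of x])

lemma zr_or_sc: "x = \<zero> \<or> (\<exists>y. x = \<S> y)"
  by (rule induct[where P = "\<lambda>x. x = \<zero> \<or> (\<exists>y. x = \<S> y)"]) (intro dfn_rules, auto)

lemma ad_left_cancel [simp]: "x \<oplus> y = x \<oplus> z \<longleftrightarrow> y = z"
proof -
  have "x \<oplus> y = x \<oplus> z \<longrightarrow> y = z"
    by (rule induct[where P = "\<lambda>x. x \<oplus> y = x \<oplus> z \<longrightarrow> y = z"]) (intro dfn_rules, auto)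
  then show ?thesis by auto
qed

lemma ad_eq_zr [simp]: "x \<oplus> y = \<zero> \<longleftrightarrow> x = \<zero> \<and> y = \<zero>"
  using zr_or_sc[of y] by auto

lemma zr_eq_ad [simp]: "\<zero> = x \<oplus> y \<longleftrightarrow> x = \<zero> \<and> y = \<zero>"
  by (metis ad_eq_zr)

definition le (infix "\<preceq>" 50) where "x \<preceq> y \<longleftrightarrow> (\<exists>z. y = x \<oplus> z)"

text \<open>Truncated subtraction, the operation that the class of ordered semidomains requires
  besides those of \<open>M\<close>.\<close>

definition mn where "mn x y = (if y \<preceq> x then THE z. x = y \<oplus> z else \<zero>)"

lemma lt_iff_le: "x \<prec> y \<longleftrightarrow> \<S> x \<preceq> y" by (simp add: lt_def le_def)

lemma ex_ad: "\<exists>z. y = x \<oplus> z \<or> x = y \<oplus> z"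
proof (rule induct[where P = "\<lambda>x. \<exists>z. y = x \<oplus> z \<or> x = y \<oplus> z"])
  fix x assume "\<exists>z. y = x \<oplus> z \<or> x = y \<oplus> z"
  then obtain z where "y = x \<oplus> z \<or> x = y \<oplus> z" by blast
  then consider w where "y = x \<oplus> \<S> w" | "y = x" | "x = y \<oplus> z" using zr_or_sc[of z] by auto
  then show "\<exists>z. y = \<S> x \<oplus> z \<or> \<S> x = y \<oplus> z"
  proof cases
    case (1 w) then show ?thesis by (intro exI[of _ w]) simp
  next
    case 2 then show ?thesis by (intro exI[of _ "\<one>"]) simp
  next
    case 3 then show ?thesis by (intro exI[of _ "\<S> z"]) simp
  qed
qed (intro dfn_rules, auto)

lemma mn_ad [simp]: "mn (a \<oplus> b) a = b" by (auto simp: mn_def le_def)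

lemma mn_ad_left [simp]: "mn a (a \<oplus> z) = \<zero>"
proof (cases "\<exists>w. a = (a \<oplus> z) \<oplus> w")
  case True
  then obtain w where "a \<oplus> \<zero> = a \<oplus> (z \<oplus> w)" by (metis ad_assoc ad_zr)
  then have "z = \<zero>" unfolding ad_left_cancel by (metis ad_eq_zr)
  then show ?thesis using mn_ad[of a \<zero>] by simp
qed (simp add: mn_def le_def)

text \<open>Makes the library of ordered semidomains available for \<open>M\<close> under the prefix
  \<open>ar\<close>.\<close>

sublocale ar: linordered_semidom where plus = "(\<oplus>)" and minus = mn and zero = "\<zero>" and times = "(\<otimes>)" and one = "\<one>" and less_eq = "(\<preceq>)" and less = "(\<prec>)"
proof
  fix a b c
  show "a \<oplus> b \<oplus> c = a \<oplus> (b \<oplus> c)" by (rule ad_assoc)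
  show "a \<oplus> b = b \<oplus> a" by (rule ad_comm)
  show "\<zero> \<oplus> a = a" by simp
  show "mn (a \<oplus> b) a = b" by simp
  show "a \<otimes> (b \<oplus> c) = a \<otimes> b \<oplus> a \<otimes> c" by (simp add: ml_comm[of a] ml_distrib)
  then have "a \<otimes> (x \<oplus> y) = a \<otimes> x \<oplus> a \<otimes> y" for x y by (simp add: ml_comm[of a] ml_distrib)
  then show "a \<otimes> mn b c = mn (a \<otimes> b) (a \<otimes> c)"
    using ex_ad[of b c] by auto
  show "mn (mn a b) c = mn a (b \<oplus> c)"
  proof (cases "b \<oplus> c \<preceq> a")
    case True
    then obtain z where "a = b \<oplus> (c \<oplus> z)" by (auto simp: le_def ad_assoc)
    then show ?thesis by (auto simp: mn_def le_def ad_assoc)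
  next
    case False
    have "mn \<zero> c = \<zero>" by (auto simp: mn_def le_def)
    moreover have "\<not> c \<preceq> mn a b" if ba: "b \<preceq> a"
    proof -
      obtain z where z: "a = b \<oplus> z" using ba unfolding le_def by blast
      then have "mn a b = z" by (auto simp: mn_def le_def)
      then show ?thesis using False z by (auto simp: le_def ad_assoc)
    qed
    ultimately show ?thesis using False by (auto simp: mn_def)
  qed
  show "a \<otimes> b \<otimes> c = a \<otimes> (b \<otimes> c)" by (rule ml_assoc)
  show "a \<otimes> b = b \<otimes> a" by (rule ml_comm)
  show "\<one> \<otimes> a = a" by simp
  show "(a \<oplus> b) \<otimes> c = a \<otimes> c \<oplus> b \<otimes> c" by (rule ml_distrib)
  show "\<zero> \<otimes> a = \<zero>" by simp
  show "a \<otimes> \<zero> = \<zero>" by simp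
  show "\<zero> \<noteq> \<one>" by simp
  show "a \<preceq> b \<Longrightarrow> c \<oplus> a \<preceq> c \<oplus> b" by (auto simp: le_def ad_assoc)
  show "a \<preceq> a" unfolding le_def by (rule exI[of _ \<zero>]) simp
  show "a \<preceq> b \<Longrightarrow> b \<preceq> c \<Longrightarrow> a \<preceq> c" unfolding le_def by (metis ad_assoc)
  show anti: "a \<preceq> b \<Longrightarrow> b \<preceq> a \<Longrightarrow> a = b"
  proof -
    assume "a \<preceq> b" "b \<preceq> a"
    then obtain z w where *: "b = a \<oplus> z" "a = b \<oplus> w" by (auto simp: le_def)
    then have "a \<oplus> \<zero> = a \<oplus> (z \<oplus> w)" by (metis ad_assoc ad_zr)
    then have "z = \<zero>" unfolding ad_left_cancel by (metis ad_eq_zr)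
    then show "a = b" using * by simp
  qed
  show "(a \<prec> b) = (a \<preceq> b \<and> \<not> b \<preceq> a)"
  proof
    assume "a \<prec> b"
    then obtain z where b: "b = a \<oplus> \<S> z" by (auto simp: lt_def)
    { fix w assume "a = b \<oplus> w"
      then have "a \<oplus> \<zero> = a \<oplus> \<S> (z \<oplus> w)" using b by (metis ad_assoc ad_sc ad_zr sc_ad)
      then have False unfolding ad_left_cancel by simp }
    then show "a \<preceq> b \<and> \<not> b \<preceq> a" using b unfolding le_def by blast
  next
    assume a: "a \<preceq> b \<and> \<not> b \<preceq> a"
    then obtain z where b: "b = a \<oplus> z" by (auto simp: le_def)
    have "z \<noteq> \<zero>" using a b unfolding le_def by (metis ad_zr)
    then show "a \<prec> b" using b zr_or_sc[of z] by (auto simp: lt_def)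
  qed
  show "a \<preceq> b \<or> b \<preceq> a" using ex_ad unfolding le_def by blast
  show "a \<prec> b \<Longrightarrow> \<zero> \<prec> c \<Longrightarrow> c \<otimes> a \<prec> c \<otimes> b"
  proof -
    assume "a \<prec> b" "\<zero> \<prec> c"
    then obtain z w where "b = \<S> (a \<oplus> z)" "c = \<S> w" by (auto simp: lt_def)
    then show ?thesis
      by (auto simp: lt_def ml_distrib ml_comm[of w] ad_assoc ad_comm ad_left_comm
          intro!: exI[of _ "z \<otimes> w \<oplus> (w \<oplus> z)"])
  qed
  show "\<zero> \<prec> \<one>" by (auto simp: lt_def intro: exI[of _ \<zero>])
  show "b \<preceq> a \<Longrightarrow> mn a b \<oplus> b = a" by (auto simp: mn_def le_def ad_comm[of _ b])
  show "a \<noteq> \<zero> \<Longrightarrow> b \<noteq> \<zero> \<Longrightarrow> a \<otimes> b \<noteq> \<zero>"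
    using zr_or_sc[of a] zr_or_sc[of b] by auto
qed

lemma dfn_le: "dft M s \<Longrightarrow> dft M t \<Longrightarrow> dfn M (\<lambda>e. s e \<preceq> t e)"
  by (rule dfn_subst2) (unfold le_def, intro dfn_rules)

lemmas [dfn_rules] = dfn_le

lemma zr_le [simp]: "\<zero> \<preceq> x" by (auto simp: le_def)

lemma not_lt_zr [simp]: "\<not> x \<prec> \<zero>" by (auto simp: lt_def)

lemma zr_lt_sc [simp]: "\<zero> \<prec> \<S> x" by (auto simp: lt_def)

lemma zr_lt_iff: "\<zero> \<prec> x \<longleftrightarrow> x \<noteq> \<zero>" using zr_or_sc[of x] by auto

lemma lt_sc_iff: "x \<prec> \<S> y \<longleftrightarrow> x \<preceq> y" by (auto simp: lt_def le_def)

lemma sc_lt_sc [simp]: "\<S> x \<prec> \<S> y \<longleftrightarrow> x \<prec> y" by (auto simp: lt_def)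

lemma sc_le_sc [simp]: "\<S> x \<preceq> \<S> y \<longleftrightarrow> x \<preceq> y" by (auto simp: le_def)

lemma lt_sc [simp]: "x \<prec> \<S> x" by (simp add: lt_sc_iff)

lemma le_sc [simp]: "x \<preceq> \<S> x" by (simp add: ar.less_imp_le)

lemma sc_le_iff: "\<S> x \<preceq> y \<longleftrightarrow> x \<prec> y" by (simp add: lt_iff_le)

lemma le_ad [simp]: "x \<preceq> x \<oplus> y" "x \<preceq> y \<oplus> x"
  by (auto simp: le_def ad_comm)

lemma double_inject: "x \<oplus> x = y \<oplus> y \<longleftrightarrow> x = y"
  by (metis ar.add_strict_mono ar.less_irrefl ar.linorder_cases)

lemma double_le: "x \<oplus> x \<preceq> y \<oplus> y \<longleftrightarrow> x \<preceq> y"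
  by (metis ar.add_strict_mono ar.add_mono ar.not_less)

subsection \<open>Division\<close>

lemma div_ex: "\<zero> \<prec> d \<Longrightarrow> \<exists>q r. u = q \<otimes> d \<oplus> r \<and> r \<prec> d"
proof -
  assume d: "\<zero> \<prec> d"
  show ?thesis
  proof (rule induct[where P = "\<lambda>u. \<exists>q r. u = q \<otimes> d \<oplus> r \<and> r \<prec> d"])
    show "\<exists>q r. \<zero> = q \<otimes> d \<oplus> r \<and> r \<prec> d" 
      by (rule exI[of _ \<zero>], rule exI[of _ \<zero>]) (simp add: d)
    fix u assume "\<exists>q r. u = q \<otimes> d \<oplus> r \<and> r \<prec> d"
    then obtain q r where qr: "u = q \<otimes> d \<oplus> r" "r \<prec> d" by blast
    show "\<exists>q r. \<S> u = q \<otimes> d \<oplus> r \<and> r \<prec> d"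
    proof (cases "\<S> r = d")
      case True
      have "\<S> u = \<S> q \<otimes> d \<oplus> \<zero>" unfolding qr(1) True[symmetric]
        by (simp add: ad_assoc ad_comm ad_left_comm)
      then show ?thesis using d by blast
    next
      case False
      then have "\<S> r \<prec> d" using qr(2) lt_iff_le ar.order.not_eq_order_implies_strict by blast
      moreover have "\<S> u = q \<otimes> d \<oplus> \<S> r" using qr(1) by simp
      ultimately show ?thesis by blast
    qed
  qed (intro dfn_rules)
qed

lemma div_unique_aux:
  assumes "q \<otimes> d \<oplus> r = q' \<otimes> d \<oplus> r'" "r \<prec> d"
  shows "\<not> q \<prec> q'"
proof
  assume "q \<prec> q'"
  then obtain z where "q' = \<S> (q \<oplus> z)" by (auto simp: lt_def)
  then have "q \<otimes> d \<oplus> r = q \<otimes> d \<oplus> (d \<oplus> (z \<otimes> d \<oplus> r'))"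
    using assms(1) by (simp add: ml_distrib ad_assoc ad_comm ad_left_comm)
  then have "r = d \<oplus> (z \<otimes> d \<oplus> r')" by simp
  then show False using assms(2) by (metis le_ad(1) ar.not_less)
qed

lemma div_unique:
  assumes "q \<otimes> d \<oplus> r = q' \<otimes> d \<oplus> r'" "r \<prec> d" "r' \<prec> d"
  shows "q = q' \<and> r = r'"
  using div_unique_aux[OF assms(1,2)] div_unique_aux[OF assms(1)[symmetric] assms(3)] assms(1)
  by (metis ad_left_cancel ar.linorder_cases)

subsection \<open>Pairing\<close>

text \<open>A product of consecutive numbers is even, by induction, so the description behind
  \<open>pr\<close> has a witness; its uniqueness is \<open>double_inject\<close>.\<close>

lemma pr_ex: "\<exists>z. z \<oplus> z = (x \<oplus> y) \<otimes> \<S> (x \<oplus> y) \<oplus> (x \<oplus> x)"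
proof -
  have "\<exists>t. t \<oplus> t = s \<otimes> \<S> s" for s
  proof (rule induct[where P = "\<lambda>s. \<exists>t. t \<oplus> t = s \<otimes> \<S> s"])
    fix s assume "\<exists>t. t \<oplus> t = s \<otimes> \<S> s"
    then obtain t where t: "t \<oplus> t = s \<otimes> \<S> s" by blast
    have "(t \<oplus> \<S> s) \<oplus> (t \<oplus> \<S> s) = (t \<oplus> t) \<oplus> (\<S> s \<oplus> \<S> s)"
      by (simp only: ad_assoc ad_comm ad_left_comm)
    also have "\<dots> = \<S> s \<otimes> \<S> (\<S> s)"
      unfolding t by (simp add: ad_assoc ad_comm ad_left_comm)
    finally show "\<exists>t. t \<oplus> t = \<S> s \<otimes> \<S> (\<S> s)" by blast
  qed (intro dfn_rules, auto)
  then obtain t where t: "t \<oplus> t = (x \<oplus> y) \<otimes> \<S> (x \<oplus> y)" by blast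
  show ?thesis
    by (rule exI[of _ "t \<oplus> x"]) (simp only: t[symmetric] ad_assoc ad_left_comm[of x t])
qed

lemma pr_eq: "pr M x y \<oplus> pr M x y = (x \<oplus> y) \<otimes> \<S> (x \<oplus> y) \<oplus> (x \<oplus> x)"
proof -
  obtain z where z: "z \<oplus> z = (x \<oplus> y) \<otimes> \<S> (x \<oplus> y) \<oplus> (x \<oplus> x)" using pr_ex by blast
  then have "pr M x y = z" unfolding pr_def
    by (intro the_equality) (metis double_inject)+
  then show ?thesis using z by simp
qed

text \<open>Replaces the description by a plain equation, from which definability follows by the
  rules. The other functions given by descriptions are treated in the same way.\<close>

lemma pr_eq_iff: "z = pr M x y \<longleftrightarrow> z \<oplus> z = (x \<oplus> y) \<otimes> \<S> (x \<oplus> y) \<oplus> (x \<oplus> x)"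
  by (metis pr_eq double_inject)

lemma dft_pr: "dft M s \<Longrightarrow> dft M t \<Longrightarrow> dft M (\<lambda>e. pr M (s e) (t e))"
  by (rule dft_subst2[where g = "pr M"]) (unfold pr_eq_iff, intro dfn_rules)

lemmas [dfn_rules] = dft_pr

text \<open>Pairs are ordered by their diagonal: with s = x + y, twice the code is at most s(s+1) +
  2s, which is below (s+1)(s+2), a lower bound for twice any code on a later diagonal.\<close>

lemma pr_sum_less:
  assumes "x \<oplus> y \<prec> x' \<oplus> y'"
  shows "pr M x y \<prec> pr M x' y'"
proof -
  let ?s = "x \<oplus> y" and ?s' = "x' \<oplus> y'"
  have "pr M x y \<oplus> pr M x y \<preceq> ?s \<otimes> \<S> ?s \<oplus> (?s \<oplus> ?s)"
    unfolding pr_eq by (intro ar.add_mono le_ad ar.order_refl)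
  also have "\<dots> \<prec> \<S> ?s \<otimes> \<S> (\<S> ?s)"
    by (auto simp: lt_def ad_assoc ad_comm ad_left_comm intro!: exI[of _ "\<one>"])
  also have "\<dots> \<preceq> ?s' \<otimes> \<S> ?s'"
    by (rule ar.mult_mono) (use assms in \<open>auto simp: sc_le_iff\<close>)
  also have "\<dots> \<preceq> pr M x' y' \<oplus> pr M x' y'" unfolding pr_eq by (rule le_ad)
  finally show ?thesis by (metis double_le ar.not_le)
qed

lemma pr_inject [simp]: "pr M x y = pr M x' y' \<longleftrightarrow> x = x' \<and> y = y'"
proof (intro iffI)
  assume eq: "pr M x y = pr M x' y'"
  then have s: "x \<oplus> y = x' \<oplus> y'"
    using pr_sum_less[of x y x' y'] pr_sum_less[of x' y' x y]
    by (metis ar.less_irrefl ar.linorder_cases)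
  have "x \<oplus> x = x' \<oplus> x'"
    using pr_eq[of x y] pr_eq[of x' y'] unfolding eq s by (metis ad_left_cancel)
  then have "x = x'" by (simp add: double_inject)
  then show "x = x' \<and> y = y'" using s by simp
qed simp

lemma pr_ge: "x \<oplus> (x \<oplus> y) \<preceq> pr M x y"
proof -
  let ?s = "x \<oplus> y"
  have "?s \<oplus> ?s \<preceq> ?s \<otimes> \<S> ?s" using zr_or_sc[of ?s] by auto
  then have "(?s \<oplus> ?s) \<oplus> (x \<oplus> x) \<preceq> pr M x y \<oplus> pr M x y"
    unfolding pr_eq by (rule ar.add_right_mono)
  then have "(x \<oplus> ?s) \<oplus> (x \<oplus> ?s) \<preceq> pr M x y \<oplus> pr M x y"
    by (simp only: ad_assoc ad_comm ad_left_comm)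
  then show ?thesis by (simp only: double_le)
qed

text \<open>Every tag in a code of syntax is nonzero, so this is the reason why immediate
  subformulas have strictly smaller codes.\<close>

lemma pr_gt:
  assumes "x \<noteq> \<zero>"
  shows "x \<prec> pr M x y" "y \<prec> pr M x y"
proof -
  obtain w where w: "x = \<S> w" using assms zr_or_sc by blast
  have "x \<oplus> (x \<oplus> y) = \<S> (x \<oplus> (w \<oplus> y))" "x \<oplus> (x \<oplus> y) = \<S> (y \<oplus> (x \<oplus> w))"
    by (simp_all add: w ad_assoc ad_comm ad_left_comm)
  then have "x \<prec> x \<oplus> (x \<oplus> y)" "y \<prec> x \<oplus> (x \<oplus> y)" unfolding lt_def by blast+
  then show "x \<prec> pr M x y" "y \<prec> pr M x y" using pr_ge[of x y] by order+
qed

lemma pr_ge_fst: "x \<preceq> pr M x y" and pr_ge_snd: "y \<preceq> pr M x y"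
  using pr_ge[of x y] by (metis ad_assoc ad_comm le_ad(1) ar.order_trans)+

text \<open>The successor moves along the Cantor diagonals: (x, y+1) is followed by (x+1, y), and
  the last pair (x, 0) of a diagonal by (0, x+1).\<close>

lemma pr_surj: "\<exists>x y. z = pr M x y"
proof (rule induct[where P = "\<lambda>z. \<exists>x y. z = pr M x y"])
  show "\<exists>x y. \<zero> = pr M x y" by (intro exI[of _ \<zero>]) (simp add: pr_eq_iff)
  fix z assume "\<exists>x y. z = pr M x y"
  then obtain x y where z: "z = pr M x y" by blast
  have S: "\<S> z \<oplus> \<S> z = \<S> (\<S> (z \<oplus> z))" by simp
  show "\<exists>x y. \<S> z = pr M x y"
  proof (cases "y = \<zero>")
    case True
    have "\<S> z = pr M \<zero> (\<S> x)" unfolding pr_eq_iff S unfolding z pr_eq True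
      by (simp add: ad_assoc ad_comm ad_left_comm)
    then show ?thesis by blast
  next
    case False
    then obtain w where w: "y = \<S> w" using zr_or_sc by blast
    have "\<S> z = pr M (\<S> x) w" unfolding pr_eq_iff S unfolding z pr_eq w
      by (simp add: ad_assoc ad_comm ad_left_comm)
    then show ?thesis by blast
  qed
qed (intro dfn_rules)

end

lemma dft_app: "dft M (\<lambda>e. g (e 0)) \<Longrightarrow> dft M s \<Longrightarrow> dft M (\<lambda>e. g (s e))"
  by (rule dft_subst1) (simp_all add: dft_def)

lemma dft_app2: "dft M (\<lambda>e. g (e 0) (e 1)) \<Longrightarrow> dft M s \<Longrightarrow> dft M t \<Longrightarrow> dft M (\<lambda>e. g (s e) (t e))"
  by (rule dft_subst2) (simp_all add: dft_def numeral_2_eq_2)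

lemma dfn_app: "dfn M (\<lambda>e. P (e 0)) \<Longrightarrow> dft M s \<Longrightarrow> dfn M (\<lambda>e. P (s e))"
  by (rule dfn_subst1)

context pa
begin

subsection \<open>Sequences\<close>

definition cg :: "'m \<Rightarrow> 'm \<Rightarrow> 'm \<Rightarrow> bool" where
  "cg m a b \<longleftrightarrow> (\<exists>s t. a \<oplus> s \<otimes> m = b \<oplus> t \<otimes> m)"

lemma dfn_cg: "dft M s \<Longrightarrow> dft M t \<Longrightarrow> dft M u \<Longrightarrow> dfn M (\<lambda>e. cg (s e) (t e) (u e))"
  by (rule dfn_subst3[where P = cg]) (unfold cg_def, intro dfn_rules)

lemmas [dfn_rules] = dfn_cg

lemma cg_refl [simp]: "cg m a a" by (auto simp: cg_def)

lemma cg_trans [trans]: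
  assumes "cg m a b" "cg m b c" shows "cg m a c"
proof -
  obtain s t where 1: "a \<oplus> s \<otimes> m = b \<oplus> t \<otimes> m" using assms(1) cg_def by blast
  obtain s' t' where 2: "b \<oplus> s' \<otimes> m = c \<oplus> t' \<otimes> m" using assms(2) cg_def by blast
  have "a \<oplus> (s \<oplus> s') \<otimes> m = (a \<oplus> s \<otimes> m) \<oplus> s' \<otimes> m" by (simp only: ml_distrib ad_assoc)
  also have "\<dots> = (b \<oplus> s' \<otimes> m) \<oplus> t \<otimes> m" unfolding 1 by (simp only: ad_assoc ad_comm ad_left_comm)
  also have "\<dots> = c \<oplus> (t' \<oplus> t) \<otimes> m" unfolding 2 by (simp only: ml_distrib ad_assoc)
  finally show ?thesis unfolding cg_def by blast
qed

lemma cg_add_right: "cg m a b \<Longrightarrow> cg m (a \<oplus> c) (b \<oplus> c)"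
  unfolding cg_def by (metis ad_assoc ad_comm)

lemma cg_add_left: "cg m a b \<Longrightarrow> cg m (c \<oplus> a) (c \<oplus> b)"
  using cg_add_right by (simp add: ad_comm)

lemma cg_mult_right: "cg m a b \<Longrightarrow> cg m (a \<otimes> c) (b \<otimes> c)"
proof -
  assume "cg m a b"
  then obtain s t where "a \<oplus> s \<otimes> m = b \<oplus> t \<otimes> m" using cg_def by blast
  then have "(a \<oplus> s \<otimes> m) \<otimes> c = (b \<oplus> t \<otimes> m) \<otimes> c" by simp
  then have "a \<otimes> c \<oplus> (s \<otimes> c) \<otimes> m = b \<otimes> c \<oplus> (t \<otimes> c) \<otimes> m"
    by (simp only: ml_distrib ml_assoc ml_comm[of m c])
  then show ?thesis unfolding cg_def by blast
qed

lemma cg_mult_left: "cg m a b \<Longrightarrow> cg m (c \<otimes> a) (c \<otimes> b)"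
  using cg_mult_right by (simp add: ml_comm)

lemma cg_multiple: "cg m (a \<oplus> q \<otimes> m) a"
  unfolding cg_def by (metis ad_zr zr_ml)

lemma cg_rem:
  assumes "cg m u r" "r \<prec> m"
  shows "\<exists>q. u = q \<otimes> m \<oplus> r"
proof -
  have "\<zero> \<prec> m" using assms(2) by (metis zr_lt_iff not_lt_zr)
  then obtain q r' where u: "u = q \<otimes> m \<oplus> r'" "r' \<prec> m" using div_ex by blast
  obtain s t where "u \<oplus> s \<otimes> m = r \<oplus> t \<otimes> m" using assms(1) cg_def by blast
  then have "(q \<oplus> s) \<otimes> m \<oplus> r' = t \<otimes> m \<oplus> r"
    unfolding u(1) by (simp only: ml_distrib ad_assoc ad_comm ad_left_comm)
  then have "r' = r" using div_unique u(2) assms(2) by blast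
  then show ?thesis using u by blast
qed

text \<open>Invertibility modulo \<open>m\<close> takes the place of coprimality: it passes to
  products at once and directly solves linear congruences.\<close>

definition cginv :: "'m \<Rightarrow> 'm \<Rightarrow> bool" where
  "cginv m a \<longleftrightarrow> (\<exists>t. cg m (a \<otimes> t) \<one>)"

lemma dfn_cginv: "dft M s \<Longrightarrow> dft M t \<Longrightarrow> dfn M (\<lambda>e. cginv (s e) (t e))"
  by (rule dfn_subst2[where P = cginv]) (unfold cginv_def, intro dfn_rules)

lemmas [dfn_rules] = dfn_cginv

lemma cginv_mult:
  assumes "cginv m a" "cginv m b" shows "cginv m (a \<otimes> b)"
proof -
  obtain s t where s: "cg m (a \<otimes> s) \<one>" and t: "cg m (b \<otimes> t) \<one>"
    using assms unfolding cginv_def by blast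
  have "(a \<otimes> b) \<otimes> (s \<otimes> t) = (a \<otimes> s) \<otimes> (b \<otimes> t)"
    by (simp only: ar.mult.assoc ar.mult.commute ar.mult.left_commute)
  also have "cg m \<dots> (\<one> \<otimes> (b \<otimes> t))" by (rule cg_mult_right[OF s])
  also have "cg m \<dots> (\<one> \<otimes> \<one>)" by (rule cg_mult_left[OF t])
  finally show ?thesis unfolding cginv_def by auto
qed

text \<open>The modulus that the beta function in \<open>elt\<close> uses at index
  \<open>i\<close>.\<close>

definition md :: "'m \<Rightarrow> 'm \<Rightarrow> 'm" where "md v i = \<S> (\<S> i \<otimes> v)"

lemma dft_md: "dft M s \<Longrightarrow> dft M t \<Longrightarrow> dft M (\<lambda>e. md (s e) (t e))"
  by (rule dft_subst2[where g = md]) (unfold md_def, intro dfn_rules)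

lemmas [dfn_rules] = dft_md

text \<open>With \<open>m = md v l\<close> and \<open>w = m - 1\<close> one has \<open>(l + 1) md v i = l - i\<close> and \<open>w^2 = 1\<close> modulo \<open>m\<close>,
  so \<open>(l + 1)^2 w v / (l - i)\<close> is an inverse of \<open>md v i\<close>.\<close>

lemma cginv_md:
  assumes "i \<prec> l" "l \<preceq> k" "\<And>d. \<zero> \<prec> d \<Longrightarrow> d \<preceq> k \<Longrightarrow> \<exists>e. d \<otimes> e = v"
  shows "cginv (md v l) (md v i)"
proof -
  let ?m = "md v l"
  obtain z where z: "l = i \<oplus> \<S> z" using assms(1) by (auto simp: lt_def)
  define d where "d = \<S> z"
  have "d \<preceq> k" using assms(2) le_ad(2)[of d i] ar.order.trans unfolding z d_def by blast
  then obtain e where e: "d \<otimes> e = v" using assms(3)[of d] by (auto simp: d_def)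
  define w where "w = \<S> l \<otimes> v"
  have m: "?m = \<S> w" by (simp add: md_def w_def)
  have Sl: "\<S> l = d \<oplus> \<S> i" by (simp add: z d_def ad_comm)
  have "\<S> l \<otimes> md v i = \<S> l \<oplus> \<S> l \<otimes> (\<S> i \<otimes> v)" unfolding md_def by (simp only: ml_sc ad_comm)
  also have "\<dots> = d \<oplus> (\<S> i \<oplus> \<S> i \<otimes> w)" unfolding w_def
    by (metis Sl ad_assoc ml_assoc ml_comm)
  also have "\<dots> = d \<oplus> \<S> i \<otimes> ?m" unfolding m by (simp only: ml_sc ad_comm)
  finally have 1: "cg ?m (\<S> l \<otimes> md v i) d" by (metis cg_multiple)
  have "md v i \<otimes> (\<S> l \<otimes> (e \<otimes> (\<S> l \<otimes> w))) = (\<S> l \<otimes> md v i) \<otimes> (e \<otimes> (\<S> l \<otimes> w))"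
    by (simp only: ar.mult.assoc ar.mult.commute ar.mult.left_commute)
  also have "cg ?m \<dots> (d \<otimes> (e \<otimes> (\<S> l \<otimes> w)))" by (rule cg_mult_right[OF 1])
  also have "d \<otimes> (e \<otimes> (\<S> l \<otimes> w)) = w \<otimes> w"
    unfolding w_def e[symmetric] by (simp only: ar.mult.assoc ar.mult.commute ar.mult.left_commute)
  also have "cg ?m (w \<otimes> w) \<one>" unfolding cg_def m
    by (rule exI[of _ "\<one>"], rule exI[of _ w]) simp
  finally show ?thesis unfolding cginv_def by blast
qed

text \<open>Plays the part of the factorial of \<open>k\<close>. The induction multiplies the old
  multiple by k+1, because definition by recursion becomes available only once sequences are
  coded.\<close>

lemma ex_common_multiple: "\<exists>v. v \<noteq> \<zero> \<and> (\<forall>d. \<zero> \<prec> d \<and> d \<preceq> k \<longrightarrow> (\<exists>e. d \<otimes> e = v))"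
proof (rule induct[where P = "\<lambda>k. \<exists>v. v \<noteq> \<zero> \<and> (\<forall>d. \<zero> \<prec> d \<and> d \<preceq> k \<longrightarrow> (\<exists>e. d \<otimes> e = v))"])
  show "\<exists>v. v \<noteq> \<zero> \<and> (\<forall>d. \<zero> \<prec> d \<and> d \<preceq> \<zero> \<longrightarrow> (\<exists>e. d \<otimes> e = v))"
    by (intro exI[of _ "\<one>"]) (metis sc_ne_zr(1) ar.not_le)
  fix k assume "\<exists>v. v \<noteq> \<zero> \<and> (\<forall>d. \<zero> \<prec> d \<and> d \<preceq> k \<longrightarrow> (\<exists>e. d \<otimes> e = v))"
  then obtain v where v: "v \<noteq> \<zero>" "\<And>d. \<zero> \<prec> d \<Longrightarrow> d \<preceq> k \<Longrightarrow> \<exists>e. d \<otimes> e = v" by blast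
  show "\<exists>v. v \<noteq> \<zero> \<and> (\<forall>d. \<zero> \<prec> d \<and> d \<preceq> \<S> k \<longrightarrow> (\<exists>e. d \<otimes> e = v))"
  proof (rule exI[of _ "v \<otimes> \<S> k"], intro conjI allI impI)
    show "v \<otimes> \<S> k \<noteq> \<zero>" using v(1) by simp
    fix d assume d: "\<zero> \<prec> d \<and> d \<preceq> \<S> k"
    show "\<exists>e. d \<otimes> e = v \<otimes> \<S> k"
    proof (cases "d = \<S> k")
      case True then show ?thesis using ml_comm by blast
    next
      case False
      then have "d \<preceq> k" using d by (metis lt_sc_iff ar.le_less)
      then show ?thesis using v(2) d ml_assoc by metis
    qed
  qed
qed (intro dfn_rules)

text \<open>Collection for a definable function, by induction on \<open>k\<close>; it supplies the
  size that the moduli must exceed.\<close>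

lemma ex_bound:
  assumes g: "dft M (\<lambda>e. g (e 0))"
  shows "\<exists>b. \<forall>i. i \<prec> k \<longrightarrow> g i \<prec> b"
proof (rule induct[where P = "\<lambda>k. \<exists>b. \<forall>i. i \<prec> k \<longrightarrow> g i \<prec> b"])
  show "dfn M (\<lambda>e. \<exists>b. \<forall>i. i \<prec> e 0 \<longrightarrow> g i \<prec> b)" by (intro dfn_rules dft_app[OF g])
  fix k assume "\<exists>b. \<forall>i. i \<prec> k \<longrightarrow> g i \<prec> b"
  then obtain b where b: "\<And>i. i \<prec> k \<Longrightarrow> g i \<prec> b" by blast
  show "\<exists>b. \<forall>i. i \<prec> \<S> k \<longrightarrow> g i \<prec> b"
  proof (intro exI[of _ "b \<oplus> \<S> (g k)"] allI impI)
    fix i assume "i \<prec> \<S> k"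
    then consider "i \<prec> k" | "i = k" by (metis lt_sc_iff ar.le_less)
    then show "g i \<prec> b \<oplus> \<S> (g k)"
    proof cases
      case 1 then show ?thesis using b le_ad(1) ar.less_le_trans by blast
    next
      case 2 then show ?thesis using le_ad(2) lt_sc ar.less_le_trans by blast
    qed
  qed
qed simp

text \<open>Induction on the number \<open>j\<close> of congruences solved. Besides the solution
  \<open>u\<close> it carries a common multiple \<open>p\<close> of the moduli used so far,
  invertible modulo every later one; adding a suitable multiple of \<open>p\<close> to
  \<open>u\<close> satisfies the next congruence and preserves the old ones.\<close>

lemma crt:
  assumes g: "dft M (\<lambda>e. g (e 0))"
    and v: "\<And>d. \<zero> \<prec> d \<Longrightarrow> d \<preceq> k \<Longrightarrow> \<exists>e. d \<otimes> e = v"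
  shows "j \<preceq> k \<longrightarrow> (\<exists>u p. (\<forall>i. i \<prec> j \<longrightarrow> cg (md v i) u (g i) \<and> (\<exists>q. p = q \<otimes> md v i)) \<and>
    (\<forall>l. j \<preceq> l \<and> l \<preceq> k \<longrightarrow> cginv (md v l) p))"
proof (rule induct[where P = "\<lambda>j. j \<preceq> k \<longrightarrow> (\<exists>u p. (\<forall>i. i \<prec> j \<longrightarrow> cg (md v i) u (g i) \<and> (\<exists>q. p = q \<otimes> md v i)) \<and>
    (\<forall>l. j \<preceq> l \<and> l \<preceq> k \<longrightarrow> cginv (md v l) p))"])
  show "dfn M (\<lambda>e. e 0 \<preceq> k \<longrightarrow> (\<exists>u p. (\<forall>i. i \<prec> e 0 \<longrightarrow> cg (md v i) u (g i) \<and> (\<exists>q. p = q \<otimes> md v i)) \<and>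
    (\<forall>l. e 0 \<preceq> l \<and> l \<preceq> k \<longrightarrow> cginv (md v l) p)))"
    by (intro dfn_rules dft_app[OF g])
  have "cginv m \<one>" for m unfolding cginv_def by (rule exI[of _ "\<one>"]) simp
  then show "\<zero> \<preceq> k \<longrightarrow> (\<exists>u p. (\<forall>i. i \<prec> \<zero> \<longrightarrow> cg (md v i) u (g i) \<and> (\<exists>q. p = q \<otimes> md v i)) \<and>
    (\<forall>l. \<zero> \<preceq> l \<and> l \<preceq> k \<longrightarrow> cginv (md v l) p))" by auto
next
  fix j
  assume IH: "j \<preceq> k \<longrightarrow> (\<exists>u p. (\<forall>i. i \<prec> j \<longrightarrow> cg (md v i) u (g i) \<and> (\<exists>q. p = q \<otimes> md v i)) \<and>
    (\<forall>l. j \<preceq> l \<and> l \<preceq> k \<longrightarrow> cginv (md v l) p))"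
  show "\<S> j \<preceq> k \<longrightarrow> (\<exists>u p. (\<forall>i. i \<prec> \<S> j \<longrightarrow> cg (md v i) u (g i) \<and> (\<exists>q. p = q \<otimes> md v i)) \<and>
    (\<forall>l. \<S> j \<preceq> l \<and> l \<preceq> k \<longrightarrow> cginv (md v l) p))"
  proof
    assume "\<S> j \<preceq> k"
    then have jk: "j \<prec> k" "j \<preceq> k" by (simp_all add: sc_le_iff)
    then obtain u p where up: "\<And>i. i \<prec> j \<Longrightarrow> cg (md v i) u (g i) \<and> (\<exists>q. p = q \<otimes> md v i)"
      "\<And>l. j \<preceq> l \<Longrightarrow> l \<preceq> k \<Longrightarrow> cginv (md v l) p" using IH by blast
    obtain t where t: "cg (md v j) (p \<otimes> t) \<one>" using up(2)[of j] jk unfolding cginv_def by blast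
    define w where "w = \<S> j \<otimes> v"
    have mw: "md v j = \<S> w" by (simp add: md_def w_def)
    \<comment> \<open>Since \<open>w\<close> is -1 modulo \<open>md v j\<close>, the product u
      \<otimes> w stands for -u, and \<open>s\<close> for t (g j - u), where \<open>t\<close>
      inverts \<open>p\<close>.\<close>
    define s where "s = t \<otimes> (g j \<oplus> u \<otimes> w)"
    have "p \<otimes> s = (p \<otimes> t) \<otimes> (g j \<oplus> u \<otimes> w)" by (simp only: s_def ml_assoc)
    then have "cg (md v j) (p \<otimes> s) (\<one> \<otimes> (g j \<oplus> u \<otimes> w))" using cg_mult_right[OF t] by simp
    then have "cg (md v j) (u \<oplus> p \<otimes> s) (u \<oplus> \<one> \<otimes> (g j \<oplus> u \<otimes> w))" by (rule cg_add_left)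
    also have "u \<oplus> \<one> \<otimes> (g j \<oplus> u \<otimes> w) = g j \<oplus> u \<otimes> md v j"
      unfolding mw by (simp add: ad_assoc ad_comm ad_left_comm)
    also have "cg (md v j) \<dots> (g j)" by (rule cg_multiple)
    finally have j: "cg (md v j) (u \<oplus> p \<otimes> s) (g j)" .
    show "\<exists>u p. (\<forall>i. i \<prec> \<S> j \<longrightarrow> cg (md v i) u (g i) \<and> (\<exists>q. p = q \<otimes> md v i)) \<and>
      (\<forall>l. \<S> j \<preceq> l \<and> l \<preceq> k \<longrightarrow> cginv (md v l) p)"
    proof (rule exI[of _ "u \<oplus> p \<otimes> s"], rule exI[of _ "p \<otimes> md v j"], intro conjI allI impI)
      fix i assume "i \<prec> \<S> j"
      then consider "i \<prec> j" | "i = j" by (metis lt_sc_iff ar.le_less)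
      then have "cg (md v i) (u \<oplus> p \<otimes> s) (g i) \<and> (\<exists>q. p \<otimes> md v j = q \<otimes> md v i)"
      proof cases
        case 1
        then obtain q where q: "p = q \<otimes> md v i" using up(1) by blast
        have "u \<oplus> p \<otimes> s = u \<oplus> (q \<otimes> s) \<otimes> md v i" unfolding q
          by (simp only: ar.mult.assoc ar.mult.commute ar.mult.left_commute)
        then have "cg (md v i) (u \<oplus> p \<otimes> s) u" using cg_multiple by simp
        moreover have "p \<otimes> md v j = (q \<otimes> md v j) \<otimes> md v i" unfolding q
          by (simp only: ar.mult.assoc ar.mult.commute ar.mult.left_commute)
        ultimately show ?thesis using up(1)[OF 1] cg_trans by blast
      next
        case 2 then show ?thesis using j by blast
      qed
      then show "cg (md v i) (u \<oplus> p \<otimes> s) (g i)" "\<exists>q. p \<otimes> md v j = q \<otimes> md v i" by auto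
    next
      fix l assume l: "\<S> j \<preceq> l \<and> l \<preceq> k"
      then have "cginv (md v l) (md v j)" using cginv_md[of j l k v] v by (simp add: sc_le_iff)
      moreover have "cginv (md v l) p" using up(2) l by (simp add: sc_le_iff ar.less_imp_le)
      ultimately show "cginv (md v l) (p \<otimes> md v j)" by (rule cginv_mult[rotated])
    qed
  qed
qed

section \<open>Coded sequences and definition by recursion\<close>

lemma elt_eq_iff:
  "r = elt M a i \<longleftrightarrow> (\<exists>u v q. a = pr M u v \<and> r \<prec> md v i \<and> u = q \<otimes> md v i \<oplus> r)"
proof -
  have ex: "\<exists>r. \<exists>u v q. a = pr M u v \<and> r \<prec> md v i \<and> u = q \<otimes> md v i \<oplus> r"
  proof -
    obtain u v where "a = pr M u v" using pr_surj by blast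
    moreover obtain q r where "u = q \<otimes> md v i \<oplus> r" "r \<prec> md v i"
      using div_ex[of "md v i" u] by (auto simp: md_def)
    ultimately show ?thesis by blast
  qed
  have un: "r = r'" if "\<exists>u v q. a = pr M u v \<and> r \<prec> md v i \<and> u = q \<otimes> md v i \<oplus> r"
    "\<exists>u v q. a = pr M u v \<and> r' \<prec> md v i \<and> u = q \<otimes> md v i \<oplus> r'" for r r'
    using that div_unique by (metis pr_inject)
  have e: "elt M a i = (THE r. \<exists>u v q. a = pr M u v \<and> r \<prec> md v i \<and> u = q \<otimes> md v i \<oplus> r)"
    by (simp add: elt_def md_def)
  from ex obtain r0 where r0: "\<exists>u v q. a = pr M u v \<and> r0 \<prec> md v i \<and> u = q \<otimes> md v i \<oplus> r0" by blast
  then have "elt M a i = r0" unfolding e using un by (intro the_equality) blast+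
  then show ?thesis using r0 un by blast
qed

lemma dft_elt: "dft M s \<Longrightarrow> dft M t \<Longrightarrow> dft M (\<lambda>e. elt M (s e) (t e))"
  by (rule dft_subst2[where g = "elt M"]) (unfold elt_eq_iff, intro dfn_rules)

lemmas [dfn_rules] = dft_elt

lemma ex_sequence:
  assumes g: "dft M (\<lambda>e. g (e 0))"
  shows "\<exists>a. \<forall>i. i \<prec> k \<longrightarrow> elt M a i = g i"
proof -
  obtain v where v: "v \<noteq> \<zero>" "\<And>d. \<zero> \<prec> d \<Longrightarrow> d \<preceq> k \<Longrightarrow> \<exists>e. d \<otimes> e = v"
    using ex_common_multiple[of k] by blast
  obtain b where b: "\<And>i. i \<prec> k \<Longrightarrow> g i \<prec> b" using ex_bound[OF g] by blast
  \<comment> \<open>A multiple of a common multiple is again one, and the factor \<open>b\<close>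
    makes every modulus larger than the entry to be stored.\<close>
  let ?v = "v \<otimes> b"
  have "\<exists>e. d \<otimes> e = ?v" if "\<zero> \<prec> d" "d \<preceq> k" for d
    using v(2)[OF that] ml_assoc by metis
  then obtain u where u: "\<And>i. i \<prec> k \<Longrightarrow> cg (md ?v i) u (g i)"
    using crt[OF g, of k ?v k] by auto
  have "elt M (pr M u ?v) i = g i" if i: "i \<prec> k" for i
  proof -
    have "\<one> \<preceq> v" using v(1) by (simp add: sc_le_iff zr_lt_iff)
    then have "\<one> \<otimes> b \<preceq> ?v" by (rule ar.mult_right_mono) simp
    then have "b \<preceq> ?v" by simp
    also have "?v \<preceq> \<S> i \<otimes> ?v" by simp
    also have "\<dots> \<preceq> md ?v i" by (simp add: md_def)
    finally have "g i \<prec> md ?v i" using b[OF i] by order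
    moreover from this obtain q where "u = q \<otimes> md ?v i \<oplus> g i" using cg_rem u[OF i] by blast
    ultimately have "g i = elt M (pr M u ?v) i" unfolding elt_eq_iff by blast
    then show ?thesis by simp
  qed
  then show ?thesis by blast
qed

text \<open>A code for the beta function cannot be lengthened in place, so the induction step
  recodes the old entries together with the new one as values of a definable function.\<close>

lemma ex_recursion:
  assumes h: "dft M (\<lambda>e. h (e 0) (e 1))"
  shows "\<exists>s. elt M s \<zero> = x \<and> (\<forall>i. i \<prec> k \<longrightarrow> elt M s (\<S> i) = h i (elt M s i))"
proof (rule induct[where P = "\<lambda>k. \<exists>s. elt M s \<zero> = x \<and> (\<forall>i. i \<prec> k \<longrightarrow> elt M s (\<S> i) = h i (elt M s i))"])
  show "dfn M (\<lambda>e. \<exists>s. elt M s \<zero> = x \<and> (\<forall>i. i \<prec> e 0 \<longrightarrow> elt M s (\<S> i) = h i (elt M s i)))"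
    by (intro dfn_rules dft_app2[OF h])
  show "\<exists>s. elt M s \<zero> = x \<and> (\<forall>i. i \<prec> \<zero> \<longrightarrow> elt M s (\<S> i) = h i (elt M s i))"
    using ex_sequence[OF dft_const[of _ x], of "\<one>"] by (metis not_lt_zr zr_lt_sc)
  fix k assume "\<exists>s. elt M s \<zero> = x \<and> (\<forall>i. i \<prec> k \<longrightarrow> elt M s (\<S> i) = h i (elt M s i))"
  then obtain s where s: "elt M s \<zero> = x" "\<And>i. i \<prec> k \<Longrightarrow> elt M s (\<S> i) = h i (elt M s i)" by blast
  define g where "g i = (if i \<preceq> k then elt M s i else h k (elt M s k))" for i
  have "dft M (\<lambda>e. g (e 0))" unfolding g_def by (intro dfn_rules)
  then obtain a where a: "\<And>i. i \<prec> \<S> (\<S> k) \<Longrightarrow> elt M a i = g i" using ex_sequence by blast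
  have "elt M a (\<S> i) = h i (elt M a i)" if "i \<prec> \<S> k" for i
  proof -
    have "elt M a i = elt M s i" using a[of i] that
      by (simp add: g_def lt_sc_iff ar.less_imp_le ar.order.strict_trans[of i "\<S> k"])
    moreover have "elt M a (\<S> i) = g (\<S> i)" using a[of "\<S> i"] that by simp
    moreover have "i \<prec> k \<or> i = k" using that by (metis lt_sc_iff ar.le_less)
    ultimately show ?thesis using s(2)[of i] by (auto simp: g_def sc_le_iff)
  qed
  moreover have "elt M a \<zero> = x" using a[of \<zero>] s(1) by (simp add: g_def)
  ultimately show "\<exists>s. elt M s \<zero> = x \<and> (\<forall>i. i \<prec> \<S> k \<longrightarrow> elt M s (\<S> i) = h i (elt M s i))" by blast
qed

lemma recursion_unique:
  assumes "elt M s \<zero> = elt M s' \<zero>"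
    and s: "\<And>i. i \<prec> k \<Longrightarrow> elt M s (\<S> i) = h i (elt M s i)"
    and s': "\<And>i. i \<prec> k \<Longrightarrow> elt M s' (\<S> i) = h i (elt M s' i)"
    and "j \<preceq> k"
  shows "elt M s j = elt M s' j"
proof -
  have "j \<preceq> k \<longrightarrow> elt M s j = elt M s' j"
  proof (rule induct[where P = "\<lambda>j. j \<preceq> k \<longrightarrow> elt M s j = elt M s' j"])
    fix j assume "j \<preceq> k \<longrightarrow> elt M s j = elt M s' j"
    then show "\<S> j \<preceq> k \<longrightarrow> elt M s (\<S> j) = elt M s' (\<S> j)"
      using s[of j] s'[of j] by (auto simp: sc_le_iff ar.less_imp_le)
  qed (intro dfn_rules, use assms(1) in simp)
  then show ?thesis using assms(4) by blast
qed


subsection \<open>Powers of two and binary digits\<close>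

lemma pow2_unique:
  assumes "elt M s \<zero> = \<one>" "\<And>j. j \<prec> i \<Longrightarrow> elt M s (\<S> j) = elt M s j \<oplus> elt M s j"
    and "elt M s' \<zero> = \<one>" "\<And>j. j \<prec> i \<Longrightarrow> elt M s' (\<S> j) = elt M s' j \<oplus> elt M s' j"
    and "j \<preceq> i"
  shows "elt M s j = elt M s' j"
  by (rule recursion_unique[where h = "\<lambda>i x. x \<oplus> x"]) (use assms in auto)

lemma pow2_ex: "\<exists>s. elt M s \<zero> = \<one> \<and> (\<forall>j. j \<prec> i \<longrightarrow> elt M s (\<S> j) = elt M s j \<oplus> elt M s j)"
  by (rule ex_recursion[where h = "\<lambda>i x. x \<oplus> x"]) (intro dfn_rules)

lemma pow2_eq_iff:
  "p = pow2 M i \<longleftrightarrow> (\<exists>s. elt M s \<zero> = \<one> \<and> (\<forall>j. j \<prec> i \<longrightarrow> elt M s (\<S> j) = elt M s j \<oplus> elt M s j)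
     \<and> elt M s i = p)" (is "_ \<longleftrightarrow> ?P p")
proof -
  have un: "p = q" if "?P p" "?P q" for p q using that pow2_unique ar.order_refl by metis
  obtain q where q: "?P q" using pow2_ex by blast
  then have "pow2 M i = q" unfolding pow2_def by (rule the_equality) (use un q in blast)
  then show ?thesis using un q by blast
qed

lemma dft_pow2: "dft M s \<Longrightarrow> dft M (\<lambda>e. pow2 M (s e))"
  by (rule dft_subst1[where g = "pow2 M"]) (unfold pow2_eq_iff, intro dfn_rules)

lemmas [dfn_rules] = dft_pow2

lemma dfn_mem: "dft M s \<Longrightarrow> dft M t \<Longrightarrow> dfn M (\<lambda>e. mem M (s e) (t e))"
  by (rule dfn_subst2[where P = "mem M"]) (unfold mem_def, intro dfn_rules)

lemmas [dfn_rules] = dfn_mem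

lemma pow2_zr [simp]: "pow2 M \<zero> = \<one>"
proof -
  have "\<one> = pow2 M \<zero>" unfolding pow2_eq_iff using pow2_ex[of \<zero>] by auto
  then show ?thesis by simp
qed

lemma pow2_sc [simp]: "pow2 M (\<S> i) = pow2 M i \<oplus> pow2 M i"
proof -
  obtain s where s: "elt M s \<zero> = \<one>" "\<And>j. j \<prec> \<S> i \<Longrightarrow> elt M s (\<S> j) = elt M s j \<oplus> elt M s j"
    using pow2_ex[of "\<S> i"] by blast
  then have "elt M s (\<S> i) = pow2 M (\<S> i)" unfolding pow2_eq_iff by blast
  moreover have "elt M s i = pow2 M i" unfolding pow2_eq_iff
    using s ar.order.strict_trans[OF _ lt_sc] by blast
  ultimately show ?thesis using s(2)[of i] by simp
qed

lemma pow2_pos [simp]: "\<zero> \<prec> pow2 M i" "pow2 M i \<noteq> \<zero>"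
proof -
  show "pow2 M i \<noteq> \<zero>"
    by (rule induct[where P = "\<lambda>i. pow2 M i \<noteq> \<zero>"]) (intro dfn_rules, simp_all)
  then show "\<zero> \<prec> pow2 M i" by (simp add: zr_lt_iff)
qed

lemma pow2_ad: "pow2 M (i \<oplus> j) = pow2 M i \<otimes> pow2 M j"
  by (rule induct[where P = "\<lambda>i. pow2 M (i \<oplus> j) = pow2 M i \<otimes> pow2 M j"])
     (intro dfn_rules, simp_all add: ml_distrib)

lemma lt_pow2: "i \<prec> pow2 M i"
proof (rule induct[where P = "\<lambda>i. i \<prec> pow2 M i"])
  fix i assume i: "i \<prec> pow2 M i"
  then have "\<S> i \<preceq> pow2 M i" by (simp add: sc_le_iff)
  then have "\<S> i \<oplus> \<zero> \<prec> pow2 M i \<oplus> pow2 M i" by (intro ar.add_le_less_mono) simp_all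
  then show "\<S> i \<prec> pow2 M (\<S> i)" by simp
qed (intro dfn_rules, simp)

lemma pow2_mono: "i \<preceq> j \<Longrightarrow> pow2 M i \<preceq> pow2 M j"
proof -
  assume "i \<preceq> j"
  then obtain z where "j = z \<oplus> i" by (auto simp: le_def ad_comm)
  moreover have "\<one> \<preceq> pow2 M z" by (simp add: sc_le_iff)
  then have "\<one> \<otimes> pow2 M i \<preceq> pow2 M z \<otimes> pow2 M i" by (rule ar.mult_right_mono) simp
  ultimately show ?thesis by (simp add: pow2_ad)
qed

lemma odd_ne_double: "\<S> (x \<oplus> x) \<noteq> y \<oplus> y"
proof
  assume eq: "\<S> (x \<oplus> x) = y \<oplus> y"
  show False
  proof (cases "y \<preceq> x")
    case True
    then have "y \<oplus> y \<preceq> x \<oplus> x" by (simp add: double_le)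
    then show False unfolding eq[symmetric] by (metis lt_sc ar.not_le)
  next
    case False
    then have "\<S> x \<preceq> y" by (simp add: sc_le_iff ar.not_le)
    then have "\<S> x \<oplus> \<S> x \<preceq> y \<oplus> y" by (simp add: double_le del: sc_ad ad_sc)
    then show False unfolding eq[symmetric] by (simp add: sc_le_iff)
  qed
qed

lemma mem_iff: "c = q \<otimes> pow2 M i \<oplus> r \<Longrightarrow> r \<prec> pow2 M i \<Longrightarrow> mem M i c \<longleftrightarrow> (\<exists>x. q = \<S> (x \<oplus> x))"
  unfolding mem_def using div_unique by metis

text \<open>Parity is unaffected by adding a double. This keeps the digits below k in place when the
  k-th power of two is added, since that power is an even multiple of each smaller one.\<close>

lemma odd_add_double: "(\<exists>x. (y \<oplus> y) \<oplus> q = \<S> (x \<oplus> x)) \<longleftrightarrow> (\<exists>x. q = \<S> (x \<oplus> x))"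
proof
  assume "\<exists>x. q = \<S> (x \<oplus> x)"
  then obtain x where "q = \<S> (x \<oplus> x)" by blast
  then have "(y \<oplus> y) \<oplus> q = \<S> ((y \<oplus> x) \<oplus> (y \<oplus> x))" by (simp add: ad_assoc ad_comm ad_left_comm)
  then show "\<exists>x. (y \<oplus> y) \<oplus> q = \<S> (x \<oplus> x)" by blast
next
  assume "\<exists>x. (y \<oplus> y) \<oplus> q = \<S> (x \<oplus> x)"
  then obtain x where x: "(y \<oplus> y) \<oplus> q = \<S> (x \<oplus> x)" by blast
  have "\<exists>z. q = z \<oplus> z \<or> q = \<S> (z \<oplus> z)"
  proof (rule induct[where P = "\<lambda>q. \<exists>z. q = z \<oplus> z \<or> q = \<S> (z \<oplus> z)"])
    fix q assume "\<exists>z. q = z \<oplus> z \<or> q = \<S> (z \<oplus> z)"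
    then obtain z where "q = z \<oplus> z \<or> q = \<S> (z \<oplus> z)" by blast
    then have "\<S> q = \<S> (z \<oplus> z) \<or> \<S> q = \<S> z \<oplus> \<S> z" by auto
    then show "\<exists>z. \<S> q = z \<oplus> z \<or> \<S> q = \<S> (z \<oplus> z)" by blast
  qed (intro dfn_rules, auto)
  then obtain z where "q = z \<oplus> z \<or> q = \<S> (z \<oplus> z)" by blast
  moreover have "q \<noteq> z \<oplus> z"
  proof
    assume "q = z \<oplus> z"
    then have "\<S> (x \<oplus> x) = (y \<oplus> z) \<oplus> (y \<oplus> z)" using x by (simp add: ad_assoc ad_left_comm)
    then show False using odd_ne_double by blast
  qed
  ultimately show "\<exists>x. q = \<S> (x \<oplus> x)" by blast
qed

lemma mem_lt: "mem M i c \<Longrightarrow> i \<prec> c"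
proof -
  assume "mem M i c"
  then obtain q r where c: "c = \<S> (q \<oplus> q) \<otimes> pow2 M i \<oplus> r" unfolding mem_def by blast
  then have "c = pow2 M i \<oplus> ((q \<oplus> q) \<otimes> pow2 M i \<oplus> r)" by (simp add: ad_assoc ad_comm ad_left_comm)
  then have "pow2 M i \<preceq> c" by simp
  then show ?thesis using lt_pow2[of i] by order
qed

lemma not_mem_zr [simp]: "\<not> mem M i \<zero>" using mem_lt by fastforce

lemma mem_lt_pow2: "mem M i c \<Longrightarrow> c \<prec> pow2 M k \<Longrightarrow> i \<prec> k"
proof (rule ccontr)
  assume m: "mem M i c" and "c \<prec> pow2 M k" "\<not> i \<prec> k"
  then have "c \<prec> pow2 M k" "pow2 M k \<preceq> pow2 M i" by (simp_all add: pow2_mono ar.not_less)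
  then have "c \<prec> pow2 M i" by order
  then have "mem M i c \<longleftrightarrow> (\<exists>x. \<zero> = \<S> (x \<oplus> x))" by (intro mem_iff) simp_all
  then show False using m by simp
qed

text \<open>As \<open>c\<close> has no digit at k or above, the addition produces no carry.\<close>

lemma mem_pow2_ad:
  assumes c: "c \<prec> pow2 M k"
  shows "mem M i (pow2 M k \<oplus> c) \<longleftrightarrow> mem M i c \<or> i = k"
proof -
  consider "i \<prec> k" | "i = k" | "k \<prec> i" using ar.linorder_cases by blast
  then show ?thesis
  proof cases
    case 1
    then obtain w where k: "k = \<S> w \<oplus> i" by (auto simp: lt_def ad_comm)
    obtain q r where qr: "c = q \<otimes> pow2 M i \<oplus> r" "r \<prec> pow2 M i" using div_ex pow2_pos by metis
    have "pow2 M k \<oplus> c = ((pow2 M w \<oplus> pow2 M w) \<oplus> q) \<otimes> pow2 M i \<oplus> r"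
      unfolding k pow2_ad qr(1) pow2_sc by (simp only: ml_distrib ad_assoc)
    then show ?thesis using mem_iff[OF _ qr(2)] qr(1) odd_add_double 1 by (metis ar.less_irrefl)
  next
    case 2
    then have "mem M i (pow2 M k \<oplus> c)" using c mem_iff[of "pow2 M k \<oplus> c" "\<one>" i c]
      by (auto intro: exI[of _ \<zero>])
    then show ?thesis using 2 by simp
  next
    case 3
    have "pow2 M k \<oplus> c \<prec> pow2 M (\<S> k)" using c by simp
    then have "\<not> mem M i (pow2 M k \<oplus> c)" "\<not> mem M i c"
      using 3 mem_lt_pow2 c by (metis lt_sc_iff ar.not_le, metis ar.order.asym)
    then show ?thesis using 3 by auto
  qed
qed

section \<open>Definable comprehension and extensionality for coded sets\<close>

lemma ex_set:
  assumes P: "dfn M (\<lambda>e. P (e 0))"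
  shows "\<exists>c. c \<prec> pow2 M k \<and> (\<forall>i. mem M i c \<longleftrightarrow> i \<prec> k \<and> P i)"
proof (rule induct[where P = "\<lambda>k. \<exists>c. c \<prec> pow2 M k \<and> (\<forall>i. mem M i c \<longleftrightarrow> i \<prec> k \<and> P i)"])
  show "dfn M (\<lambda>e. \<exists>c. c \<prec> pow2 M (e 0) \<and> (\<forall>i. mem M i c \<longleftrightarrow> i \<prec> e 0 \<and> P i))"
    by (intro dfn_rules dfn_app[OF P])
  show "\<exists>c. c \<prec> pow2 M \<zero> \<and> (\<forall>i. mem M i c \<longleftrightarrow> i \<prec> \<zero> \<and> P i)"
    by (rule exI[of _ \<zero>]) simp
  fix k assume "\<exists>c. c \<prec> pow2 M k \<and> (\<forall>i. mem M i c \<longleftrightarrow> i \<prec> k \<and> P i)"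
  then obtain c where c: "c \<prec> pow2 M k" "\<And>i. mem M i c \<longleftrightarrow> i \<prec> k \<and> P i" by blast
  have *: "i \<prec> \<S> k \<longleftrightarrow> i \<prec> k \<or> i = k" for i by (metis lt_sc_iff ar.le_less)
  show "\<exists>c. c \<prec> pow2 M (\<S> k) \<and> (\<forall>i. mem M i c \<longleftrightarrow> i \<prec> \<S> k \<and> P i)"
  proof (cases "P k")
    case True
    show ?thesis
      by (rule exI[of _ "pow2 M k \<oplus> c"]) (use c True in \<open>auto simp: mem_pow2_ad *\<close>)
  next
    case False
    have "c \<oplus> \<zero> \<prec> pow2 M k \<oplus> pow2 M k" by (intro ar.add_strict_mono c pow2_pos)
    then show ?thesis
      by (intro exI[of _ c]) (use c False in \<open>auto simp: *\<close>)
  qed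
qed

text \<open>Induction on the length of the binary expansion: the top digit is removed from both
  numbers and the remainders are compared.\<close>

lemma mem_ext_aux:
  "\<forall>c d. c \<prec> pow2 M k \<and> d \<prec> pow2 M k \<and> (\<forall>i. mem M i c \<longleftrightarrow> mem M i d) \<longrightarrow> c = d"
proof (rule induct[where P = "\<lambda>k. \<forall>c d. c \<prec> pow2 M k \<and> d \<prec> pow2 M k \<and> (\<forall>i. mem M i c \<longleftrightarrow> mem M i d) \<longrightarrow> c = d"])
  fix k
  assume IH: "\<forall>c d. c \<prec> pow2 M k \<and> d \<prec> pow2 M k \<and> (\<forall>i. mem M i c \<longleftrightarrow> mem M i d) \<longrightarrow> c = d"
  have split: "\<exists>c'. c' \<prec> pow2 M k \<and> (c = c' \<and> \<not> mem M k c \<or> c = pow2 M k \<oplus> c' \<and> mem M k c)"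
    if "c \<prec> pow2 M (\<S> k)" for c
  proof (cases "c \<prec> pow2 M k")
    case True then show ?thesis using mem_lt_pow2 by blast
  next
    case False
    then obtain c' where c': "c = pow2 M k \<oplus> c'" by (auto simp: ar.not_less le_def)
    then have "c' \<prec> pow2 M k" using that by simp
    then show ?thesis using c' mem_pow2_ad by auto
  qed
  show "\<forall>c d. c \<prec> pow2 M (\<S> k) \<and> d \<prec> pow2 M (\<S> k) \<and> (\<forall>i. mem M i c \<longleftrightarrow> mem M i d) \<longrightarrow> c = d"
  proof (intro allI impI)
    fix c d assume a: "c \<prec> pow2 M (\<S> k) \<and> d \<prec> pow2 M (\<S> k) \<and> (\<forall>i. mem M i c \<longleftrightarrow> mem M i d)"
    obtain c' where c': "c' \<prec> pow2 M k" "c = c' \<and> \<not> mem M k c \<or> c = pow2 M k \<oplus> c' \<and> mem M k c"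
      using split a by blast
    obtain d' where d': "d' \<prec> pow2 M k" "d = d' \<and> \<not> mem M k d \<or> d = pow2 M k \<oplus> d' \<and> mem M k d"
      using split a by blast
    have 1: "mem M i c' \<longleftrightarrow> mem M i c \<and> i \<noteq> k" for i
      using c' mem_pow2_ad[OF c'(1)] mem_lt_pow2[OF _ c'(1)] by (metis ar.less_irrefl)
    have 2: "mem M i d' \<longleftrightarrow> mem M i d \<and> i \<noteq> k" for i
      using d' mem_pow2_ad[OF d'(1)] mem_lt_pow2[OF _ d'(1)] by (metis ar.less_irrefl)
    have "c' = d'" using IH c'(1) d'(1) 1 2 a by blast
    then show "c = d" using c'(2) d'(2) a by auto
  qed
qed (intro dfn_rules, simp add: lt_sc_iff, metis zr_le ar.order.antisym)

lemma mem_ext: "(\<And>i. mem M i c \<longleftrightarrow> mem M i d) \<Longrightarrow> c = d"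
proof -
  assume a: "\<And>i. mem M i c \<longleftrightarrow> mem M i d"
  have "c \<preceq> c \<oplus> d" "d \<preceq> c \<oplus> d" by simp_all
  then have "c \<prec> pow2 M (c \<oplus> d)" "d \<prec> pow2 M (c \<oplus> d)" using lt_pow2[of "c \<oplus> d"] by order+
  then show "c = d" using mem_ext_aux a by blast
qed

lemma ex_insert: "\<exists>d. \<forall>i. mem M i d \<longleftrightarrow> mem M i c \<or> i = x"
proof -
  have "dfn M (\<lambda>e. mem M (e 0) c \<or> e 0 = x)" by (intro dfn_rules)
  from ex_set[OF this, of "\<S> (c \<oplus> x)"] obtain d
    where d: "\<And>i. mem M i d \<longleftrightarrow> i \<prec> \<S> (c \<oplus> x) \<and> (mem M i c \<or> i = x)" by blast
  have "i \<prec> \<S> (c \<oplus> x)" if "mem M i c \<or> i = x" for i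
    using that mem_lt[of i c] le_ad(1)[of c x] le_ad(2)[of x c]
    by (metis lt_sc_iff ar.less_imp_le ar.order.trans)
  then show ?thesis using d by blast
qed

lemma ex_union: "\<exists>d. \<forall>i. mem M i d \<longleftrightarrow> mem M i c \<or> mem M i c'"
proof -
  have "dfn M (\<lambda>e. mem M (e 0) c \<or> mem M (e 0) c')" by (intro dfn_rules)
  from ex_set[OF this, of "\<S> (c \<oplus> c')"] obtain d
    where d: "\<And>i. mem M i d \<longleftrightarrow> i \<prec> \<S> (c \<oplus> c') \<and> (mem M i c \<or> mem M i c')" by blast
  have "i \<prec> \<S> (c \<oplus> c')" if "mem M i c \<or> mem M i c'" for i
    using that mem_lt[of i c] mem_lt[of i c'] le_ad(1)[of c c'] le_ad(2)[of c' c]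
    by (metis lt_sc_iff ar.less_imp_le ar.order.trans)
  then show ?thesis using d by blast
qed

lemma ex_subset:
  assumes P: "dfn M (\<lambda>e. P (e 0))"
  shows "\<exists>d. \<forall>i. mem M i d \<longleftrightarrow> mem M i c \<and> P i"
proof -
  have "dfn M (\<lambda>e. mem M (e 0) c \<and> P (e 0))" by (intro dfn_rules P)
  from ex_set[OF this, of c] show ?thesis using mem_lt by blast
qed

end

context pa
begin

subsection \<open>Syntax\<close>

lemma num_0 [simp]: "num M 0 = \<zero>" and num_Suc [simp]: "num M (Suc n) = \<S> (num M n)"
  by (simp_all add: num_def)

lemma num_inject [simp]: "num M m = num M n \<longleftrightarrow> m = n"
proof (induction m arbitrary: n)
  case 0 show ?case by (cases n) auto
next
  case (Suc m) then show ?case by (cases n) auto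
qed

lemma num_eq_zr [simp]: "num M n = \<zero> \<longleftrightarrow> n = 0"
  using num_inject[of n 0] by (simp del: num_inject)

text \<open>The standard numbers form an initial segment. Therefore a rule of the game that speaks
  of all indices below a standard clock value concerns standard indices only.\<close>

lemma lt_num_iff: "x \<prec> num M n \<longleftrightarrow> (\<exists>m<n. x = num M m)"
proof (induction n)
  case (Suc n)
  have "x \<prec> num M (Suc n) \<longleftrightarrow> x \<prec> num M n \<or> x = num M n"
    by (metis num_Suc lt_sc_iff ar.le_less)
  then show ?case using Suc less_Suc_eq by auto
qed simp

lemmas code_defs = c_var_def c_zero_def c_succ_def c_plus_def c_times_def c_eq_def c_neg_def
  c_or_def c_ex_def

lemma code_inject [simp]:
  "c_var M v = c_var M v' \<longleftrightarrow> v = v'"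
  "c_succ M s = c_succ M s' \<longleftrightarrow> s = s'"
  "c_plus M s t = c_plus M s' t' \<longleftrightarrow> s = s' \<and> t = t'"
  "c_times M s t = c_times M s' t' \<longleftrightarrow> s = s' \<and> t = t'"
  "c_eq M s t = c_eq M s' t' \<longleftrightarrow> s = s' \<and> t = t'"
  "c_neg M f = c_neg M f' \<longleftrightarrow> f = f'"
  "c_or M f g = c_or M f' g' \<longleftrightarrow> f = f' \<and> g = g'"
  "c_ex M v f = c_ex M v' f' \<longleftrightarrow> v = v' \<and> f = f'"
  by (simp_all add: code_defs)

lemma code_distinct1:
  "c_var M v \<noteq> c_zero M" "c_var M v \<noteq> c_succ M t" "c_var M v \<noteq> c_plus M t u"
  "c_var M v \<noteq> c_times M t u" "c_var M v \<noteq> c_eq M t u" "c_var M v \<noteq> c_neg M t"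
  "c_var M v \<noteq> c_or M t u" "c_var M v \<noteq> c_ex M t u"
  "c_zero M \<noteq> c_succ M t" "c_zero M \<noteq> c_plus M t u"
  "c_zero M \<noteq> c_times M t u" "c_zero M \<noteq> c_eq M t u" "c_zero M \<noteq> c_neg M t"
  "c_zero M \<noteq> c_or M t u" "c_zero M \<noteq> c_ex M t u"
  "c_succ M v \<noteq> c_plus M t u"
  "c_succ M v \<noteq> c_times M t u" "c_succ M v \<noteq> c_eq M t u" "c_succ M v \<noteq> c_neg M t"
  "c_succ M v \<noteq> c_or M t u" "c_succ M v \<noteq> c_ex M t u"
  "c_plus M v w \<noteq> c_times M t u" "c_plus M v w \<noteq> c_eq M t u" "c_plus M v w \<noteq> c_neg M t"
  "c_plus M v w \<noteq> c_or M t u" "c_plus M v w \<noteq> c_ex M t u"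
  "c_times M v w \<noteq> c_eq M t u" "c_times M v w \<noteq> c_neg M t"
  "c_times M v w \<noteq> c_or M t u" "c_times M v w \<noteq> c_ex M t u"
  "c_eq M v w \<noteq> c_neg M t" "c_eq M v w \<noteq> c_or M t u" "c_eq M v w \<noteq> c_ex M t u"
  "c_neg M v \<noteq> c_or M t u" "c_neg M v \<noteq> c_ex M t u"
  "c_or M v w \<noteq> c_ex M t u"
  by (simp_all add: code_defs del: num_Suc)

lemmas code_distinct [simp] = code_distinct1 code_distinct1[symmetric]

lemma code_gt:
  "f \<prec> c_neg M f" "f \<prec> c_or M f g" "g \<prec> c_or M f g" "f \<prec> c_ex M v f"
  unfolding code_defs
  by (rule pr_gt(2) ar.le_less_trans[OF pr_ge_fst pr_gt(2)] ar.le_less_trans[OF pr_ge_snd pr_gt(2)],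
      simp del: num_Suc)+

lemma dft_code:
  "dft M s \<Longrightarrow> dft M (\<lambda>e. c_var M (s e))"
  "dft M s \<Longrightarrow> dft M (\<lambda>e. c_succ M (s e))"
  "dft M s \<Longrightarrow> dft M t \<Longrightarrow> dft M (\<lambda>e. c_plus M (s e) (t e))"
  "dft M s \<Longrightarrow> dft M t \<Longrightarrow> dft M (\<lambda>e. c_times M (s e) (t e))"
  "dft M s \<Longrightarrow> dft M t \<Longrightarrow> dft M (\<lambda>e. c_eq M (s e) (t e))"
  "dft M s \<Longrightarrow> dft M (\<lambda>e. c_neg M (s e))"
  "dft M s \<Longrightarrow> dft M t \<Longrightarrow> dft M (\<lambda>e. c_or M (s e) (t e))"
  "dft M s \<Longrightarrow> dft M t \<Longrightarrow> dft M (\<lambda>e. c_ex M (s e) (t e))"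
  unfolding code_defs by (intro dfn_rules; assumption)+

lemmas [dfn_rules] = dft_code

lemma dfn_is_tm: "dft M s \<Longrightarrow> dfn M (\<lambda>e. is_tm M (s e))"
  by (rule dfn_subst1[where P = "is_tm M"]) (unfold is_tm_def derivable_def, intro dfn_rules)

lemmas [dfn_rules] = dfn_is_tm

lemma dfn_is_fm: "dft M s \<Longrightarrow> dfn M (\<lambda>e. is_fm M (s e))"
  by (rule dfn_subst1[where P = "is_fm M"]) (unfold is_fm_def derivable_def, intro dfn_rules)

lemma dfn_is_free: "dft M s \<Longrightarrow> dft M t \<Longrightarrow> dfn M (\<lambda>e. is_free M (s e) (t e))"
  by (rule dfn_subst2[where P = "is_free M"]) (unfold is_free_def derivable_def, intro dfn_rules)

lemma dfn_is_asg: "dft M s \<Longrightarrow> dfn M (\<lambda>e. is_asg M (s e))"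
  by (rule dfn_subst1[where P = "is_asg M"]) (unfold is_asg_def, intro dfn_rules)

lemmas [dfn_rules] = dfn_is_fm dfn_is_free dfn_is_asg

lemma dfn_asg_for: "dft M s \<Longrightarrow> dft M t \<Longrightarrow> dfn M (\<lambda>e. asg_for M (s e) (t e))"
  by (rule dfn_subst2[where P = "asg_for M"]) (unfold asg_for_def, intro dfn_rules)

lemma dfn_is_val: "dft M s \<Longrightarrow> dft M t \<Longrightarrow> dft M u \<Longrightarrow> dfn M (\<lambda>e. is_val M (s e) (t e) (u e))"
  by (rule dfn_subst3[where P = "is_val M"]) (unfold is_val_def derivable_def, intro dfn_rules)

lemmas [dfn_rules] = dfn_asg_for dfn_is_val

text \<open>Comprehension provides the restricted set and extensionality its uniqueness, so the
  description in \<open>restr\<close> denotes it.\<close>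

lemma mem_restr:
  "mem M p (restr M a f) \<longleftrightarrow> mem M p a \<and> (\<exists>v x. p = pr M v x \<and> is_free M v f)"
proof -
  have "dfn M (\<lambda>e. \<exists>v x. e 0 = pr M v x \<and> is_free M v f)" by (intro dfn_rules)
  from ex_subset[OF this, of a] obtain b
    where b: "\<forall>p. mem M p b \<longleftrightarrow> mem M p a \<and> (\<exists>v x. p = pr M v x \<and> is_free M v f)" by blast
  then have "restr M a f = b" unfolding restr_def by (rule the_equality) (use b in \<open>auto intro: mem_ext\<close>)
  then show ?thesis using b by blast
qed

lemma restr_eq_iff: "b = restr M a f \<longleftrightarrow>
    (\<forall>p. mem M p b \<longleftrightarrow> mem M p a \<and> (\<exists>v x. p = pr M v x \<and> is_free M v f))"
  by (metis mem_restr mem_ext)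

lemma dft_restr: "dft M s \<Longrightarrow> dft M t \<Longrightarrow> dft M (\<lambda>e. restr M (s e) (t e))"
  by (rule dft_subst2[where g = "restr M"]) (unfold restr_eq_iff, intro dfn_rules)

lemmas [dfn_rules] = dft_restr

section \<open>Rule inversion and introduction for coded inductive definitions\<close>

lemma derivable_unfold:
  assumes "derivable M R x" "\<And>C C' y. (\<And>z. C z \<Longrightarrow> C' z) \<Longrightarrow> R C y \<Longrightarrow> R C' y"
  shows "R (derivable M R) x"
proof -
  obtain c where c: "mem M x c" "\<forall>y. mem M y c \<longrightarrow> R (\<lambda>z. mem M z c) y"
    using assms(1) unfolding derivable_def by blast
  have "derivable M R z" if "mem M z c" for z
    unfolding derivable_def by (rule exI[of _ c], rule conjI) (rule that, rule c(2))
  moreover have "R (\<lambda>z. mem M z c) x" using c by simp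
  ultimately show ?thesis by (rule assms(2))
qed

text \<open>The coded derivations of the premises are united and \<open>x\<close> is inserted;
  monotonicity keeps the old members derivable. No clause has more than two premises, and for one
  premise \<open>a\<close> and \<open>b\<close> coincide.\<close>

lemma derivable_intro:
  assumes "R (\<lambda>z. z = a \<or> z = b) x" "derivable M R a" "derivable M R b"
    and mono: "\<And>C C' y. (\<And>z. C z \<Longrightarrow> C' z) \<Longrightarrow> R C y \<Longrightarrow> R C' y"
  shows "derivable M R x"
proof -
  obtain c where c: "mem M a c" "\<And>y. mem M y c \<Longrightarrow> R (\<lambda>z. mem M z c) y"
    using assms(2) unfolding derivable_def by blast
  obtain d where d: "mem M b d" "\<And>y. mem M y d \<Longrightarrow> R (\<lambda>z. mem M z d) y"
    using assms(3) unfolding derivable_def by blast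
  obtain u where u: "\<And>i. mem M i u \<longleftrightarrow> mem M i c \<or> mem M i d" using ex_union by blast
  obtain w where w: "\<And>i. mem M i w \<longleftrightarrow> mem M i u \<or> i = x" using ex_insert by blast
  have "R (\<lambda>z. mem M z w) y" if yw: "mem M y w" for y
  proof -
    consider "mem M y c" | "mem M y d" | "y = x" using yw u w by blast
    then show ?thesis
    proof cases
      case 1 show ?thesis by (rule mono[OF _ c(2)[OF 1]]) (simp add: u w)
    next
      case 2 show ?thesis by (rule mono[OF _ d(2)[OF 2]]) (simp add: u w)
    next
      case 3 show ?thesis unfolding 3 by (rule mono[OF _ assms(1)]) (use c(1) d(1) u w in auto)
    qed
  qed
  then show ?thesis using w unfolding derivable_def by blast
qed

lemma derivable_intro0:
  assumes "R (\<lambda>z. False) x" and mono: "\<And>C C' y. (\<And>z. C z \<Longrightarrow> C' z) \<Longrightarrow> R C y \<Longrightarrow> R C' y"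
  shows "derivable M R x"
proof -
  obtain w where w: "\<And>i. mem M i w \<longleftrightarrow> i = x" using ex_insert[of \<zero> x] by auto
  have "R (\<lambda>z. mem M z w) x" by (rule mono[OF _ assms(1)]) simp
  then show ?thesis unfolding derivable_def by (intro exI[of _ w]) (auto simp: w)
qed

section \<open>Terms, formulas, free variables and term values inside \<open>M\<close>\<close>

lemma is_tm_var [simp]: "is_tm M (c_var M v)"
  unfolding is_tm_def by (rule derivable_intro0) auto

lemma is_tm_zero [simp]: "is_tm M (c_zero M)"
  unfolding is_tm_def by (rule derivable_intro0) auto

lemma is_tm_intros:
  "is_tm M s \<Longrightarrow> is_tm M (c_succ M s)"
  "is_tm M s \<Longrightarrow> is_tm M t \<Longrightarrow> is_tm M (c_plus M s t)"
  "is_tm M s \<Longrightarrow> is_tm M t \<Longrightarrow> is_tm M (c_times M s t)"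
  unfolding is_tm_def
  subgoal by (rule derivable_intro[where a = s and b = s]) (simp, assumption+, (elim disj_forward ex_forward conj_forward; simp))
  subgoal by (rule derivable_intro[where a = s and b = t]) (simp, assumption+, (elim disj_forward ex_forward conj_forward; simp))
  subgoal by (rule derivable_intro[where a = s and b = t]) (simp, assumption+, (elim disj_forward ex_forward conj_forward; simp))
  done

lemma is_tm_code: "is_tm M (tm_code M t)"
  by (induction t) (auto intro: is_tm_intros)

lemma is_fm_unfold:
  assumes "is_fm M y"
  shows "(\<exists>s t. is_tm M s \<and> is_tm M t \<and> y = c_eq M s t) \<or>
     (\<exists>f. is_fm M f \<and> y = c_neg M f) \<or>
     (\<exists>f g. is_fm M f \<and> is_fm M g \<and> y = c_or M f g) \<or>
     (\<exists>v f. is_fm M f \<and> y = c_ex M v f)"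
  unfolding is_fm_def
  by (rule derivable_unfold[OF assms[unfolded is_fm_def]]) (elim disj_forward ex_forward conj_forward; simp)

lemma is_fm_eq [simp]: "is_fm M (c_eq M s t) \<longleftrightarrow> is_tm M s \<and> is_tm M t"
proof
  show "is_fm M (c_eq M s t) \<Longrightarrow> is_tm M s \<and> is_tm M t" by (drule is_fm_unfold) auto
  show "is_tm M s \<and> is_tm M t \<Longrightarrow> is_fm M (c_eq M s t)"
    unfolding is_fm_def by (rule derivable_intro0) auto
qed

lemma is_fm_neg [simp]: "is_fm M (c_neg M f) \<longleftrightarrow> is_fm M f"
proof
  show "is_fm M (c_neg M f) \<Longrightarrow> is_fm M f" by (drule is_fm_unfold) auto
  show "is_fm M f \<Longrightarrow> is_fm M (c_neg M f)"
    unfolding is_fm_def by (rule derivable_intro[where a = f and b = f]) (simp, assumption+, (elim disj_forward ex_forward conj_forward; simp))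
qed

lemma is_fm_or [simp]: "is_fm M (c_or M f g) \<longleftrightarrow> is_fm M f \<and> is_fm M g"
proof
  show "is_fm M (c_or M f g) \<Longrightarrow> is_fm M f \<and> is_fm M g" by (drule is_fm_unfold) auto
  show "is_fm M f \<and> is_fm M g \<Longrightarrow> is_fm M (c_or M f g)"
    unfolding is_fm_def
    by (erule conjE, rule derivable_intro[where a = f and b = g]) (simp, assumption+, (elim disj_forward ex_forward conj_forward; simp))
qed

lemma is_fm_ex [simp]: "is_fm M (c_ex M v f) \<longleftrightarrow> is_fm M f"
proof
  show "is_fm M (c_ex M v f) \<Longrightarrow> is_fm M f" by (drule is_fm_unfold) auto
  show "is_fm M f \<Longrightarrow> is_fm M (c_ex M v f)"
    unfolding is_fm_def by (rule derivable_intro[where a = f and b = f]) (simp, assumption+, (elim disj_forward ex_forward conj_forward; simp))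
qed

lemma is_free_unfold:
  assumes "is_free M v y"
  shows "y = c_var M v \<or>
     (\<exists>t. is_free M v t \<and> y = c_succ M t) \<or>
     (\<exists>s t. (is_free M v s \<or> is_free M v t) \<and> (y = c_plus M s t \<or> y = c_times M s t \<or> y = c_eq M s t)) \<or>
     (\<exists>f. is_free M v f \<and> y = c_neg M f) \<or>
     (\<exists>f g. (is_free M v f \<or> is_free M v g) \<and> y = c_or M f g) \<or>
     (\<exists>w f. w \<noteq> v \<and> is_free M v f \<and> y = c_ex M w f)"
  unfolding is_free_def
  by (rule derivable_unfold[OF assms[unfolded is_free_def]]) (elim disj_forward ex_forward conj_forward; simp)

lemma is_free_intro:
  assumes "is_free M v f" "y = c_neg M f \<or> (\<exists>g. y = c_or M f g) \<or> (\<exists>g. y = c_or M g f) \<or>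
    (\<exists>w. w \<noteq> v \<and> y = c_ex M w f)"
  shows "is_free M v y"
proof -
  let ?C = "\<lambda>z. z = f \<or> z = f"
  have "y = c_var M v \<or>
     (\<exists>t. ?C t \<and> y = c_succ M t) \<or>
     (\<exists>s t. (?C s \<or> ?C t) \<and> (y = c_plus M s t \<or> y = c_times M s t \<or> y = c_eq M s t)) \<or>
     (\<exists>f. ?C f \<and> y = c_neg M f) \<or>
     (\<exists>f g. (?C f \<or> ?C g) \<and> y = c_or M f g) \<or>
     (\<exists>w f. w \<noteq> v \<and> ?C f \<and> y = c_ex M w f)"
    using assms(2) by (elim disjE exE conjE) simp_all
  then show ?thesis
    unfolding is_free_def
    by (rule derivable_intro[OF _ assms(1)[unfolded is_free_def] assms(1)[unfolded is_free_def]])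
      (elim disj_forward ex_forward conj_forward; simp)
qed

lemma is_free_neg [simp]: "is_free M v (c_neg M f) \<longleftrightarrow> is_free M v f"
  using is_free_unfold[of v "c_neg M f"] is_free_intro[of v f "c_neg M f"] by auto

lemma is_free_or [simp]: "is_free M v (c_or M f g) \<longleftrightarrow> is_free M v f \<or> is_free M v g"
  using is_free_unfold[of v "c_or M f g"] is_free_intro[of v f "c_or M f g"]
    is_free_intro[of v g "c_or M f g"] by auto

lemma is_free_ex [simp]: "is_free M v (c_ex M w f) \<longleftrightarrow> is_free M v f \<and> v \<noteq> w"
  using is_free_unfold[of v "c_ex M w f"] is_free_intro[of v f "c_ex M w f"] by auto

lemma not_is_free_tm_code: "tm_vars t = {} \<Longrightarrow> \<not> is_free M v (tm_code M t)"
  by (induction t) (auto dest: is_free_unfold)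

lemma is_val_unfold:
  assumes "is_val M a t y"
  shows "(\<exists>v. mem M (pr M v y) a \<and> t = c_var M v) \<or>
     (t = c_zero M \<and> y = \<zero>) \<or>
     (\<exists>t' x. is_val M a t' x \<and> t = c_succ M t' \<and> y = \<S> x) \<or>
     (\<exists>s t' x x'. is_val M a s x \<and> is_val M a t' x' \<and> t = c_plus M s t' \<and> y = x \<oplus> x') \<or>
     (\<exists>s t' x x'. is_val M a s x \<and> is_val M a t' x' \<and> t = c_times M s t' \<and> y = x \<otimes> x')"
proof -
  have "(\<exists>v x. mem M (pr M v x) a \<and> pr M t y = pr M (c_var M v) x) \<or>
     pr M t y = pr M (c_zero M) (zr M) \<or>
     (\<exists>t' x. is_val M a t' x \<and> pr M t y = pr M (c_succ M t') (sc M x)) \<or>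
     (\<exists>s t' x x'. is_val M a s x \<and> is_val M a t' x' \<and> pr M t y = pr M (c_plus M s t') (ad M x x')) \<or>
     (\<exists>s t' x x'. is_val M a s x \<and> is_val M a t' x' \<and> pr M t y = pr M (c_times M s t') (ml M x x'))"
    unfolding is_val_def
    by (rule derivable_unfold[OF assms[unfolded is_val_def]])
      (elim disj_forward ex_forward conj_forward; simp)
  then show ?thesis unfolding pr_inject by blast
qed

lemma is_val_zero: "is_val M a (c_zero M) \<zero>"
  unfolding is_val_def
  by (rule derivable_intro0) (simp, (elim disj_forward ex_forward conj_forward; simp))

lemma is_val_succ: "is_val M a t x \<Longrightarrow> is_val M a (c_succ M t) (\<S> x)"
  unfolding is_val_def
  by (rule derivable_intro[where a = "pr M t x" and b = "pr M t x"]) (simp, assumption+, (elim disj_forward ex_forward conj_forward; simp))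

lemma is_val_plus:
  "is_val M a s x \<Longrightarrow> is_val M a t y \<Longrightarrow> is_val M a (c_plus M s t) (x \<oplus> y)"
  unfolding is_val_def
  by (rule derivable_intro[where a = "pr M s x" and b = "pr M t y"]) (simp, blast, assumption+, (elim disj_forward ex_forward conj_forward; simp))

lemma is_val_times:
  "is_val M a s x \<Longrightarrow> is_val M a t y \<Longrightarrow> is_val M a (c_times M s t) (x \<otimes> y)"
  unfolding is_val_def
  by (rule derivable_intro[where a = "pr M s x" and b = "pr M t y"]) (simp, blast, assumption+, (elim disj_forward ex_forward conj_forward; simp))

text \<open>Links the evaluation coded in \<open>M\<close> with the actual one, by induction on the
  standard term; as it is closed, both the assignment and the environment are arbitrary. This yields
  the truth value of \<theta> in \<open>th_true\<close>.\<close>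

lemma is_val_tm_code: "tm_vars t = {} \<Longrightarrow> is_val M a (tm_code M t) y \<longleftrightarrow> y = tm_val M e t"
proof (induction t arbitrary: y)
  case Zero
  then show ?case using is_val_unfold[of a "c_zero M" y] is_val_zero by auto
next
  case (Succ t)
  then show ?case
    using is_val_unfold[of a "c_succ M (tm_code M t)" y] is_val_succ[of a "tm_code M t"] by auto
next
  case (Plus s t)
  then show ?case
    using is_val_unfold[of a "c_plus M (tm_code M s) (tm_code M t)" y]
      is_val_plus[of a "tm_code M s" _ "tm_code M t"] by auto
next
  case (Times s t)
  then show ?case
    using is_val_unfold[of a "c_times M (tm_code M s) (tm_code M t)" y]
      is_val_times[of a "tm_code M s" _ "tm_code M t"] by auto
qed simp

lemma asg_for_restr:
  assumes "is_asg M a" "\<And>v. is_free M v f \<Longrightarrow> \<exists>x. mem M (pr M v x) a"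
  shows "asg_for M f (restr M a f)"
  unfolding asg_for_def
proof (intro conjI allI)
  show "is_asg M (restr M a f)" using assms(1) unfolding is_asg_def mem_restr by blast
  show "(\<exists>x. mem M (pr M v x) (restr M a f)) \<longleftrightarrow> is_free M v f" for v
    using assms(2)[of v] by (auto simp: mem_restr)
qed

lemma asg_for_closed: "(\<And>v. \<not> is_free M v f) \<Longrightarrow> asg_for M f a \<longleftrightarrow> a = \<zero>"
proof
  assume f: "\<And>v. \<not> is_free M v f"
  show "asg_for M f a \<Longrightarrow> a = \<zero>"
    by (rule mem_ext) (use f in \<open>auto simp: asg_for_def is_asg_def\<close>)
  show "a = \<zero> \<Longrightarrow> asg_for M f a" using f by (auto simp: asg_for_def is_asg_def)
qed

lemma restr_closed: "(\<And>v. \<not> is_free M v f) \<Longrightarrow> restr M a f = \<zero>"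
  by (rule mem_ext) (auto simp: mem_restr)

end

subsection \<open>Iterated templates\<close>

primrec subtemplates :: "template \<Rightarrow> template set" where
  "subtemplates LetP = {LetP}"
| "subtemplates LetQ = {LetQ}"
| "subtemplates (TNeg A) = insert (TNeg A) (subtemplates A)"
| "subtemplates (TOr A B) = insert (TOr A B) (subtemplates A \<union> subtemplates B)"
| "subtemplates (TEx v A) = insert (TEx v A) (subtemplates A)"

lemma subtemplates_self [simp]: "A \<in> subtemplates A" by (cases A) auto

lemma subtemplates_trans: "B \<in> subtemplates A \<Longrightarrow> C \<in> subtemplates B \<Longrightarrow> C \<in> subtemplates A"
  by (induction A) auto

lemma subtemplates_children:
  "TNeg B \<in> subtemplates A \<Longrightarrow> B \<in> subtemplates A"
  "TOr B C \<in> subtemplates A \<Longrightarrow> B \<in> subtemplates A"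
  "TOr B C \<in> subtemplates A \<Longrightarrow> C \<in> subtemplates A"
  "TEx v B \<in> subtemplates A \<Longrightarrow> B \<in> subtemplates A"
  using subtemplates_trans by fastforce+

lemma LetQ_subtemplates: "q_occurs A \<Longrightarrow> LetQ \<in> subtemplates A"
  by (induction A) auto

text \<open>The template is an actual finite object, so an induction outside \<open>M\<close>
  suffices.\<close>

lemma dft_t_inst:
  assumes M: "pa M" and "dft M s" "dft M t"
  shows "dft M (\<lambda>e. t_inst M B (s e) (t e))"
proof -
  interpret pa M by fact
  show ?thesis by (induction B) (simp_all add: assms dft_code dft_const)
qed

locale idempotent_op = pa M for M :: "'m arith" +
  fixes \<theta> :: fm and A :: template and X :: "'m set"
  assumes sentence_\<theta>: "sentence \<theta>" and atomic_\<theta>: "atomic \<theta>"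
    and idempotent: "idempotent_template M \<theta> A"
    and X_sc: "sc M x \<in> X \<longleftrightarrow> x \<in> X"
    and X_zr: "zr M \<in> X \<longleftrightarrow> models M \<theta>"
begin

abbreviation th where "th \<equiv> fm_code M \<theta>"
abbreviation F where "F \<equiv> iterate M \<theta> A"
abbreviation p where "p \<equiv> models M \<theta>"

lemma \<theta>_eq: "\<exists>s t. \<theta> = Eq s t \<and> tm_vars s = {} \<and> tm_vars t = {}"
  using sentence_\<theta> atomic_\<theta> by (auto simp: sentence_def atomic_def)

text \<open>Atomicity of \<theta> enters here: no template instance with an outer connective or
  quantifier can coincide with \<theta>.\<close>

lemma th_ne [simp]:
  "th \<noteq> c_neg M f" "c_neg M f \<noteq> th" "th \<noteq> c_or M f g" "c_or M f g \<noteq> th"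
  "th \<noteq> c_ex M v f" "c_ex M v f \<noteq> th"
  using \<theta>_eq by auto

lemma is_fm_th [simp]: "is_fm M th" using \<theta>_eq is_tm_code by auto

lemma is_free_th [simp]: "\<not> is_free M v th"
proof -
  obtain s t where st: "\<theta> = Eq s t" "tm_vars s = {}" "tm_vars t = {}" using \<theta>_eq by blast
  then show ?thesis
    using is_free_unfold[of v "c_eq M (tm_code M s) (tm_code M t)"] not_is_free_tm_code by auto
qed

lemma th_true: "(\<exists>s t y. th = c_eq M s t \<and> is_val M a s y \<and> is_val M a t y) \<longleftrightarrow> p"
proof -
  obtain s t where st: "\<theta> = Eq s t" "tm_vars s = {}" "tm_vars t = {}" using \<theta>_eq by blast
  have "tm_val M e s = tm_val M e' s" "tm_val M e t = tm_val M e' t" for e e'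
    by (rule tm_val_cong, use st in simp)+
  then have "p \<longleftrightarrow> tm_val M undefined s = tm_val M undefined t"
    unfolding models_def st(1) by (metis sat.simps(1))
  then show ?thesis using is_val_tm_code[OF st(2), of a _ undefined] is_val_tm_code[OF st(3), of a _ undefined]
    by (auto simp: st(1))
qed

lemma models_Neg: "models M (Neg \<theta>) \<longleftrightarrow> \<not> p"
proof -
  have "sat M e \<theta> = sat M e' \<theta>" for e e'
    by (rule sat_cong) (use sentence_\<theta> in \<open>simp add: sentence_def\<close>)
  then show ?thesis unfolding models_def by (metis sat.simps(2))
qed

text \<open>With \<open>p\<close> fixed as the actual truth value of \<theta>, the two conditional
  clauses of idempotence merge into one equation.\<close>

lemma A_facts: "complexity A \<noteq> 0" "q_occurs A" "t_val A p q \<longleftrightarrow> q"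
proof -
  show "complexity A \<noteq> 0" "q_occurs A" using idempotent unfolding idempotent_template_def by blast+
  show "t_val A p q \<longleftrightarrow> q"
    using idempotent models_Neg unfolding idempotent_template_def by (cases p) simp_all
qed

lemma dft_inst: "dft M (\<lambda>e. t_inst M B th (e (k :: nat)))"
  by (intro dft_t_inst dft_const dft_var) unfold_locales

lemma F_ex: "\<exists>s. elt M s \<zero> = th \<and> (\<forall>i. i \<prec> x \<longrightarrow> elt M s (\<S> i) = t_inst M A th (elt M s i))"
  by (rule ex_recursion[where h = "\<lambda>i y. t_inst M A th y"]) (rule dft_inst)

lemma F_eq_iff: "y = F x \<longleftrightarrow>
  (\<exists>s. elt M s \<zero> = th \<and> (\<forall>i. i \<prec> x \<longrightarrow> elt M s (\<S> i) = t_inst M A th (elt M s i)) \<and> elt M s x = y)"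
  (is "_ \<longleftrightarrow> ?P y")
proof -
  have un: "y = y'" if "?P y" "?P y'" for y y'
    using that recursion_unique[of _ _ x "\<lambda>i y. t_inst M A th y" x] by (metis ar.order_refl)
  obtain z where z: "?P z" using F_ex by blast
  then have "F x = z" unfolding iterate_def by (rule the_equality) (use un z in blast)
  then show ?thesis using un z by blast
qed

lemma dft_F [dfn_rules]: "dft M s \<Longrightarrow> dft M (\<lambda>e. F (s e))"
proof (rule dft_subst1[where g = F])
  show "dfn M (\<lambda>e. e 0 = F (e 1))"
    unfolding F_eq_iff by (intro dfn_rules dft_t_inst) unfold_locales
qed

lemma F_zr [simp]: "F \<zero> = th"
proof -
  have "th = F \<zero>" unfolding F_eq_iff using F_ex[of \<zero>] by auto
  then show ?thesis by simp
qed

lemma F_sc [simp]: "F (\<S> x) = t_inst M A th (F x)"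
proof -
  obtain s where s: "elt M s \<zero> = th" "\<And>i. i \<prec> \<S> x \<Longrightarrow> elt M s (\<S> i) = t_inst M A th (elt M s i)"
    using F_ex[of "\<S> x"] by blast
  then have "elt M s (\<S> x) = F (\<S> x)" unfolding F_eq_iff by blast
  moreover have "elt M s x = F x" unfolding F_eq_iff
    using s ar.order.strict_trans[OF _ lt_sc] by blast
  ultimately show ?thesis using s(2)[of x] by simp
qed

lemma is_fm_inst: "is_fm M f \<Longrightarrow> is_fm M (t_inst M B th f)"
  by (induction B) auto

lemma is_free_inst: "\<forall>v. \<not> is_free M v f \<Longrightarrow> \<not> is_free M v (t_inst M B th f)"
  by (induction B) auto

text \<open>The index may be nonstandard, so the induction takes place in \<open>M\<close> and
  relies on the definability of \<open>F\<close>.\<close>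

lemma F_sentence: "is_fm M (F x) \<and> (\<forall>v. \<not> is_free M v (F x))"
proof (rule induct[where P = "\<lambda>x. is_fm M (F x) \<and> (\<forall>v. \<not> is_free M v (F x))"])
  show "dfn M (\<lambda>e. is_fm M (F (e 0)) \<and> (\<forall>v. \<not> is_free M v (F (e 0))))" by (intro dfn_rules)
qed (simp_all add: is_fm_inst is_free_inst)

text \<open>Codes grow with every connective, and an instance in which the letter q occurs is built
  around \<open>f\<close>. Applied to \<open>A\<close> it makes \<open>F\<close> strictly
  increasing, hence injective.\<close>

lemma inst_gt: "q_occurs B \<Longrightarrow> f \<preceq> t_inst M B th f \<and> (complexity B \<noteq> 0 \<longrightarrow> f \<prec> t_inst M B th f)"
proof (induction B)
  case (TNeg B)
  then have "f \<preceq> t_inst M B th f" by simp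
  then have "f \<prec> t_inst M (TNeg B) th f" using code_gt(1)[of "t_inst M B th f"] by simp
  then show ?case by simp
next
  case (TOr B C)
  have "t_inst M B th f \<prec> t_inst M (TOr B C) th f" "t_inst M C th f \<prec> t_inst M (TOr B C) th f"
    by (simp_all add: code_gt)
  moreover have "f \<preceq> t_inst M B th f \<or> f \<preceq> t_inst M C th f" using TOr by auto
  ultimately have "f \<prec> t_inst M (TOr B C) th f" by (metis ar.le_less_trans)
  then show ?case by simp
next
  case (TEx v B)
  then have "f \<preceq> t_inst M B th f" by simp
  then have "f \<prec> t_inst M (TEx v B) th f" using code_gt(4)[of "t_inst M B th f" "num M v"] by simp
  then show ?case by simp
qed auto

lemma inst_sub: "B \<in> subtemplates C \<Longrightarrow> B \<noteq> C \<Longrightarrow> t_inst M B th f \<prec> t_inst M C th f"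
proof (induction C)
  case (TNeg C)
  then have "t_inst M B th f \<preceq> t_inst M C th f" by fastforce
  then show ?case using code_gt(1)[of "t_inst M C th f"] by simp
next
  case (TOr C D)
  then have "t_inst M B th f \<preceq> t_inst M C th f \<or> t_inst M B th f \<preceq> t_inst M D th f" by fastforce
  then show ?case using code_gt(2,3) by (metis ar.le_less_trans t_inst.simps(4))
next
  case (TEx v C)
  then have "t_inst M B th f \<preceq> t_inst M C th f" by fastforce
  then show ?case using code_gt(4)[of "t_inst M C th f" "num M v"] by simp
qed auto

lemma F_less_sc: "F x \<prec> F (\<S> x)" using inst_gt A_facts by simp

lemma F_strict_mono: "x \<prec> y \<Longrightarrow> F x \<prec> F y"
proof -
  have "x \<prec> y \<longrightarrow> F x \<prec> F y"
  proof (rule induct[where P = "\<lambda>y. x \<prec> y \<longrightarrow> F x \<prec> F y"])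
    show "dfn M (\<lambda>e. x \<prec> e 0 \<longrightarrow> F x \<prec> F (e 0))" by (intro dfn_rules)
    fix y assume "x \<prec> y \<longrightarrow> F x \<prec> F y"
    then show "x \<prec> \<S> y \<longrightarrow> F x \<prec> F (\<S> y)"
      using F_less_sc[of y] by (metis lt_sc_iff ar.le_less ar.less_trans)
  qed simp
  then show "x \<prec> y \<Longrightarrow> F x \<prec> F y" by blast
qed

lemma F_le: "F x \<preceq> F y \<longleftrightarrow> x \<preceq> y"
  using F_strict_mono by (metis ar.le_less ar.not_le)

lemma F_inject [simp]: "F x = F y \<longleftrightarrow> x = y"
  using F_strict_mono by (metis ar.linorder_cases ar.less_irrefl)

lemma inst_ne_th: "complexity B \<noteq> 0 \<Longrightarrow> t_inst M B th f \<noteq> th"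
  by (cases B) auto

lemma F_cases:
  obtains "x = \<zero>" "F x = th" | y where "x = \<S> y" "F x = t_inst M A th (F y)" "F x \<noteq> th"
  using zr_or_sc[of x] inst_ne_th[OF A_facts(1)] by (metis F_sc F_zr)

section \<open>Independence of truth values from the representation as a template instance\<close>

lemma X_eq_zr: "F x = th \<Longrightarrow> x \<in> X \<longleftrightarrow> p"
  using F_inject[of x \<zero>] X_zr by simp

text \<open>Induction on \<open>C\<close>, whose instance is built from \<theta> alone;
  \<open>f\<close> and \<open>q\<close> are arbitrary. Outer symbols are compared. If
  \<open>B\<close> is \<open>LetQ\<close>, its instance F x is first unfolded into an instance of
  \<open>A\<close> at the predecessor of \<open>x\<close>; idempotence and closure of
  \<open>X\<close> keep the truth value unchanged.\<close>

lemma t_val_inst_q_free: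
  assumes "t_inst M B th (F x) = t_inst M C th f" "\<not> q_occurs C"
  shows "t_val B p (x \<in> X) \<longleftrightarrow> t_val C p q"
  using assms
proof (induction C arbitrary: B x)
  case LetP
  then show ?case using X_eq_zr by (cases B) auto
next
  case (TNeg C)
  have *: "t_val B p (x \<in> X) \<longleftrightarrow> t_val (TNeg C) p q"
    if "t_inst M B th (F x) = t_inst M (TNeg C) th f" "complexity B \<noteq> 0" for B x
    using that TNeg by (cases B) auto
  show ?case
  proof (cases "B = LetQ")
    case True
    show ?thesis
    proof (rule F_cases[of x])
      fix y assume y: "x = \<S> y" "F x = t_inst M A th (F y)"
      then have "t_val A p (y \<in> X) \<longleftrightarrow> t_val (TNeg C) p q" using * TNeg.prems(1) A_facts(1) True by auto
      then show ?thesis using A_facts(3) y(1) X_sc True by auto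
    qed (use TNeg.prems True in auto)
  next
    case False
    then show ?thesis using *[of B x] TNeg.prems by (cases "complexity B = 0"; cases B) auto
  qed
next
  case (TOr C D)
  have *: "t_val B p (x \<in> X) \<longleftrightarrow> t_val (TOr C D) p q"
    if "t_inst M B th (F x) = t_inst M (TOr C D) th f" "complexity B \<noteq> 0" for B x
    using that TOr by (cases B) auto
  show ?case
  proof (cases "B = LetQ")
    case True
    show ?thesis
    proof (rule F_cases[of x])
      fix y assume y: "x = \<S> y" "F x = t_inst M A th (F y)"
      then have "t_val A p (y \<in> X) \<longleftrightarrow> t_val (TOr C D) p q" using * TOr.prems(1) A_facts(1) True by auto
      then show ?thesis using A_facts(3) y(1) X_sc True by auto
    qed (use TOr.prems True in auto)
  next
    case False
    then show ?thesis using *[of B x] TOr.prems by (cases "complexity B = 0"; cases B) auto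
  qed
next
  case (TEx v C)
  have *: "t_val B p (x \<in> X) \<longleftrightarrow> t_val (TEx v C) p q"
    if "t_inst M B th (F x) = t_inst M (TEx v C) th f" "complexity B \<noteq> 0" for B x
    using that TEx by (cases B) auto
  show ?case
  proof (cases "B = LetQ")
    case True
    show ?thesis
    proof (rule F_cases[of x])
      fix y assume y: "x = \<S> y" "F x = t_inst M A th (F y)"
      then have "t_val A p (y \<in> X) \<longleftrightarrow> t_val (TEx v C) p q" using * TEx.prems(1) A_facts(1) True by auto
      then show ?thesis using A_facts(3) y(1) X_sc True by auto
    qed (use TEx.prems True in auto)
  next
    case False
    then show ?thesis using *[of B x] TEx.prems by (cases "complexity B = 0"; cases B) auto
  qed
qed auto

lemma F_ne_inst: "q_occurs B \<Longrightarrow> complexity B \<noteq> 0 \<Longrightarrow> F x \<noteq> t_inst M B th (F x)"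
  using inst_gt by (metis ar.less_irrefl)

text \<open>With the same index on both sides the templates can be compared connective by
  connective. By size, F x is no proper instance built around itself; parts without q fall under the
  previous lemma.\<close>

lemma t_val_inst_same:
  assumes "t_inst M B th (F x) = t_inst M C th (F x)"
  shows "t_val B p (x \<in> X) \<longleftrightarrow> t_val C p (x \<in> X)"
proof (cases "q_occurs B \<and> q_occurs C")
  case True
  then show ?thesis using assms
  proof (induction B arbitrary: C)
    case LetQ
    then show ?case using F_ne_inst[of C x] by (cases C) auto
  next
    case (TNeg B)
    show ?case
    proof (cases C)
      case (TNeg C') then show ?thesis using TNeg.IH[of C'] TNeg.prems by auto
    qed (use TNeg.prems F_ne_inst[of "TNeg B" x] in auto)
  next
    case (TOr B B')
    show ?case
    proof (cases C)
      case (TOr C' C'')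
      have "t_val B p (x \<in> X) \<longleftrightarrow> t_val C' p (x \<in> X)"
      proof (cases "q_occurs B \<and> q_occurs C'")
        case True then show ?thesis using TOr.IH(1)[of C'] TOr.prems TOr by auto
      next
        case False then show ?thesis
          using t_val_inst_q_free[of B x C' "F x"] t_val_inst_q_free[of C' x B "F x"] TOr.prems TOr by auto
      qed
      moreover have "t_val B' p (x \<in> X) \<longleftrightarrow> t_val C'' p (x \<in> X)"
      proof (cases "q_occurs B' \<and> q_occurs C''")
        case True then show ?thesis using TOr.IH(2)[of C''] TOr.prems TOr by auto
      next
        case False then show ?thesis
          using t_val_inst_q_free[of B' x C'' "F x"] t_val_inst_q_free[of C'' x B' "F x"] TOr.prems TOr by auto
      qed
      ultimately show ?thesis using TOr by simp
    qed (use TOr.prems F_ne_inst[of "TOr B B'" x] in auto)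
  next
    case (TEx v B)
    show ?case
    proof (cases C)
      case (TEx w C') then show ?thesis using TEx.IH[of C'] TEx.prems by auto
    qed (use TEx.prems F_ne_inst[of "TEx v B" x] in auto)
  qed auto
next
  case False
  then consider "\<not> q_occurs C" | "\<not> q_occurs B" by blast
  then show ?thesis
  proof cases
    case 1 show ?thesis by (rule t_val_inst_q_free[OF assms 1])
  next
    case 2 show ?thesis by (rule t_val_inst_q_free[OF assms[symmetric] 2, symmetric])
  qed
qed

text \<open>If x < y, then F (x+1) \<le> F y \<le> C(\<theta>, F y) = B(\<theta>, F x) \<le>
  A(\<theta>, F x) = F (x+1). All are equal, so \<open>B\<close> is \<open>A\<close>, y = x+1 and
  \<open>C\<close> is \<open>LetQ\<close>; this case is settled by idempotence and closure of
  \<open>X\<close>.\<close>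

lemma t_val_inst_le:
  assumes BC: "B \<in> subtemplates A" and eq: "t_inst M B th (F x) = t_inst M C th (F y)"
    and "q_occurs C" and xy: "x \<preceq> y"
  shows "t_val B p (x \<in> X) \<longleftrightarrow> t_val C p (y \<in> X)"
proof (cases "x = y")
  case True
  show ?thesis using t_val_inst_same[of B x C] eq unfolding True by blast
next
  case False
  then have "\<S> x \<preceq> y" using xy sc_le_iff ar.order.not_eq_order_implies_strict by blast
  then have "F (\<S> x) \<preceq> F y" by (simp only: F_le)
  moreover have le: "F y \<preceq> t_inst M B th (F x)" unfolding eq using inst_gt[OF assms(3)] by simp
  ultimately have "t_inst M A th (F x) \<preceq> t_inst M B th (F x)" by simp
  then have B: "B = A" using inst_sub[OF BC, of "F x"] by (metis ar.not_le)
  then have y: "y = \<S> x" using le \<open>\<S> x \<preceq> y\<close> F_le[of y "\<S> x"] by (metis F_sc ar.order.antisym)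
  then have "F y = t_inst M C th (F y)" using eq B by simp
  then have "C = LetQ" using F_ne_inst[OF assms(3)] assms(3) by (cases C) auto
  then show ?thesis using B y A_facts(3) X_sc by simp
qed

lemma t_val_inst_unique:
  assumes "B \<in> subtemplates A" "C \<in> subtemplates A" "t_inst M B th (F x) = t_inst M C th (F y)"
  shows "t_val B p (x \<in> X) \<longleftrightarrow> t_val C p (y \<in> X)"
proof (cases "q_occurs B \<and> q_occurs C")
  case True
  then show ?thesis using t_val_inst_le[of B x C y] t_val_inst_le[of C y B x] assms
    by (metis ar.linear)
next
  case False
  then consider "\<not> q_occurs C" | "\<not> q_occurs B" by blast
  then show ?thesis
  proof cases
    case 1 show ?thesis by (rule t_val_inst_q_free[OF assms(3) 1])
  next
    case 2 show ?thesis by (rule t_val_inst_q_free[OF assms(3)[symmetric] 2, symmetric])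
  qed
qed

text \<open>Seen from outside, the subformula relation on these formulas need not be well-founded, so
  their truth values are not defined by recursion but through a representation as an instance of a
  subtemplate; they do not depend on it by the previous lemma.\<close>

definition itf :: "'m set" where
  "itf = {t_inst M B th (F x) | B x. B \<in> subtemplates A}"

definition itv :: "'m \<Rightarrow> bool" where
  "itv f \<longleftrightarrow> (\<exists>B x. B \<in> subtemplates A \<and> f = t_inst M B th (F x) \<and> t_val B p (x \<in> X))"

lemma itv_inst: "B \<in> subtemplates A \<Longrightarrow> itv (t_inst M B th (F x)) \<longleftrightarrow> t_val B p (x \<in> X)"
  unfolding itv_def using t_val_inst_unique by blast

lemma F_itf [simp]: "F x \<in> itf"
proof -
  have "F x = t_inst M LetQ th (F x)" by simp
  then show ?thesis unfolding itf_def using LetQ_subtemplates A_facts(2) by blast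
qed

lemma itv_F: "itv (F x) \<longleftrightarrow> x \<in> X"
  using itv_inst[of LetQ x] LetQ_subtemplates A_facts(2) by simp

lemma itf_sentence: "f \<in> itf \<Longrightarrow> is_fm M f \<and> \<not> is_free M v f"
  unfolding itf_def using is_fm_inst is_free_inst F_sentence by blast

text \<open>Brings a representation into a form with a visible outer symbol: \<open>LetP\<close>
  gives \<theta>, and \<open>LetQ\<close> gives \<theta> or, after one unfolding, an instance of
  \<open>A\<close> at the predecessor.\<close>

lemma itf_cases:
  assumes "f \<in> itf"
  obtains "f = th" | B x where "B \<in> subtemplates A" "complexity B \<noteq> 0" "f = t_inst M B th (F x)"
proof -
  obtain B x where B: "B \<in> subtemplates A" "f = t_inst M B th (F x)" using assms unfolding itf_def by blast
  show thesis
  proof (cases "complexity B = 0")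
    case True
    then consider "B = LetP" | "B = LetQ" by (cases B) auto
    then show thesis
    proof cases
      case 2
      show thesis
      proof (rule F_cases[of x])
        fix y assume "x = \<S> y" "F x = t_inst M A th (F y)"
        then show thesis using that(2)[of A y] B 2 A_facts(1) by simp
      qed (use that(1) B 2 in simp)
    qed (use that(1) B in simp)
  qed (use that(2) B in blast)
qed

lemma itv_th: "th \<in> itf \<Longrightarrow> itv th \<longleftrightarrow> p"
  using itv_F[of \<zero>] X_zr by simp

lemma itf_in: "B \<in> subtemplates A \<Longrightarrow> t_inst M B th (F x) \<in> itf"
  unfolding itf_def by blast

lemma itf_eq: "c_eq M s t \<in> itf \<Longrightarrow> c_eq M s t = th"
proof (erule itf_cases)
  fix B x assume "complexity B \<noteq> 0" "c_eq M s t = t_inst M B th (F x)"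
  then show "c_eq M s t = th" by (cases B) auto
qed

text \<open>Closure and compositionality come together: the representing template must have
  \<open>TNeg\<close> outermost, and its part represents the child. The next two lemmas are the
  analogues for the other symbols.\<close>

lemma itf_neg: "c_neg M f \<in> itf \<Longrightarrow> f \<in> itf \<and> (itv (c_neg M f) \<longleftrightarrow> \<not> itv f)"
proof (erule itf_cases)
  fix B x assume B: "B \<in> subtemplates A" "complexity B \<noteq> 0" "c_neg M f = t_inst M B th (F x)"
  then obtain C where C: "B = TNeg C" "f = t_inst M C th (F x)" by (cases B) auto
  then have "C \<in> subtemplates A" using B(1) subtemplates_children by blast
  then show ?thesis using itv_inst[OF B(1), of x] itv_inst[of C x] C itf_in by auto
qed simp

lemma itf_or: "c_or M f g \<in> itf \<Longrightarrow> f \<in> itf \<and> g \<in> itf \<and> (itv (c_or M f g) \<longleftrightarrow> itv f \<or> itv g)"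
proof (erule itf_cases)
  fix B x assume B: "B \<in> subtemplates A" "complexity B \<noteq> 0" "c_or M f g = t_inst M B th (F x)"
  then obtain C D where C: "B = TOr C D" "f = t_inst M C th (F x)" "g = t_inst M D th (F x)" by (cases B) auto
  then have "C \<in> subtemplates A" "D \<in> subtemplates A" using B(1) subtemplates_children by blast+
  then show ?thesis using itv_inst[OF B(1), of x] itv_inst[of C x] itv_inst[of D x] C itf_in by auto
qed simp

lemma itf_ex: "c_ex M v f \<in> itf \<Longrightarrow> f \<in> itf \<and> (itv (c_ex M v f) \<longleftrightarrow> itv f)"
proof (erule itf_cases)
  fix B x assume B: "B \<in> subtemplates A" "complexity B \<noteq> 0" "c_ex M v f = t_inst M B th (F x)"
  then obtain w C where C: "B = TEx w C" "f = t_inst M C th (F x)" "v = num M w" by (cases B) auto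
  then have "C \<in> subtemplates A" using B(1) subtemplates_children by blast
  then show ?thesis using itv_inst[OF B(1), of x] itv_inst[of C x] C itf_in by auto
qed simp

end

subsection \<open>Recursive sets of iterated codes\<close>

text \<open>Total recursive functions of arity \<open>k\<close>, in a form that can be composed
  without explicit \<open>recf\<close> terms.\<close>

definition recfun :: "nat \<Rightarrow> (nat list \<Rightarrow> nat) \<Rightarrow> bool" where
  "recfun k f \<longleftrightarrow> (\<exists>r. \<forall>xs. length xs = k \<longrightarrow> rec_eval r xs (f xs))"

lemma recfun_nth: "i < k \<Longrightarrow> recfun k (\<lambda>xs. xs ! i)"
  unfolding recfun_def by (intro exI[of _ "RProj i"]) (auto intro: rec_eval.intros)

lemma recfun_comp1:
  assumes "recfun 1 (\<lambda>xs. g (xs ! 0))" "recfun k f"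
  shows "recfun k (\<lambda>xs. g (f xs))"
proof -
  obtain r where r: "\<And>xs. length xs = 1 \<Longrightarrow> rec_eval r xs (g (xs ! 0))"
    using assms(1) unfolding recfun_def by blast
  obtain s where s: "\<And>xs. length xs = k \<Longrightarrow> rec_eval s xs (f xs)"
    using assms(2) unfolding recfun_def by blast
  have "rec_eval (RComp r [s]) xs (g (f xs))" if "length xs = k" for xs
    by (rule rec_eval.intros(4)[where ys = "[f xs]"]) (use s[OF that] r[of "[f xs]"] in auto)
  then show ?thesis unfolding recfun_def by blast
qed

lemma recfun_comp2:
  assumes "recfun 2 (\<lambda>xs. g (xs ! 0) (xs ! 1))" "recfun k f" "recfun k f'"
  shows "recfun k (\<lambda>xs. g (f xs) (f' xs))"
proof -
  obtain r where r: "\<And>xs. length xs = 2 \<Longrightarrow> rec_eval r xs (g (xs ! 0) (xs ! 1))"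
    using assms(1) unfolding recfun_def by blast
  obtain s where s: "\<And>xs. length xs = k \<Longrightarrow> rec_eval s xs (f xs)"
    using assms(2) unfolding recfun_def by blast
  obtain s' where s': "\<And>xs. length xs = k \<Longrightarrow> rec_eval s' xs (f' xs)"
    using assms(3) unfolding recfun_def by blast
  have "rec_eval (RComp r [s, s']) xs (g (f xs) (f' xs))" if "length xs = k" for xs
    by (rule rec_eval.intros(4)[where ys = "[f xs, f' xs]"])
      (use s[OF that] s'[OF that] r[of "[f xs, f' xs]"] in auto)
  then show ?thesis unfolding recfun_def by blast
qed

lemma recfun_Suc: "recfun k f \<Longrightarrow> recfun k (\<lambda>xs. Suc (f xs))"
proof (rule recfun_comp1[where g = Suc])
  have "rec_eval RSucc xs (Suc (xs ! 0))" if "length xs = 1" for xs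
  proof -
    from that obtain x where "xs = [x]" by (cases xs) auto
    then show ?thesis by (auto intro: rec_eval.intros)
  qed
  then show "recfun 1 (\<lambda>xs. Suc (xs ! 0))" unfolding recfun_def by blast
qed

lemma recfun_const: "recfun k (\<lambda>xs. c)"
proof (induction c)
  case 0
  show ?case unfolding recfun_def by (intro exI[of _ RZero]) (auto intro: rec_eval.intros)
qed (rule recfun_Suc)

lemma recfun_rec:
  assumes "recfun 1 (\<lambda>xs. b (xs ! 0))" "recfun 3 (\<lambda>xs. s (xs ! 0) (xs ! 1) (xs ! 2))"
  shows "recfun 2 (\<lambda>xs. rec_nat (b (xs ! 1)) (\<lambda>n y. s n y (xs ! 1)) (xs ! 0))"
proof -
  obtain r where r: "\<And>xs. length xs = 1 \<Longrightarrow> rec_eval r xs (b (xs ! 0))"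
    using assms(1) unfolding recfun_def by blast
  obtain t where t: "\<And>xs. length xs = 3 \<Longrightarrow> rec_eval t xs (s (xs ! 0) (xs ! 1) (xs ! 2))"
    using assms(2) unfolding recfun_def by blast
  have *: "rec_eval (RPrim r t) [n, x] (rec_nat (b x) (\<lambda>n y. s n y x) n)" for n x
  proof (induction n)
    case 0
    show ?case using r[of "[x]"] by (auto intro: rec_eval.intros)
  next
    case (Suc n)
    show ?case
      using rec_eval.intros(6)[OF Suc t[of "[n, rec_nat (b x) (\<lambda>n y. s n y x) n, x]"]]
      by (simp add: numeral_2_eq_2)
  qed
  have "rec_eval (RPrim r t) xs (rec_nat (b (xs ! 1)) (\<lambda>n y. s n y (xs ! 1)) (xs ! 0))"
    if len: "length xs = 2" for xs
  proof -
    from len obtain n x where "xs = [n, x]"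
      by (cases xs; cases "tl xs") auto
    then show ?thesis using *[of n x] by simp
  qed
  then show ?thesis unfolding recfun_def by blast
qed

lemma recfun_iter2:
  assumes "recfun 1 (\<lambda>xs. b (xs ! 0))" "recfun 3 (\<lambda>xs. s (xs ! 0) (xs ! 1) (xs ! 2))"
    and "recfun k f" "recfun k f'"
    and "\<And>x. g 0 x = b x" "\<And>n x. g (Suc n) x = s n (g n x) x"
  shows "recfun k (\<lambda>xs. g (f xs) (f' xs))"
proof -
  have "rec_nat (b x) (\<lambda>n y. s n y x) n = g n x" for n x
    by (induction n) (simp_all add: assms(5,6))
  then show ?thesis using recfun_comp2[of g k f f', OF _ assms(3,4)] recfun_rec[OF assms(1,2)] by simp
qed

lemma recfun_add: "recfun k f \<Longrightarrow> recfun k g \<Longrightarrow> recfun k (\<lambda>xs. f xs + g xs)"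
  by (rule recfun_iter2[where b = "\<lambda>x. x" and s = "\<lambda>n y x. Suc y" and g = "(+)"])
     ((rule recfun_Suc recfun_nth | assumption | simp)+)

lemma recfun_pred: "recfun k f \<Longrightarrow> recfun k (\<lambda>xs. f xs - 1)"
  by (rule recfun_iter2[where b = "\<lambda>x. 0" and s = "\<lambda>n y x. n" and g = "\<lambda>n x. n - 1" and f' = f])
     ((rule recfun_nth recfun_const | assumption | simp)+)

lemma recfun_diff: "recfun k f \<Longrightarrow> recfun k g \<Longrightarrow> recfun k (\<lambda>xs. f xs - g xs)"
  by (rule recfun_iter2[where b = "\<lambda>x. x" and s = "\<lambda>n y x. y - 1" and g = "\<lambda>n x. x - n" and f = g])
     ((rule recfun_pred recfun_nth | assumption | simp)+)

fun tri :: "nat \<Rightarrow> nat" where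
  "tri 0 = 0"
| "tri (Suc n) = tri n + Suc n"

lemma recfun_tri: "recfun k f \<Longrightarrow> recfun k (\<lambda>xs. tri (f xs))"
  by (rule recfun_iter2[where b = "\<lambda>x. 0" and s = "\<lambda>n y x. y + Suc n" and g = "\<lambda>n x. tri n" and f' = f])
     ((rule recfun_add recfun_Suc recfun_nth recfun_const | assumption | simp)+)

text \<open>Half of the product is a triangular number, so that halving is replaced by a primitive
  recursion.\<close>

lemma pr_nat: "pr nat_arith x y = tri (x + y) + x"
proof -
  have "tri s + tri s = s * Suc s" for s by (induction s) auto
  note this[of "x + y"]
  then show ?thesis unfolding pr_def by (intro the_equality) (auto simp: nat_arith_def)
qed

lemma recfun_pr: "recfun k f \<Longrightarrow> recfun k g \<Longrightarrow> recfun k (\<lambda>xs. pr nat_arith (f xs) (g xs))"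
  unfolding pr_nat by (intro recfun_add recfun_tri)

lemma le_tri: "n \<le> tri n" by (induction n) auto

lemma pr_nat_ge: "x \<le> pr nat_arith x y" "y \<le> pr nat_arith x y" "0 < x \<Longrightarrow> y < pr nat_arith x y"
  using le_tri[of "x + y"] by (auto simp: pr_nat)

text \<open>The values grow, n \<le> h ((g ^^ n) c), so membership of x is settled by trying all n
  \<le> x.\<close>

lemma recursive_iterates:
  assumes h: "recfun 1 (\<lambda>xs. h (xs ! 0))" and g: "recfun 1 (\<lambda>xs. g (xs ! 0))"
    and hi: "\<And>y. y \<le> h y" and gi: "\<And>y. y < g y"
  shows "recursive_set (range (\<lambda>n. h ((g ^^ n) c)))"
proof -
  have it: "recfun k (\<lambda>xs. (g ^^ (f xs)) c)" if "recfun k f" for k f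
    by (rule recfun_iter2[where b = "\<lambda>x. c" and s = "\<lambda>n y x. g y" and g = "\<lambda>n x. (g ^^ n) c" and f' = f])
       ((rule that recfun_const recfun_comp1[OF g] recfun_nth | simp)+)
  \<comment> \<open>With truncated subtraction this is 1 if the n-th value equals \<open>x\<close>
    and 0 otherwise; \<chi> counts such n below a bound, and 1 - (1 - \<chi>) turns the count into a
    truth value.\<close>
  define e where "e n x = 1 - ((h ((g ^^ n) c) - x) + (x - h ((g ^^ n) c)))" for n x
  have e: "e n x = (if h ((g ^^ n) c) = x then 1 else 0)" for n x by (auto simp: e_def)
  define \<chi> where "\<chi> n x = (\<Sum>i<n. e i x)" for n x
  have "recfun 1 (\<lambda>xs. 1 - (1 - \<chi> (Suc (xs ! 0)) (xs ! 0)))"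
    by (intro recfun_diff recfun_const
        recfun_iter2[where b = "\<lambda>x. 0" and s = "\<lambda>n y x. y + e n x" and g = \<chi>])
       (simp_all add: \<chi>_def, unfold e_def,
        (rule recfun_const recfun_diff recfun_add recfun_Suc recfun_comp1[OF h] it recfun_nth | simp)+)
  then obtain r where r: "\<And>xs. length xs = 1 \<Longrightarrow> rec_eval r xs (1 - (1 - \<chi> (Suc (xs ! 0)) (xs ! 0)))"
    unfolding recfun_def by blast
  have ge: "n \<le> h ((g ^^ n) c)" for n
  proof -
    have "n \<le> (g ^^ n) c"
    proof (induction n)
      case (Suc n) then show ?case using gi[of "(g ^^ n) c"] by simp
    qed simp
    then show ?thesis using hi order_trans by blast
  qed
  have eq: "1 - (1 - \<chi> (Suc x) x) = (if x \<in> range (\<lambda>n. h ((g ^^ n) c)) then 1 else 0)" for x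
  proof (cases "\<exists>n. h ((g ^^ n) c) = x")
    case True
    then obtain n where n: "h ((g ^^ n) c) = x" by blast
    then have "n < Suc x" using ge[of n] by simp
    then have "e n x \<le> \<chi> (Suc x) x" unfolding \<chi>_def by (intro member_le_sum) auto
    then show ?thesis using n by (auto simp: e)
  next
    case False
    then have "\<chi> (Suc x) x = 0" by (auto simp: \<chi>_def e)
    then show ?thesis using False by auto
  qed
  have "rec_eval r [x] (if x \<in> range (\<lambda>n. h ((g ^^ n) c)) then 1 else 0)" for x
    using r[of "[x]"] unfolding eq[symmetric] by simp
  then show ?thesis unfolding recursive_set_def by blast
qed

text \<open>A formula context whose action on codes is recursive and increases them; the increase is
  what bounds the search in \<open>recursive_iterates\<close>.\<close>

definition codectx :: "(fm \<Rightarrow> fm) \<Rightarrow> (nat \<Rightarrow> nat) \<Rightarrow> bool" where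
  "codectx C g \<longleftrightarrow> (\<forall>f. fm_code nat_arith (C f) = g (fm_code nat_arith f)) \<and>
     recfun 1 (\<lambda>xs. g (xs ! 0)) \<and> (\<forall>y. y < g y)"

lemma num_nat: "num nat_arith n = n"
  unfolding num_def by (induction n) (auto simp: nat_arith_def)

lemma codectx_Neg: "codectx C g \<Longrightarrow> codectx (\<lambda>f. Neg (C f)) (\<lambda>y. pr nat_arith 7 (g y))"
  unfolding codectx_def
  by (auto simp: c_neg_def num_nat intro: recfun_pr recfun_const less_le_trans pr_nat_ge)

lemma codectx_Or: "codectx C g \<Longrightarrow>
  codectx (\<lambda>f. Or a (C f)) (\<lambda>y. pr nat_arith 8 (pr nat_arith (fm_code nat_arith a) (g y)))"
  unfolding codectx_def
  by (auto simp: c_or_def num_nat intro!: recfun_pr recfun_const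
      intro: less_le_trans order_trans[OF pr_nat_ge(2) pr_nat_ge(2)])

lemma codectx_Ex: "codectx C g \<Longrightarrow>
  codectx (\<lambda>f. Ex v (C f)) (\<lambda>y. pr nat_arith 9 (pr nat_arith v (g y)))"
  unfolding codectx_def
  by (auto simp: c_ex_def num_nat intro!: recfun_pr recfun_const
      intro: less_le_trans order_trans[OF pr_nat_ge(2) pr_nat_ge(2)])

lemma codectx_Neg0: "codectx Neg (\<lambda>y. pr nat_arith 7 y)"
  unfolding codectx_def
  by (auto simp: c_neg_def num_nat intro: recfun_pr recfun_const recfun_nth pr_nat_ge)

subsection \<open>Closed games\<close>

fun wins :: "('s \<Rightarrow> 'x \<Rightarrow> 's \<Rightarrow> bool) \<Rightarrow> nat \<Rightarrow> 's \<Rightarrow> bool" where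
  "wins E 0 s \<longleftrightarrow> True"
| "wins E (Suc n) s \<longleftrightarrow> (\<forall>x. \<exists>s'. E s x s' \<and> wins E n s')"

lemma wins_Suc: "wins E (Suc n) s \<Longrightarrow> wins E n s"
proof (induction n arbitrary: s)
  case (Suc n)
  show ?case
    unfolding wins.simps(2)[of E n s]
  proof
    fix x
    obtain s' where "E s x s'" "wins E (Suc n) s'" using Suc.prems unfolding wins.simps(2)[of E "Suc n" s] by blast
    then show "\<exists>s'. E s x s' \<and> wins E n s'" using Suc.IH by blast
  qed
qed simp

lemma wins_le: "m \<le> n \<Longrightarrow> wins E n s \<Longrightarrow> wins E m s"
  by (induction rule: inc_induct) (auto simp del: wins.simps dest: wins_Suc)

text \<open>The type says of s' that it is a legal answer from which n rounds can be won, for every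
  n. A finite part is realized by an answer that wins the largest number of rounds mentioned. The
  type is recursive because the formula for n rounds arises by iterating one context.\<close>

lemma wins_step:
  assumes sat: "recursively_saturated M"
    and E: "dfn M (\<lambda>e. E (e 0) (e 1) (e 2))"
    and w: "\<And>n. wins E n s"
  shows "\<exists>s'. E s x s' \<and> (\<forall>n. wins E n s')"
proof -
  obtain f r where f: "\<And>e. sat M (mix e r) f \<longleftrightarrow> E (e 0) (e 1) (e 2)"
    using E unfolding dfn_def by blast
  \<comment> \<open>\<open>f\<close> reads its three arguments at the variables 0, 2, 4; they are
    moved to \<open>a\<close>, \<open>b\<close>, \<open>c\<close>, and the parameters to the
    variables from 5 on.\<close>
  define \<sigma> where "\<sigma> a b c n = (if n = 0 then a else if n = 2 then b else if n = 4 then c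
    else if odd n then n div 2 + 5 else 0)" for a b c n :: nat
  define ok where "ok e \<longleftrightarrow> (\<forall>n. e (n + 5) = r n)" for e
  have ren: "\<exists>g. \<forall>e. ok e \<longrightarrow> (sat M e g \<longleftrightarrow> E (e a) (e b) (e c))" for a b c
  proof -
    obtain g where g: "\<And>e. sat M e g \<longleftrightarrow> sat M (\<lambda>n. e (\<sigma> a b c n)) f" using sat_ren by blast
    have "sat M e g \<longleftrightarrow> E (e a) (e b) (e c)" if "ok e" for e
    proof -
      have "(\<lambda>n. e (\<sigma> a b c n)) = mix (\<lambda>i. e (\<sigma> a b c (2 * i))) r"
        using that by (auto simp: fun_eq_iff mix_def ok_def \<sigma>_def)
      then show ?thesis unfolding g using f by (simp add: \<sigma>_def)
    qed
    then show ?thesis by blast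
  qed
  \<comment> \<open>\<open>e1\<close> is the move relation inside the iterated formula;
    \<open>e2\<close> is the move from the given position (variable 3) under the given challenge
    (variable 4) to the element sought (variable 0).\<close>
  obtain e1 where e1: "\<And>e. ok e \<Longrightarrow> sat M e e1 \<longleftrightarrow> E (e 0) (e 1) (e 2)" using ren[of 0 1 2] by blast
  obtain e2 where e2: "\<And>e. ok e \<Longrightarrow> sat M e e2 \<longleftrightarrow> E (e 3) (e 4) (e 0)" using ren[of 3 4 0] by blast
  \<comment> \<open>In usual notation: \<forall>x1 \<exists>x2 (E x0 x1 x2 \<and> \<exists>x0 (x0 =
    x2 \<and> G)). The new position is copied to variable 0, so that the same context can be
    iterated without renaming.\<close>
  define C where "C G = Neg (Ex 1 (Neg (Ex 2 (Neg (Or (Neg e1) (Neg (Ex 0 (Neg (Or (Neg (Eq (Var 0) (Var 2))) (Neg G))))))))))" for G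
  define H where "H G = Neg (Or (Neg e2) (Neg G))" for G
  define T where "T = Eq Zero Zero"
  have G: "sat M e ((C ^^ n) T) \<longleftrightarrow> wins E n (e 0)" if "ok e" for e n
    using that
  proof (induction n arbitrary: e)
    case 0 show ?case by (simp add: T_def)
  next
    case (Suc n)
    have ok: "ok (e(1 := u))" "ok (e(1 := u, 2 := v))" "ok (e(1 := u, 2 := v, 0 := w))" for u v w
      using Suc.prems by (auto simp: ok_def)
    have "sat M e ((C ^^ Suc n) T) \<longleftrightarrow> (\<forall>u. \<exists>v. sat M (e(1 := u, 2 := v)) e1 \<and>
        sat M (e(1 := u, 2 := v, 0 := v)) ((C ^^ n) T))"
      by (simp add: C_def)
    moreover have "sat M (e(1 := u, 2 := v)) e1 \<longleftrightarrow> E (e 0) u v" for u v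
      using e1[OF ok(2)[of u v]] by simp
    moreover have "sat M (e(1 := u, 2 := v, 0 := v)) ((C ^^ n) T) \<longleftrightarrow> wins E n v" for u v
      using Suc.IH[OF ok(3)[of u v v]] by (simp only: fun_upd_same)
    ultimately show ?case by (simp only: wins.simps)
  qed
  have "\<exists>g. codectx C g" unfolding C_def
    by (rule exI) (rule codectx_Neg codectx_Or codectx_Ex codectx_Neg0)+
  then obtain g where g: "codectx C g" ..
  have "\<exists>h. codectx H h" unfolding H_def
    by (rule exI) (rule codectx_Neg codectx_Or codectx_Ex codectx_Neg0)+
  then obtain h where h: "codectx H h" ..
  define p where "p = range (\<lambda>n. H ((C ^^ n) T))"
  have "fm_code nat_arith ((C ^^ n) T) = (g ^^ n) (fm_code nat_arith T)" for n
    using g by (induction n) (auto simp: codectx_def)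
  then have "fm_code nat_arith ` p = range (\<lambda>n. h ((g ^^ n) (fm_code nat_arith T)))"
    using h by (simp add: p_def codectx_def image_image)
  moreover have "recursive_set \<dots>"
    using g h by (intro recursive_iterates) (auto simp: codectx_def less_imp_le)
  ultimately have rec: "recursive_set (fm_code nat_arith ` p)" by simp
  obtain k where k: "fvars e1 \<union> fvars e2 \<union> {0, 1, 2} \<subseteq> {..k}"
    using finite_nat_set_iff_bounded_le[of "fvars e1 \<union> fvars e2 \<union> {0, 1, 2}"] by auto
  have "fvars ((C ^^ n) T) \<subseteq> {..k}" for n
    using k by (induction n) (auto simp: T_def C_def)
  then have fv: "\<forall>f\<in>p. fvars f \<subseteq> {..k}" using k by (auto simp: p_def H_def)
  define e where "e n = (if n = 3 then s else if n = 4 then x else r (n - 5))" for n :: nat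
  have ok: "ok (e(0 := y))" for y by (auto simp: ok_def e_def)
  have Hsat: "sat M (e(0 := y)) (H ((C ^^ n) T)) \<longleftrightarrow> E s x y \<and> wins E n y" for y n
    using e2[OF ok[of y]] G[OF ok[of y], of n] by (simp add: H_def e_def)
  have "\<exists>y. \<forall>f\<in>q. sat M (e(0 := y)) f" if q: "finite q" "q \<subseteq> p" for q
  proof -
    obtain N where N: "finite N" "q = (\<lambda>n. H ((C ^^ n) T)) ` N"
      using finite_subset_image[OF q(1)] q(2) unfolding p_def by metis
    obtain m where m: "\<forall>n\<in>N. n \<le> m" using N(1) finite_nat_set_iff_bounded_le by blast
    obtain y where "E s x y" "wins E m y" using w[of "Suc m"] by auto
    then have "\<forall>n\<in>N. sat M (e(0 := y)) (H ((C ^^ n) T))"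
      unfolding Hsat using m wins_le[of _ m E y] by simp
    then have "\<forall>f\<in>q. sat M (e(0 := y)) f" unfolding N(2) by simp
    then show ?thesis by blast
  qed
  then obtain y where "\<forall>f\<in>p. sat M (e(0 := y)) f"
    using sat[unfolded recursively_saturated_def, rule_format, of p k e] rec fv by blast
  then have "\<forall>n. sat M (e(0 := y)) (H ((C ^^ n) T))" unfolding p_def by simp
  then show ?thesis unfolding Hsat by blast
qed

text \<open>Choosing answers by \<open>wins_step\<close> maintains the invariant that every finite
  number of further rounds can be won.\<close>

lemma closed_game:
  assumes "recursively_saturated M" "dfn M (\<lambda>e. E (e 0) (e 1) (e 2))" "\<And>n. wins E n s"
  shows "\<exists>S. S 0 = s \<and> (\<forall>t :: nat. E (S t) (x t) (S (Suc t)))"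
proof -
  have "\<exists>S. (S 0 = s \<and> (\<forall>n. wins E n (S 0))) \<and>
      (\<forall>t. (\<forall>n. wins E n (S (Suc t))) \<and> E (S t) (x t) (S (Suc t)))"
  proof -
    define nxt where "nxt t u = (SOME u'. E u (x t) u' \<and> (\<forall>n. wins E n u'))" for t u
    define S where "S = rec_nat s nxt"
    have nxt: "E u (x t) (nxt t u) \<and> (\<forall>n. wins E n (nxt t u))" if "\<forall>n. wins E n u" for t u
      unfolding nxt_def by (rule someI_ex, rule wins_step[OF assms(1,2)]) (use that in blast)
    have S: "S 0 = s" "S (Suc t) = nxt t (S t)" for t by (simp_all add: S_def)
    have "\<forall>n. wins E n (S t)" for t
      by (induction t) (use S nxt assms(3) in auto)
    then show ?thesis using S nxt assms(3) by (intro exI[of _ S]) simp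
  qed
  then show ?thesis by blast
qed

context pa
begin

subsection \<open>Compositional valuations\<close>

definition atm :: "'m \<Rightarrow> bool" where "atm f \<longleftrightarrow> (\<exists>s t. f = c_eq M s t)"

definition ngm :: "'m \<Rightarrow> bool" where "ngm f \<longleftrightarrow> (\<exists>g. f = c_neg M g)"

definition tru :: "'m \<Rightarrow> 'm \<Rightarrow> bool" where
  "tru f a \<longleftrightarrow> (\<exists>s t y. f = c_eq M s t \<and> is_val M a s y \<and> is_val M a t y)"

definition imm :: "'m \<Rightarrow> 'm \<Rightarrow> bool" where
  "imm f g \<longleftrightarrow> f = c_neg M g \<or> (\<exists>h. f = c_or M g h \<or> f = c_or M h g) \<or> (\<exists>v. f = c_ex M v g)"

text \<open>The pairs (g, b) on whose values that of (f, a) depends. An existential formula has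
  children for the variants of \<open>a\<close> at its variable, the other compounds at most two;
  \<open>asg_for\<close> excludes variants that leave a free variable without a value.\<close>

definition chn :: "'m \<Rightarrow> 'm \<Rightarrow> 'm \<Rightarrow> 'm \<Rightarrow> bool" where
  "chn f a g b \<longleftrightarrow> asg_for M g b \<and> ((f = c_neg M g \<and> b = a) \<or>
     (\<exists>h. (f = c_or M g h \<or> f = c_or M h g) \<and> b = restr M a g) \<or>
     (\<exists>v c. f = c_ex M v g \<and> is_asg M c \<and>
        (\<forall>w x. w \<noteq> v \<longrightarrow> (mem M (pr M w x) c \<longleftrightarrow> mem M (pr M w x) a)) \<and> b = restr M c g))"

text \<open>A negation is true if its child is false, any other compound formula if some child is true;
  thus the three compositional clauses have a common form.\<close>

definition comp :: "('m \<Rightarrow> 'm \<Rightarrow> bool) \<Rightarrow> 'm \<Rightarrow> 'm \<Rightarrow> bool" where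
  "comp V f a \<longleftrightarrow> (if atm f then V f a \<longleftrightarrow> tru f a
     else V f a \<longleftrightarrow> (\<exists>g b. chn f a g b \<and> V g b \<noteq> ngm f))"

lemma chn_imm: "chn f a g b \<Longrightarrow> imm f g" by (auto simp: chn_def imm_def)

lemma chn_asg_for: "chn f a g b \<Longrightarrow> asg_for M g b" by (simp add: chn_def)

lemma imm_less: "imm f g \<Longrightarrow> g \<prec> f" by (auto simp: imm_def code_gt)

lemma imm_is_fm: "imm f g \<Longrightarrow> is_fm M f \<Longrightarrow> is_fm M g" by (auto simp: imm_def)

lemma comp_cong:
  assumes "V f a \<longleftrightarrow> V' f a" "\<And>g b. chn f a g b \<Longrightarrow> V g b \<longleftrightarrow> V' g b"
  shows "comp V f a \<longleftrightarrow> comp V' f a"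
proof -
  have "(\<exists>g b. chn f a g b \<and> V g b \<noteq> ngm f) \<longleftrightarrow> (\<exists>g b. chn f a g b \<and> V' g b \<noteq> ngm f)"
    using assms(2) by blast
  then show ?thesis using assms(1) by (simp add: comp_def)
qed

lemma shape [simp]:
  "atm (c_eq M s t)" "\<not> atm (c_neg M f)" "\<not> atm (c_or M f g)" "\<not> atm (c_ex M v f)"
  "ngm (c_neg M f)" "\<not> ngm (c_or M f g)" "\<not> ngm (c_ex M v f)"
  by (auto simp: atm_def ngm_def)

lemma chn_neg: "asg_for M (c_neg M f) a \<Longrightarrow> chn (c_neg M f) a g b \<longleftrightarrow> g = f \<and> b = a"
  by (auto simp: chn_def asg_for_def)

lemma chn_or: "asg_for M (c_or M f f') a \<Longrightarrow>
  chn (c_or M f f') a g b \<longleftrightarrow> (g = f \<or> g = f') \<and> b = restr M a g"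
  using asg_for_restr[of a g] by (auto simp: chn_def asg_for_def)

lemma chn_ex: "chn (c_ex M v f) a g b \<longleftrightarrow> g = f \<and> asg_for M f b \<and> (\<exists>c. is_asg M c \<and>
        (\<forall>w x. w \<noteq> v \<longrightarrow> (mem M (pr M w x) c \<longleftrightarrow> mem M (pr M w x) a)) \<and> b = restr M c f)"
  by (auto simp: chn_def)

lemma comp_neg: "asg_for M (c_neg M f) a \<Longrightarrow> comp V (c_neg M f) a \<longleftrightarrow> (V (c_neg M f) a \<longleftrightarrow> \<not> V f a)"
  by (simp add: comp_def chn_neg)

lemma comp_or: "asg_for M (c_or M f g) a \<Longrightarrow>
  comp V (c_or M f g) a \<longleftrightarrow> (V (c_or M f g) a \<longleftrightarrow> V f (restr M a f) \<or> V g (restr M a g))"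
  by (simp add: comp_def chn_or) blast

lemma comp_ex: "comp V (c_ex M v f) a \<longleftrightarrow> (V (c_ex M v f) a \<longleftrightarrow> (\<exists>c. is_asg M c \<and>
    (\<forall>w x. w \<noteq> v \<longrightarrow> (mem M (pr M w x) c \<longleftrightarrow> mem M (pr M w x) a)) \<and>
    asg_for M f (restr M c f) \<and> V f (restr M c f)))"
  by (simp add: comp_def chn_ex) blast

text \<open>\<open>V\<close> is arbitrary off the pairs of a formula and an assignment for it, hence
  the truncation. The clauses never leave these pairs: restrictions to the parts of a disjunction
  are assignments for them, and for existential formulas \<open>chn\<close> demands it.\<close>

lemma CS_minus_comp:
  assumes "\<And>f a. is_fm M f \<Longrightarrow> asg_for M f a \<Longrightarrow> comp V f a"
  shows "CS_minus M {(f, a). is_fm M f \<and> asg_for M f a \<and> V f a}"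
proof -
  have 1: "V (c_eq M s t) a \<longleftrightarrow> (\<exists>y. is_val M a s y \<and> is_val M a t y)"
    if "is_tm M s" "is_tm M t" "asg_for M (c_eq M s t) a" for s t a
    using assms[of "c_eq M s t" a] that by (auto simp: comp_def tru_def)
  have 2: "V (c_or M f g) a \<longleftrightarrow> V f (restr M a f) \<or> V g (restr M a g)"
    "asg_for M f (restr M a f)" "asg_for M g (restr M a g)"
    if "is_fm M f" "is_fm M g" "asg_for M (c_or M f g) a" for f g a
    using assms[of "c_or M f g" a] that comp_or[OF that(3)] asg_for_restr[of a]
    by (simp_all add: asg_for_def)
  have 3: "V (c_neg M f) a \<longleftrightarrow> \<not> V f a" "asg_for M f a"
    if "is_fm M f" "asg_for M (c_neg M f) a" for f a
    using assms[of "c_neg M f" a] that comp_neg[OF that(2)] by (simp_all add: asg_for_def)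
  have 4: "V (c_ex M v f) a \<longleftrightarrow> (\<exists>c. is_asg M c \<and>
    (\<forall>w x. w \<noteq> v \<longrightarrow> (mem M (pr M w x) c \<longleftrightarrow> mem M (pr M w x) a)) \<and>
    asg_for M f (restr M c f) \<and> V f (restr M c f))"
    if "is_fm M f" "asg_for M (c_ex M v f) a" for v f a
    using assms[of "c_ex M v f" a] that comp_ex by simp
  let ?S = "{(f, a). is_fm M f \<and> asg_for M f a \<and> V f a}"
  have "\<forall>f a. (f, a) \<in> ?S \<longrightarrow> is_fm M f \<and> asg_for M f a" by simp
  moreover have "\<forall>s t a. is_tm M s \<and> is_tm M t \<and> asg_for M (c_eq M s t) a \<longrightarrow>
        ((c_eq M s t, a) \<in> ?S \<longleftrightarrow> (\<exists>y. is_val M a s y \<and> is_val M a t y))"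
    using 1 by simp
  moreover have "\<forall>f g a. is_fm M f \<and> is_fm M g \<and> asg_for M (c_or M f g) a \<longrightarrow>
        ((c_or M f g, a) \<in> ?S \<longleftrightarrow> (f, restr M a f) \<in> ?S \<or> (g, restr M a g) \<in> ?S)"
  proof (intro allI impI)
    fix f g a assume a: "is_fm M f \<and> is_fm M g \<and> asg_for M (c_or M f g) a"
    then show "(c_or M f g, a) \<in> ?S \<longleftrightarrow> (f, restr M a f) \<in> ?S \<or> (g, restr M a g) \<in> ?S"
      using 2[of f g a] by simp
  qed
  moreover have "\<forall>f a. is_fm M f \<and> asg_for M (c_neg M f) a \<longrightarrow>
        ((c_neg M f, a) \<in> ?S \<longleftrightarrow> (f, a) \<notin> ?S)"
    using 3 by simp
  moreover have "\<forall>v f a. is_fm M f \<and> asg_for M (c_ex M v f) a \<longrightarrow>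
        ((c_ex M v f, a) \<in> ?S \<longleftrightarrow> (\<exists>b. is_asg M b \<and>
          (\<forall>w x. w \<noteq> v \<longrightarrow> (mem M (pr M w x) b \<longleftrightarrow> mem M (pr M w x) a)) \<and> (f, restr M b f) \<in> ?S))"
    using 4 by simp
  ultimately show ?thesis unfolding CS_minus_def by (intro conjI)
qed

lemma comp_closed_sentence:
  assumes "\<And>v. \<not> is_free M v f" "\<And>v. \<not> is_free M v g"
  shows "comp V (c_neg M f) \<zero> \<longleftrightarrow> (V (c_neg M f) \<zero> \<longleftrightarrow> \<not> V f \<zero>)"
    "comp V (c_or M f g) \<zero> \<longleftrightarrow> (V (c_or M f g) \<zero> \<longleftrightarrow> V f \<zero> \<or> V g \<zero>)"
    "comp V (c_ex M v f) \<zero> \<longleftrightarrow> (V (c_ex M v f) \<zero> \<longleftrightarrow> V f \<zero>)"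
proof -
  have a: "asg_for M h \<zero>" if "\<And>v. \<not> is_free M v h" for h
    using asg_for_closed[OF that] by simp
  show "comp V (c_neg M f) \<zero> \<longleftrightarrow> (V (c_neg M f) \<zero> \<longleftrightarrow> \<not> V f \<zero>)"
    by (rule comp_neg) (rule a, simp add: assms)
  have "asg_for M (c_or M f g) \<zero>" by (rule a) (simp add: assms)
  then show "comp V (c_or M f g) \<zero> \<longleftrightarrow> (V (c_or M f g) \<zero> \<longleftrightarrow> V f \<zero> \<or> V g \<zero>)"
    using comp_or[of f g \<zero> V] restr_closed[of f \<zero>] restr_closed[of g \<zero>] assms by simp
  have r: "restr M c f = \<zero>" for c by (rule restr_closed) (rule assms(1))
  have "is_asg M \<zero>" by (simp add: is_asg_def)
  then show "comp V (c_ex M v f) \<zero> \<longleftrightarrow> (V (c_ex M v f) \<zero> \<longleftrightarrow> V f \<zero>)"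
    unfolding comp_ex r using a[OF assms(1)] by auto
qed

text \<open>Closure is under finitely many descents as seen from outside \<open>M\<close>; such a
  set need not be definable, and it may contain infinite descending chains.\<close>

definition subclosed :: "'m set \<Rightarrow> bool" where
  "subclosed D \<longleftrightarrow> (\<forall>f\<in>D. is_fm M f \<and> (\<forall>g. imm f g \<longrightarrow> g \<in> D))"

lemma subclosed_children:
  assumes "subclosed D"
  shows "c_neg M f \<in> D \<Longrightarrow> f \<in> D" "c_or M f g \<in> D \<Longrightarrow> f \<in> D" "c_or M f g \<in> D \<Longrightarrow> g \<in> D"
    "c_ex M v f \<in> D \<Longrightarrow> f \<in> D"
  using assms unfolding subclosed_def imm_def by blast+

text \<open>Induction on the size of \<open>G\<close>, splitting off the formula \<open>m\<close> of
  largest code. If \<open>m\<close> is not in \<open>D\<close>, no formula of \<open>D\<close> or of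
  the rest of \<open>G\<close> has it as a child, by closure of \<open>D\<close> and by size; so its
  value can be dictated by its own clause.\<close>

lemma add_finite:
  assumes D: "subclosed D" "\<And>f a. f \<in> D \<Longrightarrow> asg_for M f a \<Longrightarrow> comp V f a" and "finite G"
  shows "\<exists>V'. (\<forall>f\<in>D. V' f = V f) \<and> (\<forall>f a. f \<in> D \<union> G \<longrightarrow> asg_for M f a \<longrightarrow> comp V' f a)"
  using \<open>finite G\<close>
proof (induction "card G" arbitrary: G)
  case 0
  then show ?case using D(2) by (intro exI[of _ V]) auto
next
  case (Suc n)
  define m where "m = ar.Max G"
  have G: "G \<noteq> {}" "finite G" using Suc by auto
  have m: "m \<in> G" "\<And>g. g \<in> G \<Longrightarrow> g \<preceq> m"
    unfolding m_def using G ar.Max_in ar.Max_ge by auto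
  have "n = card (G - {m})" "finite (G - {m})" using Suc(2) m(1) G(2) by auto
  from Suc(1)[OF this] obtain V' where V': "\<forall>f\<in>D. V' f = V f"
    "\<And>f a. f \<in> D \<union> (G - {m}) \<Longrightarrow> asg_for M f a \<Longrightarrow> comp V' f a" by blast
  show ?case
  proof (cases "m \<in> D")
    case True
    then show ?thesis using V' by (intro exI[of _ V']) blast
  next
    case False
    define W where "W f a = (if f = m then if atm m then tru m a else (\<exists>g b. chn m a g b \<and> V' g b \<noteq> ngm m)
      else V' f a)" for f a
    have "comp W m a" for a
    proof -
      have "chn m a g b \<Longrightarrow> W g b \<longleftrightarrow> V' g b" for g b
        using imm_less[OF chn_imm, of m a g b] by (auto simp: W_def)
      then have "(\<exists>g b. chn m a g b \<and> V' g b \<noteq> ngm m) \<longleftrightarrow> (\<exists>g b. chn m a g b \<and> W g b \<noteq> ngm m)"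
        by blast
      then show ?thesis unfolding comp_def by (simp add: W_def[of m a])
    qed
    moreover have "comp W f a" if f: "f \<in> D \<union> (G - {m})" "asg_for M f a" for f a
    proof -
      have "g \<noteq> m" if "chn f a g b" for g b
        using that f(1) False D(1) m(2)[of f] imm_less[OF chn_imm[OF that]] chn_imm[OF that]
        unfolding subclosed_def by (metis DiffD1 UnE ar.not_le)
      then have "comp W f a \<longleftrightarrow> comp V' f a"
        using f(1) False by (intro comp_cong) (auto simp: W_def)
      then show ?thesis using V'(2) f by blast
    qed
    moreover have "\<forall>f\<in>D. W f = V f" using V'(1) False by (auto simp: W_def fun_eq_iff)
    ultimately show ?thesis by (intro exI[of _ W]) blast
  qed
qed

text \<open>Finite approximations of a valuation consist of a set \<open>T\<close> of true and a set \<open>U\<close> of false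
  pairs.\<close>

definition consis :: "('m \<Rightarrow> 'm \<Rightarrow> bool) \<Rightarrow> ('m \<Rightarrow> 'm \<Rightarrow> bool) \<Rightarrow> bool" where
  "consis T U \<longleftrightarrow> (\<forall>f a. \<not> (T f a \<and> U f a)) \<and>
     (\<forall>f a. atm f \<longrightarrow> (T f a \<longrightarrow> tru f a) \<and> (U f a \<longrightarrow> \<not> tru f a)) \<and>
     (\<forall>f a g b. U f a \<and> \<not> atm f \<and> chn f a g b \<longrightarrow> (ngm f \<longrightarrow> \<not> U g b) \<and> (\<not> ngm f \<longrightarrow> \<not> T g b))"

text \<open>A true compound formula must have a witnessing child among the facts. A false one makes
  a claim on all its children, which is left to \<open>consis\<close> as the facts grow.\<close>

definition decided :: "('m \<Rightarrow> 'm \<Rightarrow> bool) \<Rightarrow> ('m \<Rightarrow> 'm \<Rightarrow> bool) \<Rightarrow> 'm \<Rightarrow> 'm \<Rightarrow> bool" where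
  "decided T U f a \<longleftrightarrow> (T f a \<or> U f a) \<and>
     (T f a \<and> \<not> atm f \<longrightarrow> (\<exists>g b. chn f a g b \<and> (ngm f \<longrightarrow> U g b) \<and> (\<not> ngm f \<longrightarrow> T g b)))"

lemma consis_sub:
  assumes V: "\<And>f a. T f a \<Longrightarrow> V f a" "\<And>f a. U f a \<Longrightarrow> \<not> V f a"
    and c: "\<And>f a. T f a \<or> U f a \<Longrightarrow> comp V f a"
  shows "consis T U"
proof -
  have "\<not> (T f a \<and> U f a)" for f a using V by blast
  moreover have "(T f a \<longrightarrow> tru f a) \<and> (U f a \<longrightarrow> \<not> tru f a)" if "atm f" for f a
    using V[of f a] c[of f a] that unfolding comp_def by auto
  moreover have "(ngm f \<longrightarrow> \<not> U g b) \<and> (\<not> ngm f \<longrightarrow> \<not> T g b)" if "U f a" "\<not> atm f" "chn f a g b" for f a g b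
    using V(2)[OF that(1)] V[of g b] c[of f a] that unfolding comp_def by auto
  ultimately show ?thesis unfolding consis_def by blast
qed

text \<open>A true pair has its witness by \<open>decided\<close>. If a false pair had a child of
  the wrong value, that child would be recorded at some stage, and a later stage containing both
  facts would violate \<open>consis\<close>. Consistency is assumed from stage 1 on because the
  rules of the game check the position reached by a move.\<close>

lemma comp_limit:
  assumes mono: "\<And>n f a. T n f a \<Longrightarrow> T (Suc n) f a" "\<And>n f a. U n f a \<Longrightarrow> U (Suc n) f a"
    and cons: "\<And>n. consis (T (Suc n)) (U (Suc n))"
    and dec: "\<And>f a. f \<in> D \<Longrightarrow> asg_for M f a \<Longrightarrow> \<exists>n. decided (T n) (U n) f a"
    and D: "subclosed D"
  shows "U n f a \<Longrightarrow> \<not> (\<exists>n. T n f a)"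
    and "f \<in> D \<Longrightarrow> asg_for M f a \<Longrightarrow> comp (\<lambda>f a. \<exists>n. T n f a) f a"
proof -
  have mT: "T n f a \<Longrightarrow> n \<le> k \<Longrightarrow> T k f a" for n k f a
    using lift_Suc_mono_le[of "\<lambda>n. T n f a" n k] mono(1) by auto
  have mU: "U n f a \<Longrightarrow> n \<le> k \<Longrightarrow> U k f a" for n k f a
    using lift_Suc_mono_le[of "\<lambda>n. U n f a" n k] mono(2) by auto
  show UT: "\<not> (\<exists>n. T n f a)" if u: "U n f a" for n f a
  proof
    assume "\<exists>n. T n f a"
    then obtain k where "T k f a" ..
    then have "T (Suc (n + k)) f a" "U (Suc (n + k)) f a" using u mT mU by simp_all
    then show False using cons[of "n + k"] unfolding consis_def by blast
  qed
  have total: "(\<exists>n. T n f a) \<or> (\<exists>n. U n f a)" if "f \<in> D" "asg_for M f a" for f a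
    using dec[OF that] unfolding decided_def by blast
  assume f: "f \<in> D" "asg_for M f a"
  let ?V = "\<lambda>f a. \<exists>n. T n f a"
  obtain n where n: "decided (T n) (U n) f a" using dec[OF f] by blast
  have n': "T (Suc n) f a \<or> U (Suc n) f a" using n mono unfolding decided_def by blast
  show "comp ?V f a"
  proof (cases "atm f")
    case True
    then have "?V f a \<longleftrightarrow> tru f a" using n' cons[of n] UT[of "Suc n" f a] unfolding consis_def by blast
    then show ?thesis using True by (simp add: comp_def)
  next
    case False
    have child: "g \<in> D" "asg_for M g b" if "chn f a g b" for g b
      using that D f(1) chn_imm chn_asg_for unfolding subclosed_def by blast+
    have "?V f a \<longleftrightarrow> (\<exists>g b. chn f a g b \<and> ?V g b \<noteq> ngm f)"
    proof
      assume "?V f a"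
      then have "T n f a" using n UT unfolding decided_def by blast
      then obtain g b where "chn f a g b" "ngm f \<longrightarrow> U n g b" "\<not> ngm f \<longrightarrow> T n g b"
        using n False unfolding decided_def by blast
      then show "\<exists>g b. chn f a g b \<and> ?V g b \<noteq> ngm f" using UT by blast
    next
      assume "\<exists>g b. chn f a g b \<and> ?V g b \<noteq> ngm f"
      then obtain g b where gb: "chn f a g b" "?V g b \<noteq> ngm f" by blast
      show "?V f a"
      proof (rule ccontr)
        assume "\<not> ?V f a"
        then have U: "U n f a" using n unfolding decided_def by blast
        obtain k where k: "ngm f \<longrightarrow> U k g b" "\<not> ngm f \<longrightarrow> T k g b"
          using gb(2) total[OF child[OF gb(1)]] by metis
        have "n \<le> Suc (n + k)" "k \<le> Suc (n + k)" by simp_all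
        then have "U (Suc (n + k)) f a" "ngm f \<longrightarrow> U (Suc (n + k)) g b" "\<not> ngm f \<longrightarrow> T (Suc (n + k)) g b"
          using U k mT mU by blast+
        then show False using cons[of "n + k"] False gb(1) unfolding consis_def by blast
      qed
    qed
    then show ?thesis using False by (simp add: comp_def)
  qed
qed

end

context idempotent_op
begin

section \<open>Solutions, and canonical values on the instances of subtemplates\<close>

definition solution :: "'m set \<Rightarrow> ('m \<Rightarrow> 'm \<Rightarrow> bool) \<Rightarrow> bool" where
  "solution D V \<longleftrightarrow> subclosed D \<and> (\<forall>f\<in>D. \<forall>a. asg_for M f a \<longrightarrow> comp V f a) \<and>
     (\<forall>x. F x \<in> D \<longrightarrow> (V (F x) \<zero> \<longleftrightarrow> x \<in> X))"

lemma tru_th: "tru th \<zero> \<longleftrightarrow> p"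
  using th_true unfolding tru_def .

lemma atm_th: "atm th"
  using \<theta>_eq by (auto simp: atm_def)

lemma itf_subclosed: "subclosed itf"
  unfolding subclosed_def imm_def using itf_sentence itf_neg itf_or itf_ex by blast

lemma asg_for_itf: "f \<in> itf \<Longrightarrow> asg_for M f a \<longleftrightarrow> a = \<zero>"
  using asg_for_closed itf_sentence by blast

lemma comp_itv:
  assumes f: "f \<in> itf" and V: "\<And>f. f \<in> itf \<Longrightarrow> V f \<zero> \<longleftrightarrow> itv f"
  shows "comp V f \<zero>"
proof -
  have "is_fm M f" using f itf_sentence by blast
  then consider s t where "f = c_eq M s t" | g where "f = c_neg M g" | g h where "f = c_or M g h"
    | v g where "f = c_ex M v g" using is_fm_unfold by blast
  then show ?thesis
  proof cases
    case 1
    then have "f = th" using itf_eq f by simp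
    then show ?thesis using f V itv_th atm_th tru_th by (simp add: comp_def)
  next
    case 2
    then show ?thesis using f V itf_neg[of g] comp_closed_sentence(1)[of g g V] itf_sentence by auto
  next
    case 3
    then show ?thesis using f V itf_or[of g h] comp_closed_sentence(2)[of g h V] itf_sentence by auto
  next
    case 4
    then show ?thesis using f V itf_ex[of v g] comp_closed_sentence(3)[of g g V v] itf_sentence by auto
  qed
qed

text \<open>Induction on the standard template: a subclosed domain contains the instances of all its
  parts, down to \<theta> and F x. The values of these two are forced, and the clauses determine the
  others upwards from there.\<close>

lemma solution_itv:
  assumes sol: "solution D V" and f: "f \<in> D" "f \<in> itf"
  shows "V f \<zero> \<longleftrightarrow> itv f"
proof -
  have D: "subclosed D" "\<And>f a. f \<in> D \<Longrightarrow> asg_for M f a \<Longrightarrow> comp V f a"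
    "\<And>x. F x \<in> D \<Longrightarrow> V (F x) \<zero> \<longleftrightarrow> x \<in> X" using sol unfolding solution_def by blast+
  have cl: "\<not> is_free M v (t_inst M B th (F x))" for v B x
    using is_free_inst F_sentence by blast
  then have c: "t_inst M B th (F x) \<in> D \<Longrightarrow> comp V (t_inst M B th (F x)) \<zero>" for B x
    using D(2) asg_for_closed by blast
  have "t_inst M B th (F x) \<in> D \<Longrightarrow> V (t_inst M B th (F x)) \<zero> \<longleftrightarrow> t_val B p (x \<in> X)" for B x
  proof (induction B)
    case LetP
    then show ?case using c[of LetP x] atm_th tru_th by (simp add: comp_def)
  next
    case LetQ
    then show ?case using D(3) by simp
  next
    case (TNeg B)
    then have "t_inst M B th (F x) \<in> D" using subclosed_children[OF D(1)] by (metis t_inst.simps(3,5))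
    then show ?case using TNeg c[of "TNeg B" x] comp_closed_sentence(1)[where V = V and f = "t_inst M B th (F x)" and g = "t_inst M B th (F x)", OF cl cl] by simp
  next
    case (TOr B C)
    then have "t_inst M B th (F x) \<in> D" "t_inst M C th (F x) \<in> D"
      using subclosed_children[OF D(1)] by (metis t_inst.simps(4))+
    then show ?case using TOr c[of "TOr B C" x] comp_closed_sentence(2)[where V = V and f = "t_inst M B th (F x)" and g = "t_inst M C th (F x)", OF cl cl] by simp
  next
    case (TEx v B)
    then have "t_inst M B th (F x) \<in> D" using subclosed_children[OF D(1)] by (metis t_inst.simps(3,5))
    then show ?case using TEx c[of "TEx v B" x] comp_closed_sentence(3)[where V = V and f = "t_inst M B th (F x)" and g = "t_inst M B th (F x)" and v = "num M v", OF cl cl] by simp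
  qed
  then show ?thesis using f itv_inst unfolding itf_def by blast
qed

text \<open>Old and canonical values agree on the overlap, and both domains are closed under
  immediate subformulas, so every clause lies within one of the two valuations.\<close>

lemma solution_add_itf:
  assumes sol: "solution D V"
  shows "\<exists>V'. (\<forall>f\<in>D. V' f = V f) \<and> solution (D \<union> itf) V'"
proof -
  define W where "W f a = (if f \<in> D then V f a else itv f)" for f a
  have D: "subclosed D" "\<And>f a. f \<in> D \<Longrightarrow> asg_for M f a \<Longrightarrow> comp V f a"
    using sol unfolding solution_def by blast+
  have W: "f \<in> itf \<Longrightarrow> W f \<zero> \<longleftrightarrow> itv f" for f
    using solution_itv[OF sol] by (simp add: W_def)
  have "comp W f a" if f: "f \<in> D \<union> itf" "asg_for M f a" for f a
  proof (cases "f \<in> D")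
    case True
    have "comp W f a \<longleftrightarrow> comp V f a"
      by (rule comp_cong) (use True D(1) chn_imm in \<open>auto simp: W_def subclosed_def\<close>)
    then show ?thesis using D(2) True f(2) by blast
  next
    case False
    then have "f \<in> itf" "a = \<zero>" using f asg_for_itf[of f a] by auto
    then show ?thesis using comp_itv[of f W] W by simp
  qed
  moreover have "subclosed (D \<union> itf)" using D(1) itf_subclosed unfolding subclosed_def by blast
  moreover have "W (F x) \<zero> \<longleftrightarrow> x \<in> X" for x using W itv_F by simp
  ultimately have "solution (D \<union> itf) W" unfolding solution_def by blast
  moreover have "\<forall>f\<in>D. W f = V f" by (auto simp: W_def fun_eq_iff)
  ultimately show ?thesis by blast
qed

end

context pa
begin

subsection \<open>Extending solutions\<close>

lemma ex_finite_set: "finite Y \<Longrightarrow> \<exists>c. \<forall>y. mem M y c \<longleftrightarrow> y \<in> Y"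
proof (induction Y rule: finite_induct)
  case empty
  show ?case by (rule exI[of _ \<zero>]) simp
next
  case (insert y Y)
  then obtain c where "\<And>z. mem M z c \<longleftrightarrow> z \<in> Y" by blast
  then show ?case using ex_insert[of c y] by auto
qed

text \<open>Reuses \<open>wins_step\<close>: in the game \<open>E\<close> the player moves from 0 to
  any successor and then must count down by one, staying positive. Surviving n rounds from y+1 thus
  means n \<le> y, and an answer to 0 that wins all n gives \<open>k\<close>.\<close>

lemma ex_nonstandard:
  assumes "recursively_saturated M"
  shows "\<exists>k. \<forall>n. num M n \<preceq> k"
proof -
  define E where "E s x s' \<longleftrightarrow> (\<exists>y. s' = \<S> y \<and> (s = \<zero> \<or> s = \<S> (\<S> y)))" for s x s' :: 'm
  have E: "dfn M (\<lambda>e. E (e 0) (e 1) (e 2))" unfolding E_def by (intro dfn_rules)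
  have "wins E n (\<S> (num M n))" for n by (induction n) (auto simp: E_def)
  then have "wins E n \<zero>" for n by (cases n) (auto simp: E_def)
  from wins_step[OF assms E this] obtain s' where s': "E \<zero> \<zero> s'" "\<And>n. wins E n s'" by blast
  then obtain k where k: "s' = \<S> k" by (auto simp: E_def)
  have "wins E n (\<S> y) \<Longrightarrow> num M n \<preceq> y" for n y
    by (induction n arbitrary: y) (auto simp: E_def)
  then show ?thesis using s'(2) k by blast
qed

text \<open>Numbering as in a binary heap: the children of entry i stand at 2i+1 and 2i+2, the slots
  being padded by copies or fillers if there are fewer. Step k of the induction fills two slots; a
  nonstandard length covers all standard entries.\<close>

lemma ex_subformula_sequence:
  assumes "is_fm M f"
  shows "\<exists>a. elt M a \<zero> = f \<and> (\<forall>i. i \<prec> k \<longrightarrow> (\<forall>g. imm (elt M a i) g \<longrightarrow>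
      g = elt M a (\<S> (i \<oplus> i)) \<or> g = elt M a (\<S> (\<S> (i \<oplus> i))))) \<and>
    (\<forall>i. i \<preceq> k \<oplus> k \<longrightarrow> is_fm M (elt M a i))"
proof (rule induct[where P = "\<lambda>k. \<exists>a. elt M a \<zero> = f \<and> (\<forall>i. i \<prec> k \<longrightarrow> (\<forall>g. imm (elt M a i) g \<longrightarrow>
      g = elt M a (\<S> (i \<oplus> i)) \<or> g = elt M a (\<S> (\<S> (i \<oplus> i))))) \<and>
    (\<forall>i. i \<preceq> k \<oplus> k \<longrightarrow> is_fm M (elt M a i))"])
  show "dfn M (\<lambda>e. \<exists>a. elt M a \<zero> = f \<and> (\<forall>i. i \<prec> e 0 \<longrightarrow> (\<forall>g. imm (elt M a i) g \<longrightarrow>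
      g = elt M a (\<S> (i \<oplus> i)) \<or> g = elt M a (\<S> (\<S> (i \<oplus> i))))) \<and>
    (\<forall>i. i \<preceq> e 0 \<oplus> e 0 \<longrightarrow> is_fm M (elt M a i)))"
    unfolding imm_def by (intro dfn_rules)
  obtain a where "elt M a \<zero> = f" using ex_sequence[OF dft_const[of M f], of "\<one>"] zr_lt_sc by blast
  moreover have "i = \<zero>" if "i \<preceq> \<zero>" for i using that zr_le ar.order.antisym by blast
  ultimately show "\<exists>a. elt M a \<zero> = f \<and> (\<forall>i. i \<prec> \<zero> \<longrightarrow> (\<forall>g. imm (elt M a i) g \<longrightarrow>
      g = elt M a (\<S> (i \<oplus> i)) \<or> g = elt M a (\<S> (\<S> (i \<oplus> i))))) \<and>
    (\<forall>i. i \<preceq> \<zero> \<oplus> \<zero> \<longrightarrow> is_fm M (elt M a i))"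
    using assms by (intro exI[of _ a]) auto
next
  fix k
  assume "\<exists>a. elt M a \<zero> = f \<and> (\<forall>i. i \<prec> k \<longrightarrow> (\<forall>g. imm (elt M a i) g \<longrightarrow>
      g = elt M a (\<S> (i \<oplus> i)) \<or> g = elt M a (\<S> (\<S> (i \<oplus> i))))) \<and>
    (\<forall>i. i \<preceq> k \<oplus> k \<longrightarrow> is_fm M (elt M a i))"
  then obtain a where a: "elt M a \<zero> = f" "\<And>i g. i \<prec> k \<Longrightarrow> imm (elt M a i) g \<Longrightarrow>
      g = elt M a (\<S> (i \<oplus> i)) \<or> g = elt M a (\<S> (\<S> (i \<oplus> i)))"
    "\<And>i. i \<preceq> k \<oplus> k \<Longrightarrow> is_fm M (elt M a i)" by blast
  have fk: "is_fm M (elt M a k)" using a(3) by simp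
  then consider (eq) s t where "elt M a k = c_eq M s t" | (neg) g where "elt M a k = c_neg M g"
    | (or) g h where "elt M a k = c_or M g h" | (ex) v g where "elt M a k = c_ex M v g"
    using is_fm_unfold by blast
  then have "\<exists>l r. is_fm M l \<and> is_fm M r \<and> (\<forall>g. imm (elt M a k) g \<longrightarrow> g = l \<or> g = r)"
  proof cases
    case eq
    then show ?thesis using assms by (intro exI[of _ f]) (auto simp: imm_def)
  next
    case (neg g)
    then show ?thesis using fk by (intro exI[of _ g]) (auto simp: imm_def)
  next
    case (or g h)
    then have "is_fm M g \<and> is_fm M h \<and> (\<forall>g'. imm (elt M a k) g' \<longrightarrow> g' = g \<or> g' = h)"
      using fk by (auto simp: imm_def)
    then show ?thesis by blast
  next
    case (ex v g)
    then show ?thesis using fk by (intro exI[of _ g]) (auto simp: imm_def)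
  qed
  then obtain l r where lr: "is_fm M l" "is_fm M r" "\<And>g. imm (elt M a k) g \<Longrightarrow> g = l \<or> g = r" by blast
  define h where "h j = (if j \<preceq> k \<oplus> k then elt M a j else if j = \<S> (k \<oplus> k) then l else r)" for j
  have "dft M (\<lambda>e. h (e 0))" unfolding h_def by (intro dfn_rules)
  from ex_sequence[OF this, of "\<S> (\<S> k \<oplus> \<S> k)"]
  obtain b where b: "\<And>j. j \<preceq> \<S> k \<oplus> \<S> k \<Longrightarrow> elt M b j = h j" by (auto simp: lt_sc_iff)
  have le: "j \<preceq> k \<oplus> k \<Longrightarrow> j \<preceq> \<S> k \<oplus> \<S> k" for j
    using le_sc ar.order.trans by (metis ad_sc sc_ad)
  have old: "elt M b j = elt M a j" if "j \<preceq> k \<oplus> k" for j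
    using that b[OF le] by (simp add: h_def)
  have "g = elt M b (\<S> (i \<oplus> i)) \<or> g = elt M b (\<S> (\<S> (i \<oplus> i)))"
    if i: "i \<prec> \<S> k" and g: "imm (elt M b i) g" for i g
  proof (cases "i = k")
    case True
    have "\<not> \<S> (k \<oplus> k) \<preceq> k \<oplus> k" "\<not> \<S> (\<S> (k \<oplus> k)) \<preceq> k \<oplus> k" "\<S> (k \<oplus> k) \<noteq> k \<oplus> k"
      by (metis lt_sc ar.not_le, metis lt_sc ar.less_trans ar.not_le, metis lt_sc ar.less_irrefl)
    then have "elt M b (\<S> (k \<oplus> k)) = l" "elt M b (\<S> (\<S> (k \<oplus> k))) = r"
      using b[of "\<S> (k \<oplus> k)"] b[of "\<S> (\<S> (k \<oplus> k))"] by (simp_all add: h_def)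
    then show ?thesis using g lr(3) old[of k] True by simp
  next
    case False
    then have ik: "i \<prec> k" using i by (metis lt_sc_iff ar.le_less)
    then have "\<S> i \<preceq> k" by (simp add: sc_le_iff)
    then have "\<S> i \<oplus> \<S> i \<preceq> k \<oplus> k" by (simp only: double_le)
    then have "\<S> (\<S> (i \<oplus> i)) \<preceq> k \<oplus> k" by simp
    moreover from this have "\<S> (i \<oplus> i) \<preceq> k \<oplus> k" using le_sc ar.order.trans by blast
    moreover have "i \<preceq> k \<oplus> k" using ik by (metis ar.less_imp_le ar.order.trans le_ad(1))
    ultimately show ?thesis using a(2)[OF ik] g old by simp
  qed
  moreover have "is_fm M (elt M b i)" if "i \<preceq> \<S> k \<oplus> \<S> k" for i
    using b[OF that] a(3) lr by (simp add: h_def)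
  moreover have "elt M b \<zero> = f" using old[of \<zero>] a(1) by simp
  ultimately show "\<exists>a. elt M a \<zero> = f \<and> (\<forall>i. i \<prec> \<S> k \<longrightarrow> (\<forall>g. imm (elt M a i) g \<longrightarrow>
      g = elt M a (\<S> (i \<oplus> i)) \<or> g = elt M a (\<S> (\<S> (i \<oplus> i))))) \<and>
    (\<forall>i. i \<preceq> \<S> k \<oplus> \<S> k \<longrightarrow> is_fm M (elt M a i))" by blast
qed

text \<open>An iterated disjunction of the members of \<open>Q\<close>, so that one sequence of
  subformulas takes care of all of them.\<close>

lemma ex_common_formula:
  assumes "finite Q" "\<And>f. f \<in> Q \<Longrightarrow> is_fm M f"
  shows "\<exists>f. is_fm M f \<and> (\<forall>D. subclosed D \<and> f \<in> D \<longrightarrow> Q \<subseteq> D)"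
  using assms
proof (induction Q rule: finite_induct)
  case empty
  show ?case by (rule exI[of _ "c_eq M (c_zero M) (c_zero M)"]) simp
next
  case (insert f Q)
  then obtain g where g: "is_fm M g" "\<And>D. subclosed D \<Longrightarrow> g \<in> D \<Longrightarrow> Q \<subseteq> D" by blast
  then show ?case
    using insert.prems[of f] subclosed_children(2,3)[of _ f g]
    by (intro exI[of _ "c_or M f g"]) auto
qed

text \<open>A fact is coded as a pair of a formula and an assignment, marked with 1 for true or 0
  for false; a position consists of a coded set of facts and a clock.\<close>

definition pos :: "'m \<Rightarrow> 'm \<Rightarrow> 'm \<Rightarrow> bool" where "pos q f a \<longleftrightarrow> mem M (pr M (pr M f a) \<one>) q"

definition neg :: "'m \<Rightarrow> 'm \<Rightarrow> 'm \<Rightarrow> bool" where "neg q f a \<longleftrightarrow> mem M (pr M (pr M f a) \<zero>) q"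

lemma add_fact:
  obtains q' where "\<And>y. mem M y q \<Longrightarrow> mem M y q'"
    "\<And>g b. pos q' g b \<longleftrightarrow> pos q g b \<or> g = f \<and> b = a \<and> v"
    "\<And>g b. neg q' g b \<longleftrightarrow> neg q g b \<or> g = f \<and> b = a \<and> \<not> v"
proof -
  obtain q' where "\<And>y. mem M y q' \<longleftrightarrow> mem M y q \<or> y = pr M (pr M f a) (if v then \<one> else \<zero>)"
    using ex_insert by blast
  then show thesis by (intro that[of q']) (auto simp: pos_def neg_def)
qed

end

section \<open>The game on a coded sequence of subformulas\<close>

locale saturated_op = idempotent_op +
  assumes countable: "countable (UNIV :: 'a set)"
    and saturated: "recursively_saturated M"
    and separable: "separable M X"
begin

text \<open>Entry \<open>i\<close> of the sequence \<open>sq\<close> may be challenged from round \<open>i + 1\<close> on; \<open>c\<close> codes the set of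
  those \<open>i\<close> for which this entry is \<open>F x\<close> with \<open>x\<close> in \<open>X\<close>.\<close>

definition move :: "'a \<Rightarrow> 'a \<Rightarrow> 'a \<Rightarrow> 'a \<Rightarrow> 'a \<Rightarrow> bool" where
  "move sq c s x s' \<longleftrightarrow> (\<exists>q t i a q'. s = pr M q t \<and> x = pr M i a \<and> s' = pr M q' (\<S> t) \<and>
     (\<forall>y. mem M y q \<longrightarrow> mem M y q') \<and> consis (pos q') (neg q') \<and>
     (\<forall>i. i \<prec> t \<longrightarrow> (\<forall>x. elt M sq i = F x \<longrightarrow>
        (pos q' (F x) \<zero> \<longrightarrow> mem M i c) \<and> (neg q' (F x) \<zero> \<longrightarrow> \<not> mem M i c))) \<and>
     (i \<prec> t \<and> asg_for M (elt M sq i) a \<longrightarrow> decided (pos q') (neg q') (elt M sq i) a))"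

lemma dfn_move: "dfn M (\<lambda>e. move sq c (e 0) (e 1) (e 2))"
  unfolding move_def consis_def decided_def pos_def neg_def atm_def ngm_def tru_def chn_def
  by (intro dfn_rules)

text \<open>Separability speaks of coded sequences, so the indices of the iterates occurring in
  \<open>sq\<close> are themselves listed in a coded sequence, of nonstandard length in order to
  cover every standard n.\<close>

lemma ex_index_set: "\<exists>c. \<forall>n x. elt M sq (num M n) = F x \<longrightarrow> (mem M (num M n) c \<longleftrightarrow> x \<in> X)"
proof -
  obtain k where k: "\<And>n. num M n \<preceq> k" using ex_nonstandard[OF saturated] by blast
  \<comment> \<open>The description is unique by injectivity of \<open>F\<close>; entries that are
    no iterates get the default 0, about which nothing is claimed.\<close>
  define g where "g i = (if \<exists>x. elt M sq i = F x then THE x. elt M sq i = F x else \<zero>)" for i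
  have g: "y = g i \<longleftrightarrow> (if \<exists>x. elt M sq i = F x then elt M sq i = F y else y = \<zero>)" for y i
  proof (cases "\<exists>x. elt M sq i = F x")
    case True
    then obtain x where x: "elt M sq i = F x" ..
    then have "g i = x" by (auto simp: g_def)
    then show ?thesis using x by auto
  qed (simp add: g_def)
  have "dfn M (\<lambda>e. (\<exists>x. elt M sq (e 1) = F x) \<and> elt M sq (e 1) = F (e 0) \<or>
      \<not> (\<exists>x. elt M sq (e 1) = F x) \<and> e 0 = \<zero>)"
    by (intro dfn_rules)
  then have "dft M (\<lambda>e. g (e 0))" unfolding dft_def g
    by (rule dfn_mono) auto
  from ex_sequence[OF this, of "\<S> k"] obtain b where b: "\<And>n. elt M b (num M n) = g (num M n)"
    using k by (auto simp: lt_sc_iff)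
  obtain c where c: "\<And>n. elt M b (num M n) \<in> X \<longleftrightarrow> mem M (num M n) c"
    using separable unfolding separable_def by blast
  have "mem M (num M n) c \<longleftrightarrow> x \<in> X" if "elt M sq (num M n) = F x" for n x
  proof -
    have "x = g (num M n)" unfolding g using that by auto
    then show ?thesis using b c by metis
  qed
  then show ?thesis by blast
qed

text \<open>The player follows one compositional valuation \<open>V\<close>: a challenged pair
  receives its value there and, if true and compound, a witnessing child as well. While all facts
  come from \<open>V\<close>, consistency is \<open>consis_sub\<close>, and the rule about
  \<open>c\<close> holds because the clock is standard.\<close>

lemma wins_move:
  assumes sq: "\<And>n g. imm (elt M sq (num M n)) g \<Longrightarrow>
      g = elt M sq (num M (2 * n + 1)) \<or> g = elt M sq (num M (2 * n + 2))"
    and c: "\<And>n x. elt M sq (num M n) = F x \<Longrightarrow> mem M (num M n) c \<longleftrightarrow> x \<in> X"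
    and V: "\<And>f a. f \<in> D \<union> (\<lambda>n. elt M sq (num M n)) ` {..<2 * N + 3} \<Longrightarrow> asg_for M f a \<Longrightarrow> comp V f a"
    and VX: "\<And>x. V (F x) \<zero> \<longleftrightarrow> x \<in> X"
  shows "t + m \<le> N \<Longrightarrow>
    (\<And>f a. pos q f a \<Longrightarrow> f \<in> D \<union> (\<lambda>n. elt M sq (num M n)) ` {..<2 * N + 3} \<and> asg_for M f a \<and> V f a) \<Longrightarrow>
    (\<And>f a. neg q f a \<Longrightarrow> f \<in> D \<union> (\<lambda>n. elt M sq (num M n)) ` {..<2 * N + 3} \<and> asg_for M f a \<and> \<not> V f a) \<Longrightarrow>
    wins (move sq c) m (pr M q (num M t))"
proof (induction m arbitrary: q t)
  case (Suc m)
  let ?G = "D \<union> (\<lambda>n. elt M sq (num M n)) ` {..<2 * N + 3}"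
  define good where "good q \<longleftrightarrow> (\<forall>f a. (pos q f a \<longrightarrow> f \<in> ?G \<and> asg_for M f a \<and> V f a) \<and>
    (neg q f a \<longrightarrow> f \<in> ?G \<and> asg_for M f a \<and> \<not> V f a))" for q
  have q: "good q" using Suc.prems(2,3) unfolding good_def by blast
  show ?case
    unfolding wins.simps
  proof
    fix x
    obtain i a where x: "x = pr M i a" using pr_surj by blast
    have "\<exists>q'. (\<forall>y. mem M y q \<longrightarrow> mem M y q') \<and> good q' \<and>
       (i \<prec> num M t \<and> asg_for M (elt M sq i) a \<longrightarrow> decided (pos q') (neg q') (elt M sq i) a)"
    proof (cases "i \<prec> num M t \<and> asg_for M (elt M sq i) a")
      case True
      then obtain j where j: "j < t" "i = num M j" using lt_num_iff by auto
      define f where "f = elt M sq i"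
      have a: "asg_for M f a" using True by (simp add: f_def)
      have fG: "f \<in> ?G" using j Suc.prems(1) by (auto simp: f_def)
      obtain q1 where q1: "\<And>y. mem M y q \<Longrightarrow> mem M y q1"
        "\<And>g b. pos q1 g b \<longleftrightarrow> pos q g b \<or> g = f \<and> b = a \<and> V f a"
        "\<And>g b. neg q1 g b \<longleftrightarrow> neg q g b \<or> g = f \<and> b = a \<and> \<not> V f a"
        by (rule add_fact[of q f a "V f a"]) (rule that)
      have good1: "good q1" using q a fG unfolding good_def q1 by blast
      show ?thesis
      proof (cases "V f a \<and> \<not> atm f")
        case True
        then obtain g b where gb: "chn f a g b" "V g b \<noteq> ngm f"
          using V[OF fG a] unfolding comp_def by auto
        \<comment> \<open>Entry \<open>j\<close> lies below \<open>N\<close>, so its children, at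
          2j+1 and 2j+2, are still among the first 2N+3 entries.\<close>
        have "g \<in> (\<lambda>n. elt M sq (num M n)) ` {..<2 * N + 3}"
          using sq[of j g] chn_imm[OF gb(1)] j Suc.prems(1) by (force simp: f_def simp del: num_Suc)
        then have g: "g \<in> ?G" "asg_for M g b" using chn_asg_for[OF gb(1)] by auto
        obtain q2 where q2: "\<And>y. mem M y q1 \<Longrightarrow> mem M y q2"
          "\<And>g' b'. pos q2 g' b' \<longleftrightarrow> pos q1 g' b' \<or> g' = g \<and> b' = b \<and> V g b"
          "\<And>g' b'. neg q2 g' b' \<longleftrightarrow> neg q1 g' b' \<or> g' = g \<and> b' = b \<and> \<not> V g b"
          by (rule add_fact[of q1 g b "V g b"]) (rule that)
        have "good q2" using good1 g unfolding good_def q2 by blast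
        moreover have "decided (pos q2) (neg q2) f a"
          unfolding decided_def q2 q1 using True gb by blast
        ultimately show ?thesis using q1(1) q2(1) f_def by blast
      next
        case False
        then have "decided (pos q1) (neg q1) f a" using good1 unfolding decided_def q1 good_def by blast
        then show ?thesis using q1(1) good1 f_def by blast
      qed
    next
      case False
      then show ?thesis using q by blast
    qed
    then obtain q' where q': "\<And>y. mem M y q \<Longrightarrow> mem M y q'" "good q'"
      "i \<prec> num M t \<and> asg_for M (elt M sq i) a \<longrightarrow> decided (pos q') (neg q') (elt M sq i) a" by blast
    have "consis (pos q') (neg q')"
      by (rule consis_sub[where V = V]) (use q'(2) V in \<open>unfold good_def, blast+\<close>)
    moreover have "(pos q' (F y) \<zero> \<longrightarrow> mem M k c) \<and> (neg q' (F y) \<zero> \<longrightarrow> \<not> mem M k c)"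
      if "k \<prec> num M t" "elt M sq k = F y" for k y
      using that c VX q'(2) unfolding good_def lt_num_iff by blast
    ultimately have "move sq c (pr M q (num M t)) x (pr M q' (\<S> (num M t)))"
      unfolding move_def x pr_inject using q' by blast
    moreover have "wins (move sq c) m (pr M q' (num M (Suc t)))"
      by (rule Suc.IH) (use Suc.prems(1) q'(2) in \<open>auto simp: good_def\<close>)
    ultimately show "\<exists>s'. move sq c (pr M q (num M t)) x s' \<and> wins (move sq c) m s'" by auto
  qed
qed simp

text \<open>A challenge to entry n is binding only once the clock has passed n, so each one must
  recur arbitrarily late; a dummy second component in the pairing achieves this.\<close>

lemma ex_challenges: "\<exists>ch :: nat \<Rightarrow> nat \<times> 'a. \<forall>n a k. \<exists>t\<ge>k. ch t = (n, a)"
proof -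
  obtain e :: "nat \<Rightarrow> nat \<times> 'a" where e: "range e = UNIV"
    using uncountable_def countable by (metis countable_SIGMA countableI_type UNIV_Times_UNIV UNIV_not_empty)
  have "\<exists>t\<ge>k. e (fst (prod_decode t)) = (n, a)" for n a k
  proof -
    obtain m where "e m = (n, a)" using e by (metis UNIV_I imageE)
    then show ?thesis by (intro exI[of _ "prod_encode (m, k)"]) (simp add: le_prod_encode_2)
  qed
  then show ?thesis by (intro exI[of _ "\<lambda>t. e (fst (prod_decode t))"]) blast
qed

end

section \<open>Extension of solutions and construction of the satisfaction class\<close>

lemma (in pa) num_add: "num M (m + n) = num M m \<oplus> num M n"
  by (induction m) simp_all

context saturated_op
begin

text \<open>\<open>P\<close> holds the pairs whose values are to be preserved, \<open>Q\<close> the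
  formulas to be covered; the new domain may omit the rest of \<open>D\<close>.\<close>

lemma solution_extend:
  assumes sol: "solution D V"
    and P: "finite P" "\<And>f a. (f, a) \<in> P \<Longrightarrow> f \<in> D \<and> asg_for M f a"
    and Q: "finite Q" "\<And>f. f \<in> Q \<Longrightarrow> is_fm M f"
  shows "\<exists>D' V'. solution D' V' \<and> Q \<subseteq> D' \<and> (\<forall>f a. (f, a) \<in> P \<longrightarrow> (V' f a \<longleftrightarrow> V f a))"
proof -
  \<comment> \<open>All iterates get their required values before the game, so that the valuation
    followed by the player agrees with \<open>X\<close> wherever the sequence meets an
    iterate.\<close>
  obtain V1 where V1: "\<And>f. f \<in> D \<Longrightarrow> V1 f = V f" "solution (D \<union> itf) V1"
    using solution_add_itf[OF sol] by blast
  obtain \<phi> where \<phi>: "is_fm M \<phi>" "\<And>D. subclosed D \<Longrightarrow> \<phi> \<in> D \<Longrightarrow> Q \<subseteq> D"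
    using ex_common_formula[OF Q] by blast
  obtain k where k: "\<And>n. num M n \<preceq> k" using ex_nonstandard[OF saturated] by blast
  obtain sq where sq: "elt M sq \<zero> = \<phi>"
    "\<And>i g. i \<prec> k \<Longrightarrow> imm (elt M sq i) g \<Longrightarrow>
      g = elt M sq (\<S> (i \<oplus> i)) \<or> g = elt M sq (\<S> (\<S> (i \<oplus> i)))"
    "\<And>i. i \<preceq> k \<oplus> k \<Longrightarrow> is_fm M (elt M sq i)"
    using ex_subformula_sequence[OF \<phi>(1), of k] by blast
  have sq_imm: "g = elt M sq (num M (2 * n + 1)) \<or> g = elt M sq (num M (2 * n + 2))"
    if "imm (elt M sq (num M n)) g" for n g
  proof -
    have "num M n \<prec> k" using k[of "Suc n"] by (simp add: sc_le_iff)
    moreover have "num M (2 * n + 1) = \<S> (num M n \<oplus> num M n)"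
      "num M (2 * n + 2) = \<S> (\<S> (num M n \<oplus> num M n))" by (simp_all add: mult_2 num_add)
    ultimately show ?thesis using sq(2) that by metis
  qed
  have sq_fm: "is_fm M (elt M sq (num M n))" for n
    using sq(3)[of "num M n"] k[of n] le_ad(1)[of k k] ar.order.trans by blast
  \<comment> \<open>Only standard indices are taken; they are closed under passing from n to 2n+1
    and 2n+2.\<close>
  define D' where "D' = range (\<lambda>n. elt M sq (num M n))"
  have D': "subclosed D'" unfolding subclosed_def D'_def using sq_imm sq_fm by blast
  have QD: "Q \<subseteq> D'" using \<phi>(2)[OF D'] sq(1) unfolding D'_def by (metis num_0 rangeI)
  obtain c where c: "\<And>n x. elt M sq (num M n) = F x \<Longrightarrow> mem M (num M n) c \<longleftrightarrow> x \<in> X"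
    using ex_index_set by blast
  have "finite ((\<lambda>(f, a). pr M (pr M f a) (if V f a then \<one> else \<zero>)) ` P)" using P(1) by simp
  then obtain q0 where q0:
    "\<And>y. mem M y q0 \<longleftrightarrow> y \<in> (\<lambda>(f, a). pr M (pr M f a) (if V f a then \<one> else \<zero>)) ` P"
    using ex_finite_set by blast
  have pos0: "pos q0 f a \<longleftrightarrow> (f, a) \<in> P \<and> V f a" and neg0: "neg q0 f a \<longleftrightarrow> (f, a) \<in> P \<and> \<not> V f a" for f a
    unfolding pos_def neg_def q0 by (force split: if_splits)+
  \<comment> \<open>The valuation \<open>W\<close> that the player follows depends on
    \<open>N\<close>; saturation turns these separate strategies into a single infinite
    play.\<close>
  have "wins (move sq c) N (pr M q0 (num M 0))" for N
  proof -
    define G where "G = (\<lambda>n. elt M sq (num M n)) ` {..<2 * N + 3}"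
    have "finite G" by (simp add: G_def)
    moreover have "subclosed (D \<union> itf)" "\<And>f a. f \<in> D \<union> itf \<Longrightarrow> asg_for M f a \<Longrightarrow> comp V1 f a"
      and V1F: "\<And>x. V1 (F x) \<zero> \<longleftrightarrow> x \<in> X"
      using V1(2) unfolding solution_def by simp_all
    ultimately obtain W where W: "\<And>f. f \<in> D \<union> itf \<Longrightarrow> W f = V1 f"
      "\<And>f a. f \<in> D \<union> itf \<union> G \<Longrightarrow> asg_for M f a \<Longrightarrow> comp W f a"
      using add_finite[of "D \<union> itf" V1 G] by metis
    have WV: "f \<in> D \<Longrightarrow> W f a \<longleftrightarrow> V f a" for f a using W(1)[of f] V1(1)[of f] by simp
    show ?thesis
    proof (rule wins_move[where D = "D \<union> itf" and N = N and V = W])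
      show "W (F x) \<zero> \<longleftrightarrow> x \<in> X" for x using W(1)[of "F x"] V1F by simp
      show "comp W f a" if "f \<in> D \<union> itf \<union> (\<lambda>n. elt M sq (num M n)) ` {..<2 * N + 3}" "asg_for M f a" for f a
        using W(2) that unfolding G_def by blast
      show "f \<in> D \<union> itf \<union> (\<lambda>n. elt M sq (num M n)) ` {..<2 * N + 3} \<and> asg_for M f a \<and> W f a"
        if "pos q0 f a" for f a using that P(2) WV unfolding pos0 by blast
      show "f \<in> D \<union> itf \<union> (\<lambda>n. elt M sq (num M n)) ` {..<2 * N + 3} \<and> asg_for M f a \<and> \<not> W f a"
        if "neg q0 f a" for f a using that P(2) WV unfolding neg0 by blast
    qed (use sq_imm c in auto)
  qed
  obtain ch :: "nat \<Rightarrow> nat \<times> 'a" where ch: "\<And>n a k. \<exists>t\<ge>k. ch t = (n, a)"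
    using ex_challenges by blast
  obtain S where S: "S 0 = pr M q0 (num M 0)"
    "\<And>t. move sq c (S t) (pr M (num M (fst (ch t))) (snd (ch t))) (S (Suc t))"
    using closed_game[OF saturated dfn_move \<open>\<And>N. wins (move sq c) N (pr M q0 (num M 0))\<close>,
        of "\<lambda>t. pr M (num M (fst (ch t))) (snd (ch t))"] by blast
  have "\<exists>q. S t = pr M q (num M t)" for t
  proof (induction t)
    case 0 then show ?case using S(1) by blast
  next
    case (Suc t) then show ?case using S(2)[of t] unfolding move_def by auto
  qed
  then obtain q where q: "\<And>t. S t = pr M (q t) (num M t)" by metis
  have "q 0 = q0" using q[of 0] S(1) by simp
  have step: "(\<forall>y. mem M y (q t) \<longrightarrow> mem M y (q (Suc t))) \<and> consis (pos (q (Suc t))) (neg (q (Suc t))) \<and>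
     (\<forall>i. i \<prec> num M t \<longrightarrow> (\<forall>x. elt M sq i = F x \<longrightarrow>
        (pos (q (Suc t)) (F x) \<zero> \<longrightarrow> mem M i c) \<and> (neg (q (Suc t)) (F x) \<zero> \<longrightarrow> \<not> mem M i c))) \<and>
     (num M (fst (ch t)) \<prec> num M t \<and> asg_for M (elt M sq (num M (fst (ch t)))) (snd (ch t)) \<longrightarrow>
        decided (pos (q (Suc t))) (neg (q (Suc t))) (elt M sq (num M (fst (ch t)))) (snd (ch t)))" for t
    using S(2)[of t] unfolding move_def q by (elim exE conjE) simp
  define V' where "V' f a \<longleftrightarrow> (\<exists>t. pos (q t) f a)" for f a
  have dec: "\<exists>t>n. decided (pos (q (Suc t))) (neg (q (Suc t))) (elt M sq (num M n)) a"
    if "asg_for M (elt M sq (num M n)) a" for n a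
  proof -
    obtain t where t: "t \<ge> Suc n" "ch t = (n, a)" using ch by blast
    then have "num M n \<prec> num M t" using lt_num_iff by auto
    then show ?thesis using step[of t] t that by (intro exI[of _ t]) simp
  qed
  have mono: "pos (q n) f a \<Longrightarrow> pos (q (Suc n)) f a" "neg (q n) f a \<Longrightarrow> neg (q (Suc n)) f a" for n f a
    using step unfolding pos_def neg_def by blast+
  have dec': "\<exists>n. decided (pos (q n)) (neg (q n)) f a" if "f \<in> D'" "asg_for M f a" for f a
    using dec that unfolding D'_def by blast
  note limit = comp_limit[of "\<lambda>n. pos (q n)" "\<lambda>n. neg (q n)" D', OF mono _ dec' D', folded V'_def]
  have neg_V': "neg (q n) f a \<Longrightarrow> \<not> V' f a" for n f a
    using limit(1) step by blast
  have comp: "f \<in> D' \<Longrightarrow> asg_for M f a \<Longrightarrow> comp V' f a" for f a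
    using limit(2) step by blast
  have "V' (F x) \<zero> \<longleftrightarrow> x \<in> X" if Fx: "F x \<in> D'" for x
  proof -
    obtain n where n: "elt M sq (num M n) = F x" using Fx unfolding D'_def by auto
    have "asg_for M (F x) \<zero>" using asg_for_itf F_itf by blast
    then obtain t where t: "t > n" "decided (pos (q (Suc t))) (neg (q (Suc t))) (F x) \<zero>"
      using dec[of n \<zero>] n by auto
    \<comment> \<open>The clock has passed \<open>n\<close>, so the rule about \<open>c\<close>
      applies to this entry.\<close>
    have "num M n \<prec> num M t" using t(1) lt_num_iff by auto
    then have "pos (q (Suc t)) (F x) \<zero> \<Longrightarrow> x \<in> X" "neg (q (Suc t)) (F x) \<zero> \<Longrightarrow> x \<notin> X"
      using step[of t] n c by blast+
    then show ?thesis using t(2) neg_V' unfolding decided_def V'_def by blast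
  qed
  then have "solution D' V'" unfolding solution_def using D' comp by blast
  moreover have "V' f a \<longleftrightarrow> V f a" if "(f, a) \<in> P" for f a
    using that pos0 neg0 neg_V'[of 0 f a] \<open>q 0 = q0\<close> unfolding V'_def by metis
  ultimately show ?thesis using QD by blast
qed

text \<open>A stage is a triple \<open>(D, V, P)\<close>. Domain and valuation are replaced at each
  step; the values on the finite set \<open>P\<close> persist and are recorded by \<open>T\<close>
  and \<open>U\<close>. An enumeration of all pairs of a formula and an assignment for it ensures
  that each is decided at some stage.\<close>

lemma ex_satisfaction_class: "\<exists>S. CS_minus M S \<and> (\<forall>x. truth M S (F x) \<longleftrightarrow> x \<in> X)"
proof -
  define inv where "inv \<sigma> \<longleftrightarrow> (case \<sigma> of (D, V, P) \<Rightarrow> solution D V \<and> finite P \<and>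
    (\<forall>f a. (f, a) \<in> P \<longrightarrow> f \<in> D \<and> asg_for M f a))" for \<sigma> :: "'a set \<times> ('a \<Rightarrow> 'a \<Rightarrow> bool) \<times> ('a \<times> 'a) set"
  define T where "T \<sigma> f a \<longleftrightarrow> (case \<sigma> of (D, V, P) \<Rightarrow> (f, a) \<in> P \<and> V f a)"
    for \<sigma> :: "'a set \<times> ('a \<Rightarrow> 'a \<Rightarrow> bool) \<times> ('a \<times> 'a) set" and f a
  define U where "U \<sigma> f a \<longleftrightarrow> (case \<sigma> of (D, V, P) \<Rightarrow> (f, a) \<in> P \<and> \<not> V f a)"
    for \<sigma> :: "'a set \<times> ('a \<Rightarrow> 'a \<Rightarrow> bool) \<times> ('a \<times> 'a) set" and f a
  define R where "R u \<sigma> \<sigma>' \<longleftrightarrow> (\<forall>f a. T \<sigma> f a \<longrightarrow> T \<sigma>' f a) \<and> (\<forall>f a. U \<sigma> f a \<longrightarrow> U \<sigma>' f a) \<and>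
    decided (T \<sigma>') (U \<sigma>') (fst u) (snd u)"
    for u :: "'a \<times> 'a" and \<sigma> \<sigma>' :: "'a set \<times> ('a \<Rightarrow> 'a \<Rightarrow> bool) \<times> ('a \<times> 'a) set"
  define nodes where "nodes = {(f, a). is_fm M f \<and> asg_for M f a}"
  have step: "\<exists>\<sigma>'. inv \<sigma>' \<and> R u \<sigma> \<sigma>'" if \<sigma>: "inv \<sigma>" and u: "u \<in> nodes" for \<sigma> u
  proof -
    obtain D V P where \<sigma>_eq: "\<sigma> = (D, V, P)" by (cases \<sigma>)
    obtain f a where u_eq: "u = (f, a)" by (cases u)
    have f: "is_fm M f" "asg_for M f a" using u by (simp_all add: u_eq nodes_def)
    have DVP: "solution D V" "finite P" "\<And>f a. (f, a) \<in> P \<Longrightarrow> f \<in> D \<and> asg_for M f a"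
      using \<sigma> by (auto simp: inv_def \<sigma>_eq)
    have "is_fm M g" if "g \<in> insert f (fst ` P)" for g
      using that f(1) DVP(1,3) unfolding solution_def subclosed_def by auto
    then obtain D' V' where D': "solution D' V'" "insert f (fst ` P) \<subseteq> D'"
      "\<And>f a. (f, a) \<in> P \<Longrightarrow> V' f a \<longleftrightarrow> V f a"
      using solution_extend[OF DVP(1-3), of "insert f (fst ` P)"] DVP(2) by blast
    \<comment> \<open>If the chosen pair is true and compound, a witnessing child joins the facts to
      be preserved; later valuations are free elsewhere.\<close>
    have "\<exists>P'. finite P' \<and> insert (f, a) P \<subseteq> P' \<and> (\<forall>f a. (f, a) \<in> P' \<longrightarrow> f \<in> D' \<and> asg_for M f a) \<and>
      decided (\<lambda>f a. (f, a) \<in> P' \<and> V' f a) (\<lambda>f a. (f, a) \<in> P' \<and> \<not> V' f a) f a"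
    proof -
      have P1: "\<And>g b. (g, b) \<in> insert (f, a) P \<Longrightarrow> g \<in> D' \<and> asg_for M g b"
        using D'(2) DVP(3) f(2) by force
      show ?thesis
      proof (cases "V' f a \<and> \<not> atm f")
        case True
        have "f \<in> D'" using D'(2) by simp
        then have "comp V' f a" using D'(1) f(2) unfolding solution_def by blast
        then obtain g b where gb: "chn f a g b" "V' g b \<noteq> ngm f" using True unfolding comp_def by auto
        have "g \<in> D'" "asg_for M g b"
          using D'(1) \<open>f \<in> D'\<close> chn_imm[OF gb(1)] chn_asg_for[OF gb(1)]
          unfolding solution_def subclosed_def by blast+
        then show ?thesis
          by (intro exI[of _ "insert (g, b) (insert (f, a) P)"])
            (use True gb DVP(2) P1 in \<open>auto simp: decided_def\<close>)
      next
        case False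
        then show ?thesis
          by (intro exI[of _ "insert (f, a) P"]) (use DVP(2) P1 in \<open>auto simp: decided_def\<close>)
      qed
    qed
    then obtain P' where P': "finite P'" "insert (f, a) P \<subseteq> P'"
      "\<And>f a. (f, a) \<in> P' \<Longrightarrow> f \<in> D' \<and> asg_for M f a"
      "decided (\<lambda>f a. (f, a) \<in> P' \<and> V' f a) (\<lambda>f a. (f, a) \<in> P' \<and> \<not> V' f a) f a" by blast
    have "inv (D', V', P')" using D'(1) P'(1,3) by (simp add: inv_def)
    moreover have TU: "T (D, V, P) = (\<lambda>f a. (f, a) \<in> P \<and> V f a)"
      "U (D, V, P) = (\<lambda>f a. (f, a) \<in> P \<and> \<not> V f a)" for D V P
      by (simp_all add: T_def U_def fun_eq_iff)
    have "R u \<sigma> (D', V', P')"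
      unfolding R_def \<sigma>_eq u_eq TU fst_conv snd_conv using P'(2,4) D'(3) by blast
    ultimately show ?thesis by blast
  qed
  have "(th, \<zero>) \<in> nodes" using asg_for_itf[of th \<zero>] F_itf[of \<zero>] by (simp add: nodes_def)
  moreover have "Countable_Set.countable nodes"
  proof -
    have "Countable_Set.countable (UNIV \<times> UNIV :: ('a \<times> 'a) set)" using countable by blast
    then show ?thesis using countable_subset by (metis UNIV_Times_UNIV subset_UNIV)
  qed
  ultimately obtain en :: "nat \<Rightarrow> 'a \<times> 'a" where en: "range en = nodes"
    using range_from_nat_into by (metis empty_iff)
  have "\<exists>\<sigma>. inv \<sigma>"
  proof -
    have "solution {} V" for V by (simp add: solution_def subclosed_def)
    then show ?thesis by (intro exI[of _ "({}, \<lambda>_ _. True, {})"]) (simp add: inv_def)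
  qed
  then have "\<exists>\<sigma>. \<forall>n. inv (\<sigma> n) \<and> R (en n) (\<sigma> n) (\<sigma> (Suc n))"
    by (intro dependent_nat_choice step) (use en in blast)+
  then obtain \<sigma> where \<sigma>: "\<And>n. inv (\<sigma> n)" "\<And>n. R (en n) (\<sigma> n) (\<sigma> (Suc n))" by blast
  have mono: "T (\<sigma> n) f a \<Longrightarrow> T (\<sigma> (Suc n)) f a" "U (\<sigma> n) f a \<Longrightarrow> U (\<sigma> (Suc n)) f a" for n f a
    using \<sigma>(2)[of n] unfolding R_def by blast+
  have cons: "consis (T (\<sigma> n)) (U (\<sigma> n))" for n
  proof -
    obtain D V P where eq: "\<sigma> n = (D, V, P)" by (cases "\<sigma> n")
    show ?thesis
      by (rule consis_sub[where V = V])
        (use \<sigma>(1)[of n] in \<open>auto simp: eq T_def U_def inv_def solution_def\<close>)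
  qed
  have dec: "\<exists>n. decided (T (\<sigma> n)) (U (\<sigma> n)) f a" if "f \<in> Collect (is_fm M)" "asg_for M f a" for f a
  proof -
    have "(f, a) \<in> range en" using that unfolding en nodes_def by simp
    then obtain n where "en n = (f, a)" by (metis imageE)
    then show ?thesis using \<sigma>(2)[of n] unfolding R_def by auto
  qed
  have sub: "subclosed (Collect (is_fm M))" unfolding subclosed_def using imm_is_fm by blast
  note limit = comp_limit[of "\<lambda>n. T (\<sigma> n)" "\<lambda>n. U (\<sigma> n)" "Collect (is_fm M)", OF mono cons dec sub]
  define V where "V f a \<longleftrightarrow> (\<exists>n. T (\<sigma> n) f a)" for f a
  have "comp V f a" if "is_fm M f" "asg_for M f a" for f a
    using limit(2)[of f a] that unfolding V_def by simp
  then have "CS_minus M {(f, a). is_fm M f \<and> asg_for M f a \<and> V f a}" by (rule CS_minus_comp)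
  moreover have "truth M {(f, a). is_fm M f \<and> asg_for M f a \<and> V f a} (F x) \<longleftrightarrow> x \<in> X" for x
  proof -
    have Fx: "is_fm M (F x)" "asg_for M (F x) \<zero>"
      using F_sentence asg_for_itf[of "F x" \<zero>] by auto
    then obtain n where n: "decided (T (\<sigma> n)) (U (\<sigma> n)) (F x) \<zero>" using dec by blast
    have "T (\<sigma> n) (F x) \<zero> \<Longrightarrow> x \<in> X" "U (\<sigma> n) (F x) \<zero> \<Longrightarrow> x \<notin> X"
      using \<sigma>(1)[of n] by (auto simp: T_def U_def inv_def solution_def split: prod.splits)
    then have "V (F x) \<zero> \<longleftrightarrow> x \<in> X"
      using n limit(1)[of n "F x" \<zero>] unfolding decided_def V_def by blast
    then show ?thesis using Fx by (simp add: truth_def)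
  qed
  ultimately show ?thesis by blast
qed

end

theorem theorem2p8:
  fixes M :: "'m arith" and \<theta> :: fm and F :: "'m \<Rightarrow> 'm" and X :: "'m set"
  assumes "countable (UNIV :: 'm set)"
    and "model_of_PA M"
    and "recursively_saturated M"
    and "sentence \<theta>" and "atomic \<theta>"
    and "local_idempotent_operator M \<theta> F"
    and "separable M X"
    and "\<And>x. x \<in> X \<Longrightarrow> sc M x \<in> X"
    and "\<And>x. sc M x \<in> X \<Longrightarrow> x \<in> X"
    and "\<And>n. num M n \<in> X \<longleftrightarrow> models M \<theta>"
  shows "\<exists>S. CS_minus M S \<and>
     (models M \<theta> \<longrightarrow> X = {x. truth M S (F x) \<longleftrightarrow> truth M S (fm_code M \<theta>)}) \<and>
     (\<not> models M \<theta> \<longrightarrow> X = {x. \<not> (truth M S (F x) \<longleftrightarrow> truth M S (fm_code M \<theta>))})"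
proof -
  obtain A where A: "idempotent_template M \<theta> A" "F = iterate M \<theta> A"
    using assms(6) unfolding local_idempotent_operator_def by blast
  have X: "zr M \<in> X \<longleftrightarrow> models M \<theta>" using assms(10)[of 0] by (simp add: num_def)
  interpret saturated_op M \<theta> A X
    by unfold_locales (use assms A X in blast)+
  obtain S where S: "CS_minus M S" "\<And>x. truth M S (F x) \<longleftrightarrow> x \<in> X"
    using ex_satisfaction_class A(2) by blast
  \<comment> \<open>As F 0 = \<theta>, and 0 lies in \<open>X\<close> exactly if \<theta> holds,
    T(\<theta>) has the actual truth value of \<theta>; both equations then follow from
    \<open>S(2)\<close>.\<close>
  have "truth M S (fm_code M \<theta>) \<longleftrightarrow> models M \<theta>"
    using S(2)[of "zr M"] X A(2) F_zr by simp
  then show ?thesis using S by (intro exI[of _ S]) auto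
qed

end
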